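(* The union of the network classes $\mathcal{N}_{1},\mathcal{N}_{2},\mathcal{N}_{3}$, $\mathcal{N}_{5},\mathcal{N}_{6},\mathcal{N}_{7},\mathcal{N}_{8},\mathcal{N}_{9}$, $\mathcal{N}_{17}$, $\mathcal{N}_{18}$, $\mathcal{N}_{20},\mathcal{N}_{21},\ldots,\mathcal{N}_{27}$, $\mathcal{N}_{29}$, $\mathcal{N}_{30}$, $\mathcal{N}_{17}^{p}$, $\mathcal{N}_{18}^{p}$, $\mathcal{N}_{20}^{p},\mathcal{N}_{21}^{p},\ldots,\mathcal{N}_{27}^{p}$, $\mathcal{N}_{29}^{p}$ and $\mathcal{N}_{30}^{p}$ is a minimal generating set for $\mathcal{Z}_{1,2}$.
   Context: **Networks.** One-port networks are built from resistors (impedance $R$), inductors (impedance $Ls$, $L>0$) and capacitors (impedance $1/(Cs)$, $C>0$). A single element is a series-parallel network, and a series or parallel connection of two series-parallel networks is a series-parallel network. A series connection of networks with impedances $Z_1,Z_2$ has impedance $Z_1+Z_2$; a parallel connection has impedance $Z$ with $1/Z=1/Z_1+1/Z_2$, written $Z_1\parallel Z_2$. Below, an expression built with $+$ and $\parallel$ describes the network with the corresponding series and parallel connections. A resistor with resistance $R=0$ is a short circuit, and a resistor with conductance $G=0$ (written $1/G$) is an open circuit; such resistors are regarded as removed and are not counted as elements. Energy storage elements are the inductors and capacitors. **Transformations.** For a series-parallel network $N$ with impedance $Z(s)$: $N^{i}$ is obtained by replacing inductors with impedance $Xs$ by capacitors with impedance $X/s$ and vice versa (impedance $Z(1/s)$);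 $N^{d}$ is obtained by interchanging series and parallel connections and inverting the impedance of each element (impedance $1/Z(s)$); $N^{p}=(N^{i})^{d}=(N^{d})^{i}$. For a class $\mathcal{N}$, $\mathcal{N}^{p}=\{N^{p}: N\in\mathcal{N}\}$. **Impedance sets and generating sets.** $\mathcal{Z}_{m,n}$ is the set of impedances of series-parallel networks containing at most $m$ capacitors and at most $n$ inductors. A set $\mathcal{G}$ is a generating set for $\mathcal{Z}_{m,n}$ if (i) $\mathcal{G}$ is a set of series-parallel networks, each containing at most $m+n$ energy storage elements, and (ii) for every $Z\in\mathcal{Z}_{m,n}$ there is a network in $\mathcal{G}$ whose impedance is $Z$. It is a minimal generating set if in addition it is a union of generic network classes. **Generic classes.** For a network class $\mathcal{N}$ whose networks contain $n$ energy storage elements, its realizability set is the set of coefficient vectors $(p_0,\ldots,p_n,q_0,\ldots,q_n)\in\mathbb{R}^{2n+2}$, with $p_n,q_n$ not both zero, such that $p/q$, with $p(s)=\sum_k p_ks^k$ and $q(s)=\sum_k q_ks^k$, is the impedance of a network in $\mathcal{N}$. The dimension of a semi-algebraic set $\mathcal{S}$ is the largest $d$ such that there is a one-to-one smooth map from $(-1,1)^d$ into $\mathcal{S}$. The class $\mathcal{N}$ is generic if every network in $\mathcal{N}$ contains strictly fewer elements than the dimension of the realizability set of $\mathcal{N}$. **Network classes.** $\mathcal{N}_k$ is the set of all networks of the form $N_k$ with parameters satisfying: all $R_j\ge 0$, all $G_j\ge 0$, all $C_j,L_j>0$, and additionally $R_2>0$ in $N_5$ and $N_{14}$. - $N_1$: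 $R_1$. - $N_2$: $R_1+\left(\frac1{G_2}\parallel\frac1{C_1s}\right)$. - $N_3$: $R_1+\left(\frac1{G_2}\parallel L_1s\right)$. - $N_5$: $R_1+\left(L_2s\parallel\left(R_2+\left(\frac1{G_3}\parallel L_1s\right)\right)\right)$. - $N_6$: $R_1+\left(L_1s\parallel\left(R_2+\left(\frac1{G_3}\parallel\frac1{C_1s}\right)\right)\right)$. - $N_7$: $R_1+\left(\frac1{C_1s}\parallel\left(R_2+\left(\frac1{G_3}\parallel L_1s\right)\right)\right)$. - $N_8$: $\frac1{G_1}\parallel\left(\frac1{C_1s}+\left(\frac1{G_2}\parallel(R_3+L_1s)\right)\right)$. - $N_9$: $\frac1{G_1}\parallel\left(L_1s+\left(\frac1{G_2}\parallel\left(R_3+\frac1{C_1s}\right)\right)\right)$. - $N_{10}$: $R_4+\left[(R_5+L_2s)\parallel\left(R_1+\left(L_1s\parallel\left(R_2+\left(\frac1{G_3}\parallel\frac1{C_1s}\right)\right)\right)\right)\right]$. - $N_{11}$: $R_4+\left[(R_5+L_2s)\parallel\left(R_1+\left(\frac1{C_1s}\parallel\left(R_2+\left(\frac1{G_3}\parallel L_1s\right)\right)\right)\right)\right]$. - $N_{12}$: $R_4+\left[(R_5+L_2s)\parallel\frac1{G_1}\parallel\left(\frac1{C_1s}+\left(\frac1{G_2}\parallel(R_3+L_1s)\right)\right)\right]$. - $N_{13}$: $R_4+\left[(R_5+L_2s)\parallel\frac1{G_1}\parallel\left(L_1s+\left(\frac1{G_2}\parallel\left(R_3+\frac1{C_1s}\right)\right)\right)\right]$.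 - $N_{14}$: $R_4+\left[\left(R_5+\frac1{C_1s}\right)\parallel\left(R_1+\left(L_2s\parallel\left(R_2+\left(\frac1{G_3}\parallel L_1s\right)\right)\right)\right)\right]$. The following are the subclasses obtained by removing one element (setting the indicated parameter to $0$): from $\mathcal{N}_{10}$: $\mathcal{N}_{17}$ ($G_3=0$), $\mathcal{N}_{18}$ ($R_5=0$); from $\mathcal{N}_{11}$: $\mathcal{N}_{20}$ ($G_3=0$), $\mathcal{N}_{21}$ ($R_5=0$); from $\mathcal{N}_{12}$: $\mathcal{N}_{22}$ ($G_1=0$), $\mathcal{N}_{23}$ ($R_3=0$), $\mathcal{N}_{24}$ ($R_5=0$); from $\mathcal{N}_{13}$: $\mathcal{N}_{25}$ ($G_1=0$), $\mathcal{N}_{26}$ ($R_3=0$), $\mathcal{N}_{27}$ ($R_5=0$); from $\mathcal{N}_{14}$: $\mathcal{N}_{29}$ ($G_3=0$), $\mathcal{N}_{30}$ ($R_5=0$). *)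

theory Defs
  imports "HOL-Analysis.Analysis" "HOL-Computational_Algebra.Computational_Algebra"
begin

section \<open>Series-parallel networks\<close>

text \<open>
  A resistor is entered either by its resistance or by its conductance, so that
  \<open>Resistor 0\<close> is a short circuit and \<open>Conductor 0\<close> an open circuit. These two leaves stay in
  the tree, where they have no electrical effect in the networks below, but they are never
  counted as elements.
\<close>

datatype network =
    Resistor real
  | Conductor real
  | Inductor real
  | Capacitor real
  | Series network network    (infixr "\<^bold>+" 65)
  | Parallel network network  (infixr "\<parallel>" 70)

primrec sp_network :: "network \<Rightarrow> bool" where
  "sp_network (Resistor R) \<longleftrightarrow> R \<ge> 0"
| "sp_network (Conductor G) \<longleftrightarrow> G \<ge> 0"
| "sp_network (Inductor L) \<longleftrightarrow> L > 0"
| "sp_network (Capacitor C) \<longleftrightarrow> C > 0"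
| "sp_network (N \<^bold>+ M) \<longleftrightarrow> sp_network N \<and> sp_network M"
| "sp_network (N \<parallel> M) \<longleftrightarrow> sp_network N \<and> sp_network M"

primrec num_resistors :: "network \<Rightarrow> nat" where
  "num_resistors (Resistor R) = (if R = 0 then 0 else 1)"
| "num_resistors (Conductor G) = (if G = 0 then 0 else 1)"
| "num_resistors (Inductor L) = 0"
| "num_resistors (Capacitor C) = 0"
| "num_resistors (N \<^bold>+ M) = num_resistors N + num_resistors M"
| "num_resistors (N \<parallel> M) = num_resistors N + num_resistors M"

primrec num_inductors :: "network \<Rightarrow> nat" where
  "num_inductors (Resistor R) = 0"
| "num_inductors (Conductor G) = 0"
| "num_inductors (Inductor L) = 1"
| "num_inductors (Capacitor C) = 0"
| "num_inductors (N \<^bold>+ M) = num_inductors N + num_inductors M"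
| "num_inductors (N \<parallel> M) = num_inductors N + num_inductors M"

primrec num_capacitors :: "network \<Rightarrow> nat" where
  "num_capacitors (Resistor R) = 0"
| "num_capacitors (Conductor G) = 0"
| "num_capacitors (Inductor L) = 0"
| "num_capacitors (Capacitor C) = 1"
| "num_capacitors (N \<^bold>+ M) = num_capacitors N + num_capacitors M"
| "num_capacitors (N \<parallel> M) = num_capacitors N + num_capacitors M"

definition num_storage :: "network \<Rightarrow> nat" where
  "num_storage N = num_inductors N + num_capacitors N"

definition num_elements :: "network \<Rightarrow> nat" where
  "num_elements N = num_resistors N + num_storage N"


section \<open>Impedance\<close>

text \<open>
  Impedances are elements of the field of rational functions \<^typ>\<open>real poly fract\<close>, together with
  \<^term>\<open>None\<close> for the infinite impedance of an open circuit. The reciprocal exchanges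
  \<open>0\<close> and \<^term>\<open>None\<close>. In an \<^const>\<open>sp_network\<close> all finite nonzero impedances are positive
  at \<open>s = 1\<close>, so sums never cancel.
\<close>

type_synonym ratfun = "real poly fract"

definition imp_inverse :: "ratfun option \<Rightarrow> ratfun option" where
  "imp_inverse z = (case z of None \<Rightarrow> Some 0 | Some a \<Rightarrow> if a = 0 then None else Some (inverse a))"

definition imp_add :: "ratfun option \<Rightarrow> ratfun option \<Rightarrow> ratfun option" where
  "imp_add z w = (case (z, w) of (Some a, Some b) \<Rightarrow> Some (a + b) | _ \<Rightarrow> None)"

primrec impedance :: "network \<Rightarrow> ratfun option" where
  "impedance (Resistor R) = Some (Fract [:R:] 1)"
| "impedance (Conductor G) = imp_inverse (Some (Fract [:G:] 1))"
| "impedance (Inductor L) = Some (Fract [:0, L:] 1)"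
| "impedance (Capacitor C) = imp_inverse (Some (Fract [:0, C:] 1))"
| "impedance (N \<^bold>+ M) = imp_add (impedance N) (impedance M)"
| "impedance (N \<parallel> M) =
     imp_inverse (imp_add (imp_inverse (impedance N)) (imp_inverse (impedance M)))"

text \<open>\<open>\<Z> m n\<close>: at most \<open>m\<close> capacitors and at most \<open>n\<close> inductors.\<close>

definition \<Z> :: "nat \<Rightarrow> nat \<Rightarrow> ratfun set" where
  "\<Z> m n = {Z. \<exists>N. sp_network N \<and> num_capacitors N \<le> m \<and> num_inductors N \<le> n \<and>
                    impedance N = Some Z}"


section \<open>Transformations\<close>

primrec trans_i :: "network \<Rightarrow> network" where
  "trans_i (Resistor R) = Resistor R"
| "trans_i (Conductor G) = Conductor G"
| "trans_i (Inductor L) = Capacitor (1 / L)"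
| "trans_i (Capacitor C) = Inductor (1 / C)"
| "trans_i (N \<^bold>+ M) = trans_i N \<^bold>+ trans_i M"
| "trans_i (N \<parallel> M) = trans_i N \<parallel> trans_i M"

primrec trans_d :: "network \<Rightarrow> network" where
  "trans_d (Resistor R) = Conductor R"
| "trans_d (Conductor G) = Resistor G"
| "trans_d (Inductor L) = Capacitor L"
| "trans_d (Capacitor C) = Inductor C"
| "trans_d (N \<^bold>+ M) = trans_d N \<parallel> trans_d M"
| "trans_d (N \<parallel> M) = trans_d N \<^bold>+ trans_d M"

definition trans_p :: "network \<Rightarrow> network" where
  "trans_p N = trans_d (trans_i N)"


section \<open>Dimension, generic classes, generating sets\<close>

text \<open>
  As for \<^const>\<open>Euclidean_space\<close>, a point of \<open>\<real>\<^sup>d\<close> is a sequence that vanishes from index \<open>d\<close> on.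
\<close>

definition open_cube :: "nat \<Rightarrow> (nat \<Rightarrow> real) set" where
  "open_cube d = {x \<in> topspace (Euclidean_space d). \<forall>i<d. -1 < x i \<and> x i < 1}"

text \<open>All partial derivatives of order at most \<open>k\<close> exist and are continuous on \<open>open_cube d\<close>.\<close>

primrec C_diff :: "nat \<Rightarrow> nat \<Rightarrow> ((nat \<Rightarrow> real) \<Rightarrow> real) \<Rightarrow> bool" where
  "C_diff d 0 f \<longleftrightarrow> continuous_on (open_cube d) f"
| "C_diff d (Suc k) f \<longleftrightarrow> continuous_on (open_cube d) f \<and>
     (\<forall>i<d. \<exists>g. (\<forall>x\<in>open_cube d. ((\<lambda>t. f (x(i := t))) has_real_derivative g x) (at (x i))) \<and>
                C_diff d k g)"

definition smooth_map :: "nat \<Rightarrow> ((nat \<Rightarrow> real) \<Rightarrow> (nat \<Rightarrow> real)) \<Rightarrow> bool" where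
  "smooth_map d F \<longleftrightarrow> (\<forall>j k. C_diff d k (\<lambda>x. F x j))"

definition contains_smooth_cube :: "(nat \<Rightarrow> real) set \<Rightarrow> nat \<Rightarrow> bool" where
  "contains_smooth_cube S d \<longleftrightarrow>
     (\<exists>F. smooth_map d F \<and> inj_on F (open_cube d) \<and> F ` open_cube d \<subseteq> S)"

definition has_dimension :: "(nat \<Rightarrow> real) set \<Rightarrow> nat \<Rightarrow> bool" where
  "has_dimension S d \<longleftrightarrow>
     contains_smooth_cube S d \<and> (\<forall>e. contains_smooth_cube S e \<longrightarrow> e \<le> d)"

text \<open>The vector \<open>(p\<^sub>0, \<dots>, p\<^sub>n, q\<^sub>0, \<dots>, q\<^sub>n)\<close>.\<close>

definition coeff_vector :: "nat \<Rightarrow> real poly \<Rightarrow> real poly \<Rightarrow> (nat \<Rightarrow> real)" where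
  "coeff_vector n p q =
     (\<lambda>i. if i \<le> n then coeff p i else if i \<le> 2 * n + 1 then coeff q (i - (n + 1)) else 0)"

text \<open>
  The numerator and denominator need not be coprime. The condition \<open>q \<noteq> 0\<close> is needed because
  \<^term>\<open>Fract p 0\<close> is \<open>0\<close>.
\<close>

definition realizability_set :: "nat \<Rightarrow> network set \<Rightarrow> (nat \<Rightarrow> real) set" where
  "realizability_set n \<N> =
     {coeff_vector n p q | p q.
        degree p \<le> n \<and> degree q \<le> n \<and> (coeff p n \<noteq> 0 \<or> coeff q n \<noteq> 0) \<and> q \<noteq> 0 \<and>
        (\<exists>N\<in>\<N>. impedance N = Some (Fract p q))}"

definition generic :: "network set \<Rightarrow> bool" where
  "generic \<N> \<longleftrightarrow>
     (\<exists>n d. (\<forall>N\<in>\<N>. num_storage N = n) \<and> has_dimension (realizability_set n \<N>) d \<and>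
            (\<forall>N\<in>\<N>. num_elements N < d))"

definition generating_set :: "nat \<Rightarrow> nat \<Rightarrow> network set \<Rightarrow> bool" where
  "generating_set m n \<G> \<longleftrightarrow>
     (\<forall>N\<in>\<G>. sp_network N \<and> num_storage N \<le> m + n) \<and>
     (\<forall>Z\<in>\<Z> m n. \<exists>N\<in>\<G>. impedance N = Some Z)"

text \<open>
  A network class consists of networks of one form: they differ only in their element values,
  where the value \<open>0\<close> of a resistor or conductor is admitted and stands for its removal.
\<close>

primrec form :: "network \<Rightarrow> network" where
  "form (Resistor R) = Resistor 1"
| "form (Conductor G) = Conductor 1"
| "form (Inductor L) = Inductor 1"
| "form (Capacitor C) = Capacitor 1"
| "form (N \<^bold>+ M) = form N \<^bold>+ form M"
| "form (N \<parallel> M) = form N \<parallel> form M"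

definition network_class :: "network set \<Rightarrow> bool" where
  "network_class \<N> \<longleftrightarrow> (\<forall>N\<in>\<N>. \<forall>M\<in>\<N>. form N = form M)"

definition minimal_generating_set :: "nat \<Rightarrow> nat \<Rightarrow> network set \<Rightarrow> bool" where
  "minimal_generating_set m n \<G> \<longleftrightarrow>
     generating_set m n \<G> \<and> (\<exists>\<C>. (\<forall>\<N>\<in>\<C>. network_class \<N> \<and> generic \<N>) \<and> \<G> = \<Union>\<C>)"


section \<open>The network classes\<close>

definition net10 where
  "net10 R1 R2 G3 R4 R5 C1 L1 L2 =
     Resistor R4 \<^bold>+ ((Resistor R5 \<^bold>+ Inductor L2) \<parallel>
       (Resistor R1 \<^bold>+ (Inductor L1 \<parallel> (Resistor R2 \<^bold>+ (Conductor G3 \<parallel> Capacitor C1)))))"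

definition net11 where
  "net11 R1 R2 G3 R4 R5 C1 L1 L2 =
     Resistor R4 \<^bold>+ ((Resistor R5 \<^bold>+ Inductor L2) \<parallel>
       (Resistor R1 \<^bold>+ (Capacitor C1 \<parallel> (Resistor R2 \<^bold>+ (Conductor G3 \<parallel> Inductor L1)))))"

definition net12 where
  "net12 G1 G2 R3 R4 R5 C1 L1 L2 =
     Resistor R4 \<^bold>+ ((Resistor R5 \<^bold>+ Inductor L2) \<parallel> Conductor G1 \<parallel>
       (Capacitor C1 \<^bold>+ (Conductor G2 \<parallel> (Resistor R3 \<^bold>+ Inductor L1))))"

definition net13 where
  "net13 G1 G2 R3 R4 R5 C1 L1 L2 =
     Resistor R4 \<^bold>+ ((Resistor R5 \<^bold>+ Inductor L2) \<parallel> Conductor G1 \<parallel>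
       (Inductor L1 \<^bold>+ (Conductor G2 \<parallel> (Resistor R3 \<^bold>+ Capacitor C1))))"

definition net14 where
  "net14 R1 R2 G3 R4 R5 C1 L1 L2 =
     Resistor R4 \<^bold>+ ((Resistor R5 \<^bold>+ Capacitor C1) \<parallel>
       (Resistor R1 \<^bold>+ (Inductor L2 \<parallel> (Resistor R2 \<^bold>+ (Conductor G3 \<parallel> Inductor L1)))))"

definition "\<N>1 = {Resistor R1 | R1. R1 \<ge> 0}"

definition "\<N>2 =
  {Resistor R1 \<^bold>+ (Conductor G2 \<parallel> Capacitor C1) | R1 G2 C1. R1 \<ge> 0 \<and> G2 \<ge> 0 \<and> C1 > 0}"

definition "\<N>3 =
  {Resistor R1 \<^bold>+ (Conductor G2 \<parallel> Inductor L1) | R1 G2 L1. R1 \<ge> 0 \<and> G2 \<ge> 0 \<and> L1 > 0}"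

definition "\<N>5 =
  {Resistor R1 \<^bold>+ (Inductor L2 \<parallel> (Resistor R2 \<^bold>+ (Conductor G3 \<parallel> Inductor L1))) | R1 R2 G3 L1 L2.
     R1 \<ge> 0 \<and> R2 > 0 \<and> G3 \<ge> 0 \<and> L1 > 0 \<and> L2 > 0}"

definition "\<N>6 =
  {Resistor R1 \<^bold>+ (Inductor L1 \<parallel> (Resistor R2 \<^bold>+ (Conductor G3 \<parallel> Capacitor C1))) | R1 R2 G3 C1 L1.
     R1 \<ge> 0 \<and> R2 \<ge> 0 \<and> G3 \<ge> 0 \<and> C1 > 0 \<and> L1 > 0}"

definition "\<N>7 =
  {Resistor R1 \<^bold>+ (Capacitor C1 \<parallel> (Resistor R2 \<^bold>+ (Conductor G3 \<parallel> Inductor L1))) | R1 R2 G3 C1 L1.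
     R1 \<ge> 0 \<and> R2 \<ge> 0 \<and> G3 \<ge> 0 \<and> C1 > 0 \<and> L1 > 0}"

definition "\<N>8 =
  {Conductor G1 \<parallel> (Capacitor C1 \<^bold>+ (Conductor G2 \<parallel> (Resistor R3 \<^bold>+ Inductor L1))) | G1 G2 R3 C1 L1.
     G1 \<ge> 0 \<and> G2 \<ge> 0 \<and> R3 \<ge> 0 \<and> C1 > 0 \<and> L1 > 0}"

definition "\<N>9 =
  {Conductor G1 \<parallel> (Inductor L1 \<^bold>+ (Conductor G2 \<parallel> (Resistor R3 \<^bold>+ Capacitor C1))) | G1 G2 R3 C1 L1.
     G1 \<ge> 0 \<and> G2 \<ge> 0 \<and> R3 \<ge> 0 \<and> C1 > 0 \<and> L1 > 0}"

definition "\<N>17 = {net10 R1 R2 0 R4 R5 C1 L1 L2 | R1 R2 R4 R5 C1 L1 L2.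
  R1 \<ge> 0 \<and> R2 \<ge> 0 \<and> R4 \<ge> 0 \<and> R5 \<ge> 0 \<and> C1 > 0 \<and> L1 > 0 \<and> L2 > 0}"

definition "\<N>18 = {net10 R1 R2 G3 R4 0 C1 L1 L2 | R1 R2 G3 R4 C1 L1 L2.
  R1 \<ge> 0 \<and> R2 \<ge> 0 \<and> G3 \<ge> 0 \<and> R4 \<ge> 0 \<and> C1 > 0 \<and> L1 > 0 \<and> L2 > 0}"

definition "\<N>20 = {net11 R1 R2 0 R4 R5 C1 L1 L2 | R1 R2 R4 R5 C1 L1 L2.
  R1 \<ge> 0 \<and> R2 \<ge> 0 \<and> R4 \<ge> 0 \<and> R5 \<ge> 0 \<and> C1 > 0 \<and> L1 > 0 \<and> L2 > 0}"

definition "\<N>21 = {net11 R1 R2 G3 R4 0 C1 L1 L2 | R1 R2 G3 R4 C1 L1 L2.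
  R1 \<ge> 0 \<and> R2 \<ge> 0 \<and> G3 \<ge> 0 \<and> R4 \<ge> 0 \<and> C1 > 0 \<and> L1 > 0 \<and> L2 > 0}"

definition "\<N>22 = {net12 0 G2 R3 R4 R5 C1 L1 L2 | G2 R3 R4 R5 C1 L1 L2.
  G2 \<ge> 0 \<and> R3 \<ge> 0 \<and> R4 \<ge> 0 \<and> R5 \<ge> 0 \<and> C1 > 0 \<and> L1 > 0 \<and> L2 > 0}"

definition "\<N>23 = {net12 G1 G2 0 R4 R5 C1 L1 L2 | G1 G2 R4 R5 C1 L1 L2.
  G1 \<ge> 0 \<and> G2 \<ge> 0 \<and> R4 \<ge> 0 \<and> R5 \<ge> 0 \<and> C1 > 0 \<and> L1 > 0 \<and> L2 > 0}"

definition "\<N>24 = {net12 G1 G2 R3 R4 0 C1 L1 L2 | G1 G2 R3 R4 C1 L1 L2.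
  G1 \<ge> 0 \<and> G2 \<ge> 0 \<and> R3 \<ge> 0 \<and> R4 \<ge> 0 \<and> C1 > 0 \<and> L1 > 0 \<and> L2 > 0}"

definition "\<N>25 = {net13 0 G2 R3 R4 R5 C1 L1 L2 | G2 R3 R4 R5 C1 L1 L2.
  G2 \<ge> 0 \<and> R3 \<ge> 0 \<and> R4 \<ge> 0 \<and> R5 \<ge> 0 \<and> C1 > 0 \<and> L1 > 0 \<and> L2 > 0}"

definition "\<N>26 = {net13 G1 G2 0 R4 R5 C1 L1 L2 | G1 G2 R4 R5 C1 L1 L2.
  G1 \<ge> 0 \<and> G2 \<ge> 0 \<and> R4 \<ge> 0 \<and> R5 \<ge> 0 \<and> C1 > 0 \<and> L1 > 0 \<and> L2 > 0}"

definition "\<N>27 = {net13 G1 G2 R3 R4 0 C1 L1 L2 | G1 G2 R3 R4 C1 L1 L2.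
  G1 \<ge> 0 \<and> G2 \<ge> 0 \<and> R3 \<ge> 0 \<and> R4 \<ge> 0 \<and> C1 > 0 \<and> L1 > 0 \<and> L2 > 0}"

definition "\<N>29 = {net14 R1 R2 0 R4 R5 C1 L1 L2 | R1 R2 R4 R5 C1 L1 L2.
  R1 \<ge> 0 \<and> R2 > 0 \<and> R4 \<ge> 0 \<and> R5 \<ge> 0 \<and> C1 > 0 \<and> L1 > 0 \<and> L2 > 0}"

definition "\<N>30 = {net14 R1 R2 G3 R4 0 C1 L1 L2 | R1 R2 G3 R4 C1 L1 L2.
  R1 \<ge> 0 \<and> R2 > 0 \<and> G3 \<ge> 0 \<and> R4 \<ge> 0 \<and> C1 > 0 \<and> L1 > 0 \<and> L2 > 0}"

end

theory Submission
  imports Defs "HOL-Homology.Homology" "HOL-Real_Asymp.Real_Asymp"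
begin

text \<open>
  Structural induction shows that a network with one capacitor and two inductors has, up to the
  transformation \<open>p\<close>, an impedance \<open>r + (E \<parallel> X)\<close>. Here \<open>E\<close> consists of a resistor and one storage element, and
  \<open>X\<close> is a biquadratic that is regular (if \<open>E\<close> contains an inductor) or an RL impedance (if \<open>E\<close> contains
  the capacitor). Such a representation is not unique, and by compactness there is one
  with the largest \<open>r\<close>. If the resistor in \<open>E\<close> were positive and \<open>X\<close> an interior point of its class of
  biquadratics, then moving the zero of \<open>E\<close> to the right would increase \<open>r\<close> further. Hence the resistor
  in \<open>E\<close> vanishes or \<open>X\<close> lies on the boundary of its class. On the boundary \<open>X\<close> is bilinear or its canonical
  network lacks an element. If the missing element is the series resistor, a storage element of \<open>X\<close> is
  in parallel with \<open>E\<close> and takes over the role of \<open>E\<close>, with vanishing resistor.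

  For genericity, the coefficients of impedances near a suitable one fill an open set, so that the
  realizability set has the full dimension \<open>2n + 2\<close>; it cannot be larger by invariance of domain.
\<close>

section \<open>Impedances as functions of a positive real frequency\<close>

text \<open>If \<open>E\<close> vanishes at t < 0 and \<open>X\<close> does not, then Z(t) = r, and
  near t the branch \<open>E\<close> dominates the parallel connection, so Z rises there with the
  positive slope of \<open>E\<close>. For u slightly to the right of t, the function Z - Z(u)
  vanishes at u. Splitting the pole at u off its reciprocal gives a new branch and a biquadratic
  close to \<open>X\<close>, still inside the open class, with Z(u) > r as series resistance. The
  obstacle is a common zero of \<open>E\<close> and \<open>X\<close>: their admittances then share a
  pole, and admittance is moved from \<open>E\<close> to \<open>X\<close> at fixed r until
  \<open>X\<close> reaches the boundary or \<open>E\<close> has disappeared. Compactness needs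
  closed classes and perturbation needs open ones, so the sign conditions occur in a weak and a
  strict version. All identities are checked for values at positive real s: there sums of impedances
  do not cancel, and these values determine a rational function.\<close>

definition rinv :: "real option \<Rightarrow> real option" where
  "rinv v = (case v of None \<Rightarrow> Some 0 | Some a \<Rightarrow> if a = 0 then None else Some (inverse a))"

definition radd :: "real option \<Rightarrow> real option \<Rightarrow> real option" where
  "radd v w = (case (v, w) of (Some a, Some b) \<Rightarrow> Some (a + b) | _ \<Rightarrow> None)"

definition rpar :: "real option \<Rightarrow> real option \<Rightarrow> real option" where
  "rpar v w = rinv (radd (rinv v) (rinv w))"

text \<open>With the value \<open>None\<close> of \<open>ratio 0 0\<close>, \<open>radd_ratio\<close> below holds unconditionally.\<close>

definition ratio :: "real \<Rightarrow> real \<Rightarrow> real option" where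
  "ratio x y = (if y = 0 then None else Some (x / y))"

primrec val :: "network \<Rightarrow> real \<Rightarrow> real option" where
  "val (Resistor R) s = Some R"
| "val (Conductor G) s = rinv (Some G)"
| "val (Inductor L) s = Some (L * s)"
| "val (Capacitor C) s = rinv (Some (C * s))"
| "val (N \<^bold>+ M) s = radd (val N s) (val M s)"
| "val (N \<parallel> M) s = rpar (val N s) (val M s)"

lemma rinv_rinv [simp]: "rinv (rinv v) = v"
  by (auto simp: rinv_def split: option.splits)

lemma rinv_simps [simp]: "rinv None = Some 0" "rinv (Some 0) = None"
  by (auto simp: rinv_def)

lemma radd_simps [simp]: "radd None w = None" "radd v None = None" "radd (Some a) (Some b) = Some (a + b)"
  "radd (Some 0) v = v" "radd v (Some 0) = v"
  by (auto simp: radd_def split: option.splits)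

lemma radd_commute: "radd v w = radd w v"
  by (auto simp: radd_def split: option.splits)

lemma radd_assoc: "radd (radd u v) w = radd u (radd v w)"
  by (auto simp: radd_def split: option.splits)

lemma rpar_commute: "rpar v w = rpar w v"
  by (simp add: rpar_def radd_commute)

lemma rpar_assoc: "rpar (rpar u v) w = rpar u (rpar v w)"
  by (simp add: rpar_def radd_assoc)

lemma rpar_left_commute: "rpar u (rpar v w) = rpar v (rpar u w)"
  by (metis rpar_assoc rpar_commute)

lemma rinv_radd: "rinv (radd v w) = rpar (rinv v) (rinv w)"
  by (simp add: rpar_def)

lemma rinv_rpar: "rinv (rpar v w) = radd (rinv v) (rinv w)"
  by (simp add: rpar_def)

lemma rpar_simps [simp]: "rpar None v = v" "rpar v None = v" "rpar (Some 0) v = Some 0" "rpar v (Some 0) = Some 0"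
  by (simp_all add: rpar_def)

lemma ratio_simps [simp]: "ratio x 0 = None" "ratio 0 1 = Some 0" "ratio x 1 = Some x"
  by (auto simp: ratio_def)

lemma rinv_ratio: "x \<noteq> 0 \<or> y \<noteq> 0 \<Longrightarrow> rinv (ratio x y) = ratio y x"
  by (auto simp: ratio_def rinv_def)

lemma radd_ratio: "radd (ratio x y) (ratio u w) = ratio (x * w + u * y) (y * w)"
  by (auto simp: ratio_def field_simps)

text \<open>The third assumption excludes two short circuits, for which the left side is
  \<open>Some 0\<close> while the right side would be \<open>ratio 0 0\<close>, that is
  \<open>None\<close>. Nonnegativity keeps the two admittances from cancelling.\<close>

lemma rpar_ratio:
  assumes "x \<noteq> 0 \<or> y \<noteq> 0" "u \<noteq> 0 \<or> w \<noteq> 0" "x \<noteq> 0 \<or> u \<noteq> 0"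
    and "0 \<le> x" "0 \<le> y" "0 \<le> u" "0 \<le> w"
  shows "rpar (ratio x y) (ratio u w) = ratio (x * u) (x * w + u * y)"
proof -
  have "rpar (ratio x y) (ratio u w) = rinv (ratio (y * u + w * x) (x * u))"
    using assms by (simp add: rpar_def rinv_ratio radd_ratio)
  also have "\<dots> = ratio (x * u) (y * u + w * x)"
  proof (rule rinv_ratio)
    show "y * u + w * x \<noteq> 0 \<or> x * u \<noteq> 0"
      using assms by (auto simp: add_nonneg_eq_0_iff)
  qed
  finally show ?thesis by (simp add: mult.commute add.commute)
qed

lemma ratio_scale: "k \<noteq> 0 \<Longrightarrow> ratio (k * x) (k * y) = ratio x y"
  by (auto simp: ratio_def)

lemma pos_poly_nz: "\<forall>s>0. 0 < poly q s \<Longrightarrow> q \<noteq> (0 :: real poly)"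
  by (metis less_irrefl poly_0 zero_less_one)

text \<open>
  \<open>represents z v\<close>: the rational function \<open>z\<close> takes the values \<open>v\<close> on the positive axis. Numerator and
  denominator are positive there, so evaluation commutes with sums and reciprocals.
\<close>

definition represents :: "ratfun option \<Rightarrow> (real \<Rightarrow> real option) \<Rightarrow> bool" where
  "represents z v \<longleftrightarrow> z = None \<and> (\<forall>s>0. v s = None) \<or>
     (\<exists>p q. z = Some (Fract p q) \<and> (p = 0 \<or> (\<forall>s>0. 0 < poly p s)) \<and>
       (\<forall>s>0. 0 < poly q s) \<and> (\<forall>s>0. v s = Some (poly p s / poly q s)))"

lemma represents_Some:
  assumes "p = 0 \<or> (\<forall>s>0. 0 < poly p s)" "\<forall>s>0. 0 < poly q s" "\<And>s. s > 0 \<Longrightarrow> v s = Some (poly p s / poly q s)"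
  shows "represents (Some (Fract p q)) v"
  unfolding represents_def using assms by blast

lemma represents_cases:
  assumes "represents z v"
  obtains "z = None" "\<And>s. s > 0 \<Longrightarrow> v s = None"
  | p q where "z = Some (Fract p q)" "p = 0 \<or> (\<forall>s>0. 0 < poly p s)" "\<forall>s>0. 0 < poly q s"
      "\<And>s. s > 0 \<Longrightarrow> v s = Some (poly p s / poly q s)"
  using assms unfolding represents_def by metis

lemma represents_inverse:
  assumes "represents z v" shows "represents (imp_inverse z) (\<lambda>s. rinv (v s))"
  using assms
proof (cases rule: represents_cases)
  case 1
  then have "represents (Some (Fract 0 1)) (\<lambda>s. rinv (v s))"
    by (intro represents_Some) auto
  then show ?thesis by (simp add: 1 imp_inverse_def Zero_fract_def)
next
  case (2 p q)
  show ?thesis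
  proof (cases "p = 0")
    case True
    then show ?thesis using 2(1,4) by (simp add: represents_def imp_inverse_def fract_collapse)
  next
    case False
    then have p: "\<forall>s>0. 0 < poly p s" using 2 by blast
    have "represents (Some (Fract q p)) (\<lambda>s. rinv (v s))"
    proof (rule represents_Some)
      fix s :: real assume s: "s > 0"
      then have "0 < poly p s" "0 < poly q s" using p 2 by auto
      then show "rinv (v s) = Some (poly q s / poly p s)" using 2(4)[OF s] by (simp add: rinv_def)
    qed (use p 2 in auto)
    moreover have "imp_inverse z = Some (Fract q p)"
      using False pos_poly_nz[OF 2(3)] by (simp add: 2(1) imp_inverse_def Zero_fract_def eq_fract)
    ultimately show ?thesis by simp
  qed
qed

lemma represents_add:
  assumes "represents z v" "represents z' v'" shows "represents (imp_add z z') (\<lambda>s. radd (v s) (v' s))"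
  using assms(1)
proof (cases rule: represents_cases)
  case 1
  then show ?thesis by (simp add: represents_def imp_add_def)
next
  case (2 p q)
  note pq = this
  from assms(2) show ?thesis
  proof (cases rule: represents_cases)
    case 1
    then show ?thesis by (simp add: represents_def imp_add_def split: option.splits)
  next
    case (2 p' q')
    have pos: "0 < poly q s" "0 < poly q' s" if "s > 0" for s using that pq(3) 2(3) by auto
    have "represents (Some (Fract (p * q' + p' * q) (q * q'))) (\<lambda>s. radd (v s) (v' s))"
    proof (rule represents_Some)
      have "p * q' + p' * q = 0 \<or> 0 < poly (p * q' + p' * q) s" if "s > 0" for s
        using pq(2) 2(2) pos[OF that] that by (cases "p = 0"; cases "p' = 0") (simp_all add: add_pos_pos)
      then show "p * q' + p' * q = 0 \<or> (\<forall>s>0. 0 < poly (p * q' + p' * q) s)" by blast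
      show "\<forall>s>0. 0 < poly (q * q') s" using pos by auto
      fix s :: real assume s: "s > 0"
      with pos[OF this] show "radd (v s) (v' s) = Some (poly (p * q' + p' * q) s / poly (q * q') s)"
        by (simp add: pq(4) 2(4) add_frac_eq less_imp_neq[symmetric])
    qed
    then show ?thesis
      using pos_poly_nz[OF pq(3)] pos_poly_nz[OF 2(3)] by (simp add: pq(1) 2(1) imp_add_def)
  qed
qed

lemma represents_val: "sp_network N \<Longrightarrow> represents (impedance N) (val N)"
proof (induction N)
  case (Resistor R)
  then show ?case unfolding impedance.simps by (intro represents_Some) auto
next
  case (Conductor G)
  then have "represents (Some (Fract [:G:] 1)) (\<lambda>s. Some G)" by (intro represents_Some) auto
  from represents_inverse[OF this] show ?case by (simp add: val.simps[abs_def])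
next
  case (Inductor L)
  then show ?case unfolding impedance.simps by (intro represents_Some) auto
next
  case (Capacitor C)
  then have "represents (Some (Fract [:0, C:] 1)) (\<lambda>s. Some (C * s))" by (intro represents_Some) auto
  from represents_inverse[OF this] show ?case by (simp add: val.simps[abs_def])
next
  case (Series N M)
  then show ?case using represents_add by (simp add: val.simps[abs_def])
next
  case (Parallel N M)
  then have "represents (imp_add (imp_inverse (impedance N)) (imp_inverse (impedance M)))
      (\<lambda>s. radd (rinv (val N s)) (rinv (val M s)))"
    by (intro represents_add represents_inverse) auto
  from represents_inverse[OF this] show ?case by (simp add: val.simps[abs_def] rpar_def)
qed

lemma poly_eq_on_pos:
  fixes p q :: "real poly"
  assumes "\<And>s. s > 0 \<Longrightarrow> poly p s = poly q s"
  shows "p = q"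
proof (rule ccontr)
  assume "p \<noteq> q"
  then have "finite {s. poly (p - q) s = 0}" by (intro poly_roots_finite) simp
  moreover have "{0<..} \<subseteq> {s. poly (p - q) s = 0}" using assms by auto
  ultimately have "finite {0::real<..}" by (rule finite_subset[rotated])
  then show False using infinite_Ioi by blast
qed

text \<open>Cross-multiplied, the two fractions agree at infinitely many points and hence as
  polynomials. \<open>p\<close> and \<open>q\<close> may have common factors, as they may in
  \<open>realizability_set\<close>.\<close>

lemma impedance_eq_Fract:
  assumes N: "sp_network N" and v: "\<And>s. s > 0 \<Longrightarrow> val N s = Some (poly p s / poly q s)"
    and q: "\<And>s. s > 0 \<Longrightarrow> poly q s \<noteq> 0"
  shows "impedance N = Some (Fract p q)"
  using represents_val[OF N]
proof (cases rule: represents_cases)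
  case 1
  then show ?thesis using v[of 1] by auto
next
  case (2 p' q')
  have "p' * q = p * q'"
  proof (rule poly_eq_on_pos)
    fix s :: real assume s: "s > 0"
    then have "poly p' s / poly q' s = poly p s / poly q s" using 2(4) v by (metis option.inject)
    moreover have "poly q' s \<noteq> 0" using 2(3) s by auto
    ultimately show "poly (p' * q) s = poly (p * q') s" using q[OF s] by (simp add: field_simps)
  qed
  moreover have "q \<noteq> 0" using q[of 1] by auto
  ultimately show ?thesis using pos_poly_nz[OF 2(3)] by (simp add: 2(1) eq_fract)
qed

text \<open>From here on networks can be compared through \<open>val\<close> at positive frequencies
  alone.\<close>

lemma impedance_eqI:
  assumes "sp_network N" "sp_network M" "\<And>s. s > 0 \<Longrightarrow> val N s = val M s"
  shows "impedance N = impedance M"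
  using represents_val[OF assms(2)]
proof (cases rule: represents_cases)
  case 1
  then have "val N 1 = None" using assms(3) by simp
  then have "impedance N = None"
    using represents_val[OF assms(1)] by (auto simp: represents_def)
  then show ?thesis using 1 by simp
next
  case (2 p q)
  have "impedance N = Some (Fract p q)"
    by (rule impedance_eq_Fract) (use assms 2 in \<open>auto simp: less_imp_neq[symmetric]\<close>)
  then show ?thesis using 2 by simp
qed

section \<open>The transformations i, d and p on values, element counts and forms\<close>

lemma sp_trans_i: "sp_network N \<Longrightarrow> sp_network (trans_i N)" by (induction N) auto
lemma sp_trans_d: "sp_network N \<Longrightarrow> sp_network (trans_d N)" by (induction N) auto
lemma sp_trans_p: "sp_network N \<Longrightarrow> sp_network (trans_p N)"
  by (simp add: trans_p_def sp_trans_i sp_trans_d)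

lemma val_trans_i: "sp_network N \<Longrightarrow> s > 0 \<Longrightarrow> val (trans_i N) s = val N (1 / s)"
  by (induction N) (auto simp: rinv_def field_simps)

lemma val_trans_d: "sp_network N \<Longrightarrow> s > 0 \<Longrightarrow> val (trans_d N) s = rinv (val N s)"
  by (induction N) (auto simp: rinv_radd rinv_rpar)

lemma val_trans_p: "sp_network N \<Longrightarrow> s > 0 \<Longrightarrow> val (trans_p N) s = rinv (val N (1 / s))"
  by (simp add: trans_p_def val_trans_d val_trans_i sp_trans_i)

lemma num_trans_p [simp]:
  "num_inductors (trans_p N) = num_inductors N" "num_capacitors (trans_p N) = num_capacitors N"
  "num_resistors (trans_p N) = num_resistors N"
  unfolding trans_p_def by (induction N) auto

text \<open>Inverting an element value fixes the value 1, so \<open>form\<close> commutes with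
  \<open>trans_p\<close>.\<close>

lemma form_trans_p: "form N = form M \<Longrightarrow> form (trans_p N) = form (trans_p M)"
proof -
  have "form (trans_p N) = trans_p (form N)" for N
    unfolding trans_p_def by (induction N) auto
  then show "form N = form M \<Longrightarrow> form (trans_p N) = form (trans_p M)" by simp
qed

section \<open>Biquadratic impedances\<close>

type_synonym biquad = "real \<times> real \<times> real \<times> real \<times> real \<times> real"

fun biq :: "biquad \<Rightarrow> real \<Rightarrow> real option" where
  "biq (a0, a1, a2, b0, b1, b2) s = ratio (a0 + a1 * s + a2 * s\<^sup>2) (b0 + b1 * s + b2 * s\<^sup>2)"

fun nonneg :: "biquad \<Rightarrow> bool" where
  "nonneg (a0, a1, a2, b0, b1, b2) \<longleftrightarrow> 0 \<le> a0 \<and> 0 \<le> a1 \<and> 0 \<le> a2 \<and> 0 \<le> b0 \<and> 0 \<le> b1 \<and> 0 \<le> b2"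

text \<open>
  For \<open>Z(s) = (a2 s\<^sup>2 + a1 s + a0) / (b2 s\<^sup>2 + b1 s + b0)\<close>, \<open>min_at_0\<close> expresses that the real part of
  \<open>Z(i\<omega>)\<close> is minimal at \<open>\<omega> = 0\<close>. Reversing the coefficients moves the minimum to infinity, and exchanging
  numerator and denominator passes to the admittance.
\<close>

fun min_at_0 :: "biquad \<Rightarrow> bool" where
  "min_at_0 (a0, a1, a2, b0, b1, b2) \<longleftrightarrow>
     0 \<le> a2 * b0 - a0 * b2 \<and> 0 \<le> a1 * b0 - a0 * b1 \<and>
     b0 * (a2 * b0 - a0 * b2) \<le> b1 * (a1 * b0 - a0 * b1)"

text \<open>The resultant of numerator and denominator, both read as quadratics; it vanishes when
  they have a common factor.\<close>

fun bres :: "biquad \<Rightarrow> real" where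
  "bres (a0, a1, a2, b0, b1, b2) =
     (a2 * b0 - a0 * b2)\<^sup>2 - (a1 * b0 - a0 * b1) * (a2 * b1 - a1 * b2)"

fun bflip :: "biquad \<Rightarrow> biquad" where
  "bflip (a0, a1, a2, b0, b1, b2) = (a2, a1, a0, b2, b1, b0)"

fun bswap :: "biquad \<Rightarrow> biquad" where
  "bswap (a0, a1, a2, b0, b1, b2) = (b0, b1, b2, a0, a1, a2)"

text \<open>The zero vector is admitted, so that \<open>{x. regular x}\<close> is a closed cone; likewise for \<open>rl\<close>.\<close>

definition regular :: "biquad \<Rightarrow> bool" where
  "regular x \<longleftrightarrow> nonneg x \<and> 0 \<le> bres x \<and>
     (min_at_0 x \<or> min_at_0 (bflip x) \<or> min_at_0 (bswap x) \<or> min_at_0 (bflip (bswap x)))"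

text \<open>Let A, B, D be the three minors in the order listed. The derivative of the quotient has
  numerator B + 2 A s + D s^2, and the resultant is a quarter of its discriminant. So the signs of
  B, D and the resultant say that the function is nondecreasing along the whole real axis, as an RL
  impedance is.\<close>

fun rl :: "biquad \<Rightarrow> bool" where
  "rl (a0, a1, a2, b0, b1, b2) \<longleftrightarrow> nonneg (a0, a1, a2, b0, b1, b2) \<and>
     0 \<le> a2 * b0 - a0 * b2 \<and> 0 \<le> a1 * b0 - a0 * b1 \<and> 0 \<le> a2 * b1 - a1 * b2 \<and>
     bres (a0, a1, a2, b0, b1, b2) \<le> 0"

lemma flip_swap_simps [simp]:
  "bflip (bflip x) = x" "bswap (bswap x) = x" "bswap (bflip x) = bflip (bswap x)"
  "nonneg (bflip x) = nonneg x" "nonneg (bswap x) = nonneg x"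
  "bflip x = 0 \<longleftrightarrow> x = 0" "bswap x = 0 \<longleftrightarrow> x = 0"
  by (cases x; auto simp: zero_prod_def)+

lemma bres_flip_swap [simp]: "bres (bflip x) = bres x" "bres (bswap x) = bres x"
  by (cases x; simp add: algebra_simps power2_eq_square)+

lemma regular_flip_swap [simp]: "regular (bflip x) = regular x" "regular (bswap x) = regular x"
  unfolding regular_def by auto

lemma rl_flip_swap: "rl (bflip (bswap x)) = rl x"
  by (cases x) (auto simp: algebra_simps power2_eq_square)

lemma quadratic_pos:
  assumes "0 \<le> a0" "0 \<le> a1" "0 \<le> a2" "a0 \<noteq> 0 \<or> a1 \<noteq> 0 \<or> a2 \<noteq> 0" "0 < (s::real)"
  shows "0 < a0 + a1 * s + a2 * s\<^sup>2"
proof -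
  have "0 \<le> a1 * s" "0 \<le> a2 * s\<^sup>2" using assms by auto
  moreover have "a0 > 0 \<or> a1 * s > 0 \<or> a2 * s\<^sup>2 > 0" using assms by auto
  ultimately show ?thesis using assms by linarith
qed

lemma biq_flip: "s > 0 \<Longrightarrow> biq (bflip x) s = biq x (1 / s)"
proof (cases x)
  case (fields a0 a1 a2 b0 b1 b2)
  assume s: "s > 0"
  have "a2 + a1 * s + a0 * s\<^sup>2 = s\<^sup>2 * (a0 + a1 * (1 / s) + a2 * (1 / s)\<^sup>2)" for a0 a1 a2 :: real
    using s by (simp add: field_simps power2_eq_square)
  then show ?thesis
    using s unfolding fields bflip.simps biq.simps by (metis ratio_scale power_not_zero less_irrefl)
qed

lemma rinv_biq: "nonneg x \<Longrightarrow> x \<noteq> 0 \<Longrightarrow> s > 0 \<Longrightarrow> rinv (biq x s) = biq (bswap x) s"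
proof (cases x)
  case (fields a0 a1 a2 b0 b1 b2)
  assume x: "nonneg x" "x \<noteq> 0" and s: "s > 0"
  then have "a0 + a1 * s + a2 * s\<^sup>2 \<noteq> 0 \<or> b0 + b1 * s + b2 * s\<^sup>2 \<noteq> 0"
    using quadratic_pos[of a0 a1 a2 s] quadratic_pos[of b0 b1 b2 s] unfolding fields
    by (auto simp: zero_prod_def)
  then show ?thesis unfolding fields by (simp add: rinv_ratio)
qed

text \<open>
  \<open>WL\<close>, \<open>WC\<close>, \<open>TLL\<close>, \<open>TLC\<close> will contain the impedances of networks with resistors and one inductor, one
  capacitor, two inductors, and one inductor and one capacitor.
\<close>

definition Res :: "(real \<Rightarrow> real option) \<Rightarrow> bool" where
  "Res v \<longleftrightarrow> (\<exists>a b. 0 \<le> a \<and> 0 \<le> b \<and> 0 < a + b \<and> (\<forall>s>0. v s = ratio a b))"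

definition WL :: "(real \<Rightarrow> real option) \<Rightarrow> bool" where
  "WL v \<longleftrightarrow> Res v \<or> (\<exists>r l g. 0 \<le> r \<and> 0 < l \<and> 0 \<le> g \<and> (\<forall>s>0. v s = Some (r + l * s / (1 + g * s))))"

definition WC :: "(real \<Rightarrow> real option) \<Rightarrow> bool" where
  "WC v \<longleftrightarrow> Res v \<or> (\<exists>r c g. 0 \<le> r \<and> 0 < c \<and> 0 \<le> g \<and> (\<forall>s>0. v s = Some (r + c / (g + s))))"

definition TLC :: "(real \<Rightarrow> real option) \<Rightarrow> bool" where
  "TLC v \<longleftrightarrow> (\<exists>x. regular x \<and> x \<noteq> 0 \<and> (\<forall>s>0. v s = biq x s))"

definition TLL :: "(real \<Rightarrow> real option) \<Rightarrow> bool" where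
  "TLL v \<longleftrightarrow> (\<exists>x. rl x \<and> x \<noteq> 0 \<and> (\<forall>s>0. v s = biq x s))"

text \<open>The effect of \<open>trans_p\<close> on values, see \<open>val_trans_p\<close>. It
  preserves the kind of each storage element and exchanges series and parallel, so each closure
  property under series connection yields its parallel counterpart.\<close>

definition pd :: "(real \<Rightarrow> real option) \<Rightarrow> real \<Rightarrow> real option" where
  "pd v s = rinv (v (1 / s))"

lemma pd_pd: "pd (pd v) = v"
  by (auto simp: pd_def)

lemma WL_cong: "WL v \<Longrightarrow> (\<And>s. s > 0 \<Longrightarrow> w s = v s) \<Longrightarrow> WL w" unfolding WL_def Res_def by auto
lemma WC_cong: "WC v \<Longrightarrow> (\<And>s. s > 0 \<Longrightarrow> w s = v s) \<Longrightarrow> WC w" unfolding WC_def Res_def by auto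
lemma TLC_cong: "TLC v \<Longrightarrow> (\<And>s. s > 0 \<Longrightarrow> w s = v s) \<Longrightarrow> TLC w" unfolding TLC_def by auto
lemma TLL_cong: "TLL v \<Longrightarrow> (\<And>s. s > 0 \<Longrightarrow> w s = v s) \<Longrightarrow> TLL w" unfolding TLL_def by auto

lemma Res_cases:
  assumes "Res v"
  obtains "\<And>s. s > 0 \<Longrightarrow> v s = None" | r where "0 \<le> r" "\<And>s. s > 0 \<Longrightarrow> v s = Some r"
  using assms unfolding Res_def ratio_def
  by (metis add.right_neutral divide_nonneg_nonneg)

lemma Res_None: "(\<And>s. s > 0 \<Longrightarrow> v s = None) \<Longrightarrow> Res v"
  unfolding Res_def by (intro exI[of _ 1] exI[of _ 0]) auto

lemma Res_Some: "0 \<le> r \<Longrightarrow> (\<And>s. s > 0 \<Longrightarrow> v s = Some r) \<Longrightarrow> Res v"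
  unfolding Res_def by (intro exI[of _ r] exI[of _ 1]) auto

lemma Res_WL: "Res v \<Longrightarrow> WL v" and Res_WC: "Res v \<Longrightarrow> WC v" by (auto simp: WL_def WC_def)

lemma Res_pd: "Res v \<Longrightarrow> Res (pd v)"
  unfolding Res_def
proof (elim exE conjE)
  fix a b :: real assume "0 \<le> a" "0 \<le> b" "0 < a + b" "\<forall>s>0. v s = ratio a b"
  then show "\<exists>a b. 0 \<le> a \<and> 0 \<le> b \<and> 0 < a + b \<and> (\<forall>s>0. pd v s = ratio a b)"
    by (intro exI[of _ b] exI[of _ a]) (auto simp: pd_def rinv_ratio)
qed

text \<open>For b0 > 0, subtracting the value a0 / b0 at s = 0 leaves l s / (1 + g s), where l has
  the sign of the determinant a1 b0 - a0 b1. For b0 = 0 the determinant condition forces a0 b1 = 0,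
  so the quotient is constant or infinite.\<close>

lemma ratio_WL:
  assumes "0 \<le> a0" "0 \<le> a1" "0 \<le> b0" "0 \<le> b1" "a0 \<noteq> 0 \<or> a1 \<noteq> 0 \<or> b0 \<noteq> 0 \<or> b1 \<noteq> 0"
    and "a0 * b1 \<le> a1 * b0" and v: "\<And>s. s > 0 \<Longrightarrow> v s = ratio (a0 + a1 * s) (b0 + b1 * s)"
  shows "WL v"
proof (cases "b0 = 0")
  case True
  then have "a0 * b1 \<le> 0" "0 \<le> a0 * b1" using assms by auto
  then have *: "a0 * b1 = 0" by linarith
  show ?thesis
  proof (cases "b1 = 0")
    case True
    then show ?thesis using \<open>b0 = 0\<close> v by (intro Res_WL Res_None) auto
  next
    case False
    then have "v s = Some (a1 / b1)" if "s > 0" for s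
      using that v * \<open>b0 = 0\<close> by (simp add: ratio_def)
    then show ?thesis using assms by (intro Res_WL Res_Some[of "a1 / b1"]) auto
  qed
next
  case False
  then have b0: "b0 > 0" using assms by simp
  define l where "l = (a1 * b0 - a0 * b1) / b0\<^sup>2"
  have v': "v s = Some (a0 / b0 + l * s / (1 + b1 / b0 * s))" if s: "s > 0" for s
  proof -
    have d: "0 < b0 + b1 * s" using b0 s assms(4) by (simp add: add_pos_nonneg)
    have *: "k / b0\<^sup>2 * s / (x / b0) = k * s / (b0 * x)" for k x
      using b0 by (simp add: field_simps power2_eq_square)
    have "1 + b1 / b0 * s = (b0 + b1 * s) / b0" using b0 by (simp add: field_simps)
    then have "a0 / b0 + l * s / (1 + b1 / b0 * s) = a0 / b0 + (a1 * b0 - a0 * b1) * s / (b0 * (b0 + b1 * s))"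
      by (simp only: l_def *)
    also have "\<dots> = (a0 + a1 * s) / (b0 + b1 * s)"
      using b0 d by (simp add: divide_simps) (simp add: algebra_simps)
    finally show ?thesis using v[OF s] d by (simp add: ratio_def)
  qed
  have "0 \<le> l" using assms by (simp add: l_def)
  then consider "l = 0" | "l > 0" by linarith
  then show ?thesis
  proof cases
    case 1
    then show ?thesis using v' b0 assms(1) by (intro Res_WL Res_Some[of "a0 / b0"]) auto
  next
    case 2
    then show ?thesis unfolding WL_def using v' b0 assms(1,4)
      by (intro disjI2 exI[of _ "a0 / b0"] exI[of _ l] exI[of _ "b1 / b0"]) auto
  qed
qed

lemma Res_flip: "Res v \<Longrightarrow> Res (\<lambda>s. v (1 / s))"
proof (cases v rule: Res_cases)
qed (auto intro: Res_None Res_Some)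

lemma WL_flip: "WL v \<Longrightarrow> WC (\<lambda>s. v (1 / s))" and WC_flip: "WC v \<Longrightarrow> WL (\<lambda>s. v (1 / s))"
proof -
  assume "WL v"
  then show "WC (\<lambda>s. v (1 / s))"
    unfolding WL_def
  proof (elim disjE exE conjE)
    assume "Res v" then show ?thesis by (intro Res_WC Res_flip)
  next
    fix r l g :: real assume "0 \<le> r" "0 < l" "0 \<le> g" and v: "\<forall>s>0. v s = Some (r + l * s / (1 + g * s))"
    moreover have "l * (1 / s) / (1 + g * (1 / s)) = l / (g + s)" if "s > 0" for s
      using that \<open>0 \<le> g\<close> by (auto simp: divide_simps algebra_simps)
    ultimately show ?thesis unfolding WC_def
      by (intro disjI2 exI[of _ r] exI[of _ l] exI[of _ g]) auto
  qed
next
  assume "WC v"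
  then show "WL (\<lambda>s. v (1 / s))"
    unfolding WC_def
  proof (elim disjE exE conjE)
    assume "Res v" then show ?thesis by (intro Res_WL Res_flip)
  next
    fix r l g :: real assume "0 \<le> r" "0 < l" "0 \<le> g" and v: "\<forall>s>0. v s = Some (r + l / (g + s))"
    moreover have "l / (g + 1 / s) = l * s / (1 + g * s)" if "s > 0" for s
      using that \<open>0 \<le> g\<close> by (auto simp: divide_simps algebra_simps)
    ultimately show ?thesis unfolding WL_def
      by (intro disjI2 exI[of _ r] exI[of _ l] exI[of _ g]) auto
  qed
qed

lemma Res_rinv: "Res v \<Longrightarrow> Res (\<lambda>s. rinv (v s))"
  using Res_flip[OF Res_pd[of v]] by (simp add: pd_def)

lemma WL_rinv: "WL v \<Longrightarrow> WC (\<lambda>s. rinv (v s))"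
  unfolding WL_def
proof (elim disjE exE conjE)
  assume "Res v" then show ?thesis by (intro Res_WC Res_rinv)
next
  fix r l g :: real assume *: "0 \<le> r" "0 < l" "0 \<le> g" and v: "\<forall>s>0. v s = Some (r + l * s / (1 + g * s))"
  have "WL (\<lambda>s. rinv (v (1 / s)))"
  proof (rule ratio_WL[of g 1 "r * g + l" r])
    show "g \<noteq> 0 \<or> (1::real) \<noteq> 0 \<or> r * g + l \<noteq> 0 \<or> r \<noteq> 0" by simp
    fix s :: real assume s: "s > 0"
    have "v (1 / s) = ratio ((r * g + l) + r * s) (g + 1 * s)"
      using s * v by (simp add: ratio_def field_simps)
    then show "rinv (v (1 / s)) = ratio (g + 1 * s) ((r * g + l) + r * s)"
      using s * by (simp add: rinv_ratio)
  qed (use * in \<open>simp_all add: mult.commute\<close>)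
  from WL_flip[OF this] show ?thesis by simp
qed

lemma WC_rinv: "WC v \<Longrightarrow> WL (\<lambda>s. rinv (v s))"
  using WC_flip WL_rinv WC_flip by fastforce

lemma WL_pd: "WL v \<Longrightarrow> WL (pd v)" and WC_pd: "WC v \<Longrightarrow> WC (pd v)"
  using WC_flip[OF WL_rinv, of v] WL_flip[OF WC_rinv, of v]
  by (simp_all add: pd_def[abs_def])

lemma TLC_flip: "TLC v \<Longrightarrow> TLC (\<lambda>s. v (1 / s))"
  unfolding TLC_def
  by (metis biq_flip flip_swap_simps(6) regular_flip_swap(1) zero_less_divide_1_iff)

lemma TLC_rinv: "TLC v \<Longrightarrow> TLC (\<lambda>s. rinv (v s))"
  unfolding TLC_def
  by (metis flip_swap_simps(7) regular_def regular_flip_swap(2) rinv_biq)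

lemma TLC_pd: "TLC v \<Longrightarrow> TLC (pd v)"
  using TLC_flip[OF TLC_rinv] by (simp add: pd_def[abs_def])

lemma TLL_pd: "TLL v \<Longrightarrow> TLL (pd v)"
  unfolding TLL_def
proof (elim exE conjE)
  fix x assume x: "rl x" "x \<noteq> 0" "\<forall>s>0. v s = biq x s"
  then have nn: "nonneg x" by (cases x) auto
  then show "\<exists>x. rl x \<and> x \<noteq> 0 \<and> (\<forall>s>0. pd v s = biq x s)"
    using x by (intro exI[of _ "bflip (bswap x)"])
      (auto simp: rl_flip_swap pd_def biq_flip rinv_biq)
qed

section \<open>Inclusions between the function classes and closure under connections\<close>

lemma Res_TLC: "Res v \<Longrightarrow> TLC v" and Res_TLL: "Res v \<Longrightarrow> TLL v"
proof -
  assume "Res v"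
  then obtain a b where ab: "0 \<le> a" "0 \<le> b" "0 < a + b" "\<forall>s>0. v s = ratio a b"
    unfolding Res_def by blast
  have "regular (a, 0, 0, b, 0, 0)" "rl (a, 0, 0, b, 0, 0)" "(a, 0, 0, b, 0, 0) \<noteq> 0"
    "\<forall>s>0. v s = biq (a, 0, 0, b, 0, 0) s"
    using ab by (auto simp: regular_def zero_prod_def)
  then show "TLC v" "TLL v" unfolding TLC_def TLL_def by blast+
qed

lemma WL_TLC: "WL v \<Longrightarrow> TLC v" and WL_TLL: "WL v \<Longrightarrow> TLL v"
proof -
  assume "WL v"
  then have "TLC v \<and> TLL v"
    unfolding WL_def
  proof (elim disjE exE conjE)
    assume "Res v" then show ?thesis by (simp add: Res_TLC Res_TLL)
  next
    fix r l g :: real assume *: "0 \<le> r" "0 < l" "0 \<le> g" and v: "\<forall>s>0. v s = Some (r + l * s / (1 + g * s))"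
    let ?x = "(r, r * g + l, 0, 1, g, 0) :: biquad"
    have "v s = biq ?x s" if "s > 0" for s
      using that * v add_pos_nonneg[of 1 "g * s"] by (simp add: ratio_def field_simps)
    moreover have "regular ?x" "rl ?x" using * by (auto simp: regular_def zero_prod_def algebra_simps)
    moreover have "?x \<noteq> 0" by (simp add: zero_prod_def)
    ultimately show ?thesis unfolding TLC_def TLL_def by blast
  qed
  then show "TLC v" "TLL v" by auto
qed

lemma WC_TLC: "WC v \<Longrightarrow> TLC v"
  using TLC_flip[OF WL_TLC[OF WC_flip]] by simp

text \<open>These are the coefficients of l s / (1 + g s) + c / (h + s), and the resultant is l c (1
  - g h)^2, which vanishes when the two poles coincide. The signs of l h - c g and of g h - 1 select
  which of the four orientations of \<open>min_at_0\<close> holds.\<close>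

lemma series_WL_WC:
  fixes l c g h :: real
  assumes "0 < l" "0 < c" "0 \<le> g" "0 \<le> h"
  shows "regular (c, l * h + c * g, l, h, 1 + g * h, g)"
proof -
  have A: "l * h - c * g = l * h - c * g" and
    K: "bres (c, l * h + c * g, l, h, 1 + g * h, g) = l * c * (1 - g * h)\<^sup>2"
    by (simp_all add: algebra_simps power2_eq_square)
  have K0: "0 \<le> bres (c, l * h + c * g, l, h, 1 + g * h, g)"
    unfolding K using assms by simp
  have B: "(l * h + c * g) * h - c * (1 + g * h) = l * h\<^sup>2 - c"
    and D: "l * (1 + g * h) - (l * h + c * g) * g = l - c * g\<^sup>2"
    by (simp_all add: algebra_simps power2_eq_square)
  have gh: "0 \<le> g * h" "0 \<le> l * h" "0 \<le> c * g" "0 \<le> c * g * h" using assms by auto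
  consider (1) "l * h \<ge> c * g" "g * h \<ge> 1" | (2) "l * h \<ge> c * g" "g * h < 1"
    | (3) "l * h \<le> c * g" "g * h \<ge> 1" | (4) "l * h \<le> c * g" "g * h < 1" by linarith
  then show ?thesis
  proof cases
    case 1
    have 2: "c \<le> c * (g * h)" using assms 1(2) by simp
    have 3: "c * g * h \<le> l * h * h" by (rule mult_right_mono) (use 1 assms in auto)
    have "c * (g * h) * 1 \<le> c * (g * h) * (g * h)" by (rule mult_left_mono) (use 1 assms in auto)
    moreover have "c * g * h * (g * h) \<le> l * h * h * (g * h)" by (rule mult_right_mono) (use 3 gh in auto)
    ultimately have 4: "c \<le> l * h * h * (g * h)" using 2 by (simp add: mult.assoc)
    have "min_at_0 (c, l * h + c * g, l, h, 1 + g * h, g)"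
      unfolding min_at_0.simps B
      using 1 2 3 4 by (auto simp: algebra_simps power2_eq_square)
    then show ?thesis unfolding regular_def using K0 assms by auto
  next
    case 2
    have 3: "c * g * g \<le> l * h * g" by (rule mult_right_mono) (use 2 assms in auto)
    have 5: "l * (g * h) \<le> l" using 2 assms by simp
    have 4: "0 \<le> c * g * (2 * l - l * (g * h) - c * g * g)"
      by (rule mult_nonneg_nonneg) (use 3 5 gh in \<open>auto simp: algebra_simps\<close>)
    have "min_at_0 (bflip (bswap (c, l * h + c * g, l, h, 1 + g * h, g)))"
      using 2 3 4 5 by (simp add: algebra_simps power2_eq_square)
    then show ?thesis unfolding regular_def using K0 assms by auto
  next
    case 3
    have h: "0 < h" "0 < g" using 3 assms by (metis less_eq_real_def mult_zero_left mult_zero_right not_one_le_zero)+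
    have 2: "l \<le> l * (g * h)" using assms 3(2) by simp
    have 4: "l * h * g \<le> c * g * g" by (rule mult_right_mono) (use 3 assms in auto)
    have "l * (g * h) * 1 \<le> l * (g * h) * (g * h)" by (rule mult_left_mono) (use 3 assms gh in auto)
    moreover have "l * h * g * (g * h) \<le> c * g * g * (g * h)" by (rule mult_right_mono) (use 4 gh in auto)
    ultimately have 5: "l \<le> c * g * g * (g * h)" using 2 by (simp add: algebra_simps)
    have "min_at_0 (bflip (c, l * h + c * g, l, h, 1 + g * h, g))"
      using 2 3 4 5 by (simp add: algebra_simps power2_eq_square)
    then show ?thesis unfolding regular_def using K0 assms by auto
  next
    case 4
    have 3: "l * h * h \<le> c * g * h" by (rule mult_right_mono) (use 4 assms in auto)
    have 5: "c * (g * h) \<le> c" using 4 assms by simp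
    have 6: "0 \<le> l * h * (2 * c - c * (g * h) - l * h * h)"
      by (rule mult_nonneg_nonneg) (use 3 5 gh in \<open>auto simp: algebra_simps\<close>)
    have "min_at_0 (bswap (c, l * h + c * g, l, h, 1 + g * h, g))"
      using 4 3 5 6 by (simp add: algebra_simps power2_eq_square)
    then show ?thesis unfolding regular_def using K0 assms by auto
  qed
qed

text \<open>This is the last inequality of \<open>min_at_0\<close> for the admittance with the
  factors a0, a1 replaced by b0, b1. For a0 > 0 it follows on multiplying that inequality by b0,
  since \<open>a0 * (b1 * \<beta>) = \<beta>\<^sup>2 + b0 * (a1 * \<beta>)\<close>.\<close>

lemma min_at_0_swap_denom:
  assumes "nonneg (a0, a1, a2, b0, b1, b2)" "min_at_0 (b0, b1, b2, a0, a1, a2)"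
  shows "b0 * (b2 * a0 - b0 * a2) \<le> b1 * (b1 * a0 - b0 * a1)"
proof (cases "a0 = 0")
  case True
  then have "b0 * a2 \<le> 0" "b0 * a1 \<le> 0" "0 \<le> b0 * a2" "0 \<le> b0 * a1" using assms by auto
  then have "b0 * a2 = 0" "b0 * a1 = 0" by linarith+
  then show ?thesis using True by auto
next
  case False
  then have a0: "a0 > 0" using assms by simp
  define \<alpha> \<beta> where "\<alpha> = b2 * a0 - b0 * a2" and "\<beta> = b1 * a0 - b0 * a1"
  have "a0 * \<alpha> \<le> a1 * \<beta>" "0 \<le> b0" using assms by (auto simp: \<alpha>_def \<beta>_def)
  then have "b0 * (a0 * \<alpha>) \<le> b0 * (a1 * \<beta>)" by (rule mult_left_mono)
  moreover have "a0 * (b1 * \<beta>) = \<beta>\<^sup>2 + b0 * (a1 * \<beta>)"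
    by (simp add: \<beta>_def algebra_simps power2_eq_square)
  ultimately have "a0 * (b0 * \<alpha>) \<le> a0 * (b1 * \<beta>)"
    using zero_le_power2[of \<beta>] by (simp only: mult.left_commute[of a0 b0])
  then show ?thesis using a0 by (simp add: \<alpha>_def \<beta>_def)
qed

text \<open>Adding r times the denominator to the numerator changes no minor. In the first claim the
  outer factors b0, b1 stay as well. In the second they turn from a0, a1 into a0 + r b0, a1 + r b1,
  and the extra terms are r times \<open>min_at_0_swap_denom\<close>.\<close>

lemma min_at_0_add:
  assumes "0 \<le> r" "nonneg (a0, a1, a2, b0, b1, b2)"
  shows "min_at_0 (a0, a1, a2, b0, b1, b2) \<Longrightarrow> min_at_0 (a0 + r * b0, a1 + r * b1, a2 + r * b2, b0, b1, b2)"
    and "min_at_0 (b0, b1, b2, a0, a1, a2) \<Longrightarrow> min_at_0 (b0, b1, b2, a0 + r * b0, a1 + r * b1, a2 + r * b2)"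
proof -
  assume "min_at_0 (a0, a1, a2, b0, b1, b2)"
  then show "min_at_0 (a0 + r * b0, a1 + r * b1, a2 + r * b2, b0, b1, b2)"
    by (simp add: algebra_simps)
next
  assume m: "min_at_0 (b0, b1, b2, a0, a1, a2)"
  define \<alpha> \<beta> where "\<alpha> = b2 * a0 - b0 * a2" and "\<beta> = b1 * a0 - b0 * a1"
  have "a0 * \<alpha> \<le> a1 * \<beta>" "0 \<le> \<alpha>" "0 \<le> \<beta>" using m by (auto simp: \<alpha>_def \<beta>_def)
  moreover have "r * (b0 * \<alpha>) \<le> r * (b1 * \<beta>)"
    using min_at_0_swap_denom[OF assms(2) m] assms(1) unfolding \<alpha>_def \<beta>_def by (rule mult_left_mono)
  ultimately have "(a0 + r * b0) * \<alpha> \<le> (a1 + r * b1) * \<beta>" by (simp add: algebra_simps)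
  moreover have "b2 * (a0 + r * b0) - b0 * (a2 + r * b2) = \<alpha>" "b1 * (a0 + r * b0) - b0 * (a1 + r * b1) = \<beta>"
    by (simp_all add: \<alpha>_def \<beta>_def algebra_simps)
  ultimately show "min_at_0 (b0, b1, b2, a0 + r * b0, a1 + r * b1, a2 + r * b2)"
    using \<open>0 \<le> \<alpha>\<close> \<open>0 \<le> \<beta>\<close> unfolding min_at_0.simps by simp
qed

lemma regular_add:
  assumes r: "0 \<le> r" and x: "regular (a0, a1, a2, b0, b1, b2)"
  shows "regular (a0 + r * b0, a1 + r * b1, a2 + r * b2, b0, b1, b2)"
proof -
  have nn: "nonneg (a0, a1, a2, b0, b1, b2)" "nonneg (a2, a1, a0, b2, b1, b0)"
    using x by (auto simp: regular_def)
  have "bres (a0 + r * b0, a1 + r * b1, a2 + r * b2, b0, b1, b2) = bres (a0, a1, a2, b0, b1, b2)"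
    by (simp add: algebra_simps power2_eq_square)
  moreover have "nonneg (a0 + r * b0, a1 + r * b1, a2 + r * b2, b0, b1, b2)" using nn r by auto
  ultimately show ?thesis
    using x min_at_0_add[OF r nn(1)] min_at_0_add[OF r nn(2)]
    unfolding regular_def bflip.simps bswap.simps by metis
qed

lemma rl_add:
  "0 \<le> r \<Longrightarrow> rl (a0, a1, a2, b0, b1, b2) \<Longrightarrow> rl (a0 + r * b0, a1 + r * b1, a2 + r * b2, b0, b1, b2)"
  by (auto simp: algebra_simps power2_eq_square)

lemma biq_add:
  "radd (Some r) (biq (a0, a1, a2, b0, b1, b2) s) = biq (a0 + r * b0, a1 + r * b1, a2 + r * b2, b0, b1, b2) s"
  by (auto simp: ratio_def field_simps)

lemma TLC_Res_series:
  assumes "Res u" "TLC v" shows "TLC (\<lambda>s. radd (u s) (v s))"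
  using assms(1)
proof (cases rule: Res_cases)
  case 1
  then show ?thesis by (intro Res_TLC Res_None) auto
next
  case (2 r)
  obtain a0 a1 a2 b0 b1 b2 where x: "regular (a0, a1, a2, b0, b1, b2)" "(a0, a1, a2, b0, b1, b2) \<noteq> 0"
    "\<And>s. s > 0 \<Longrightarrow> v s = biq (a0, a1, a2, b0, b1, b2) s"
    using assms(2) unfolding TLC_def by (metis prod_cases6)
  have "(a0 + r * b0, a1 + r * b1, a2 + r * b2, b0, b1, b2) \<noteq> 0" using x(2) by (auto simp: zero_prod_def)
  then show ?thesis unfolding TLC_def using regular_add[OF 2(1) x(1)] biq_add x(3) 2(2)
    by (metis (no_types, lifting))
qed

lemma TLL_Res_series:
  assumes "Res u" "TLL v" shows "TLL (\<lambda>s. radd (u s) (v s))"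
  using assms(1)
proof (cases rule: Res_cases)
  case 1
  then show ?thesis by (intro Res_TLL Res_None) auto
next
  case (2 r)
  obtain a0 a1 a2 b0 b1 b2 where x: "rl (a0, a1, a2, b0, b1, b2)" "(a0, a1, a2, b0, b1, b2) \<noteq> 0"
    "\<And>s. s > 0 \<Longrightarrow> v s = biq (a0, a1, a2, b0, b1, b2) s"
    using assms(2) unfolding TLL_def by (metis prod_cases6)
  have "(a0 + r * b0, a1 + r * b1, a2 + r * b2, b0, b1, b2) \<noteq> 0" using x(2) by (auto simp: zero_prod_def)
  then show ?thesis unfolding TLL_def using rl_add[OF 2(1) x(1)] biq_add x(3) 2(2)
    by (metis (no_types, lifting))
qed

lemma Res_Res_series:
  assumes "Res u" "Res v" shows "Res (\<lambda>s. radd (u s) (v s))"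
  using assms(1)
proof (cases rule: Res_cases)
  case 1
  then show ?thesis by (intro Res_None) auto
next
  case (2 r)
  from assms(2) show ?thesis
  proof (cases rule: Res_cases)
    case 1
    then show ?thesis by (intro Res_None) auto
  next
    case (2 r')
    then show ?thesis using \<open>0 \<le> r\<close> \<open>\<And>s. s > 0 \<Longrightarrow> u s = Some r\<close> by (intro Res_Some[of "r + r'"]) auto
  qed
qed

lemma WL_Res_series:
  assumes "Res u" "WL v" shows "WL (\<lambda>s. radd (u s) (v s))"
  using assms(1)
proof (cases rule: Res_cases)
  case 1
  then show ?thesis by (intro Res_WL Res_None) auto
next
  case (2 r)
  from assms(2)[unfolded WL_def] show ?thesis
  proof (elim disjE exE conjE)
    assume "Res v"
    then show ?thesis using assms(1) by (intro Res_WL Res_Res_series)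
  next
    fix r' l g :: real assume *: "0 \<le> r'" "0 < l" "0 \<le> g" "\<forall>s>0. v s = Some (r' + l * s / (1 + g * s))"
    then show ?thesis unfolding WL_def using 2
      by (intro disjI2 exI[of _ "r + r'"] exI[of _ l] exI[of _ g]) auto
  qed
qed

lemma WC_Res_series:
  assumes "Res u" "WC v" shows "WC (\<lambda>s. radd (u s) (v s))"
proof -
  have "Res (\<lambda>s. u (1 / s))" using assms(1) by (rule Res_flip)
  from WL_flip[OF WL_Res_series[OF this WC_flip[OF assms(2)]]] show ?thesis by simp
qed

lemma series_WL_WL:
  fixes l c g h :: real
  assumes "0 < l" "0 < k" "0 \<le> g" "0 \<le> h"
  shows "rl (0, l + k, l * h + k * g, 1, g + h, g * h)"
proof -
  have "bres (0, l + k, l * h + k * g, 1, g + h, g * h) = - (l * k * (g - h)\<^sup>2)"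
    by (simp add: algebra_simps power2_eq_square)
  moreover have "0 \<le> l * k * (g - h)\<^sup>2" using assms by simp
  moreover have "(l * h + k * g) * (g + h) - (l + k) * (g * h) = l * h\<^sup>2 + k * g\<^sup>2"
    by (simp add: algebra_simps power2_eq_square)
  moreover have "0 \<le> l * h\<^sup>2 + k * g\<^sup>2" using assms by simp
  ultimately show ?thesis using assms by (simp add: add_nonneg_nonneg)
qed

lemma WL_WL_series:
  assumes "WL u" "WL v" shows "TLL (\<lambda>s. radd (u s) (v s))"
  using assms(1) unfolding WL_def
proof (elim disjE exE conjE)
  assume "Res u" then show ?thesis using assms(2) by (intro TLL_Res_series WL_TLL)
next
  fix r l g :: real assume u: "0 \<le> r" "0 < l" "0 \<le> g" "\<forall>s>0. u s = Some (r + l * s / (1 + g * s))"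
  show ?thesis
    using assms(2) unfolding WL_def
  proof (elim disjE exE conjE)
    assume "Res v" then show ?thesis
      using TLL_Res_series[OF _ WL_TLL[OF assms(1)], of v] by (simp add: radd_commute)
  next
    fix r' k h :: real assume v: "0 \<le> r'" "0 < k" "0 \<le> h" "\<forall>s>0. v s = Some (r' + k * s / (1 + h * s))"
    let ?x = "(0, l + k, l * h + k * g, 1, g + h, g * h) :: biquad"
    have 1: "rl ?x" using u v by (intro series_WL_WL) auto
    have 2: "?x \<noteq> 0" by (simp add: zero_prod_def)
    have 3: "TLL (biq ?x)" unfolding TLL_def using 1 2 by blast
    have 4: "radd (u s) (v s) = radd (Some (r + r')) (biq ?x s)" if s: "s > 0" for s
    proof -
      have p: "0 < 1 + g * s" "0 < 1 + h * s" using s u v by (simp_all add: add_pos_nonneg)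
      have "1 + (g + h) * s + g * h * s\<^sup>2 = (1 + g * s) * (1 + h * s)"
        by (simp add: algebra_simps power2_eq_square)
      moreover have "l * s / (1 + g * s) + k * s / (1 + h * s) =
          (0 + (l + k) * s + (l * h + k * g) * s\<^sup>2) / ((1 + g * s) * (1 + h * s))"
        using p by (simp add: add_frac_eq) (simp add: algebra_simps power2_eq_square)
      ultimately have "biq ?x s = Some (l * s / (1 + g * s) + k * s / (1 + h * s))"
        using p by (simp add: ratio_def)
      then show ?thesis using u v s by simp
    qed
    have "TLL (\<lambda>s. radd (Some (r + r')) (biq ?x s))"
      using u v by (intro TLL_Res_series[OF _ 3] Res_Some[of "r + r'"]) auto
    then show ?thesis by (rule TLL_cong) (rule 4)
  qed
qed

lemma WL_WC_series:
  assumes "WL u" "WC v" shows "TLC (\<lambda>s. radd (u s) (v s))"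
  using assms(1) unfolding WL_def
proof (elim disjE exE conjE)
  assume "Res u" then show ?thesis using assms(2) by (intro TLC_Res_series WC_TLC)
next
  fix r l g :: real assume u: "0 \<le> r" "0 < l" "0 \<le> g" "\<forall>s>0. u s = Some (r + l * s / (1 + g * s))"
  show ?thesis
    using assms(2) unfolding WC_def
  proof (elim disjE exE conjE)
    assume "Res v" then show ?thesis
      using TLC_Res_series[OF _ WL_TLC[OF assms(1)], of v] by (simp add: radd_commute)
  next
    fix r' c h :: real assume v: "0 \<le> r'" "0 < c" "0 \<le> h" "\<forall>s>0. v s = Some (r' + c / (h + s))"
    let ?x = "(c, l * h + c * g, l, h, 1 + g * h, g) :: biquad"
    have 1: "regular ?x" using u v by (intro series_WL_WC) auto
    have 2: "?x \<noteq> 0" using u by (simp add: zero_prod_def)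
    have 3: "TLC (biq ?x)" unfolding TLC_def using 1 2 by blast
    have 4: "radd (u s) (v s) = radd (Some (r + r')) (biq ?x s)" if s: "s > 0" for s
    proof -
      have p: "0 < 1 + g * s" "0 < h + s" using s u v by (simp_all add: add_pos_nonneg add_nonneg_pos)
      have "h + (1 + g * h) * s + g * s\<^sup>2 = (1 + g * s) * (h + s)"
        by (simp add: algebra_simps power2_eq_square)
      moreover have "l * s / (1 + g * s) + c / (h + s) =
          (c + (l * h + c * g) * s + l * s\<^sup>2) / ((1 + g * s) * (h + s))"
        using p by (simp add: add_frac_eq) (simp add: algebra_simps power2_eq_square)
      ultimately have "biq ?x s = Some (l * s / (1 + g * s) + c / (h + s))"
        using p by (simp add: ratio_def)
      then show ?thesis using u v s by simp
    qed
    have "TLC (\<lambda>s. radd (Some (r + r')) (biq ?x s))"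
      using u v by (intro TLC_Res_series[OF _ 3] Res_Some[of "r + r'"]) auto
    then show ?thesis by (rule TLC_cong) (rule 4)
  qed
qed

lemma pd_radd: "pd (\<lambda>s. radd (u s) (v s)) = (\<lambda>s. rpar (pd u s) (pd v s))"
  by (auto simp: pd_def rinv_radd)

lemma WL_WC_parallel: "WL u \<Longrightarrow> WC v \<Longrightarrow> TLC (\<lambda>s. rpar (u s) (v s))"
  using TLC_pd[OF WL_WC_series[OF WL_pd WC_pd], of u v] by (simp add: pd_radd pd_pd)

lemma WL_WL_parallel: "WL u \<Longrightarrow> WL v \<Longrightarrow> TLL (\<lambda>s. rpar (u s) (v s))"
  using TLL_pd[OF WL_WL_series[OF WL_pd WL_pd], of u v] by (simp add: pd_radd pd_pd)

lemma TLC_Res_parallel: "Res u \<Longrightarrow> TLC v \<Longrightarrow> TLC (\<lambda>s. rpar (u s) (v s))"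
  using TLC_pd[OF TLC_Res_series[OF Res_pd TLC_pd], of u v] by (simp add: pd_radd pd_pd)

lemma TLL_Res_parallel: "Res u \<Longrightarrow> TLL v \<Longrightarrow> TLL (\<lambda>s. rpar (u s) (v s))"
  using TLL_pd[OF TLL_Res_series[OF Res_pd TLL_pd], of u v] by (simp add: pd_radd pd_pd)

section \<open>The impedances of networks with one capacitor and two inductors\<close>

lemma WL_I:
  assumes "0 \<le> r" "0 < l" "0 \<le> g" "\<And>s. s > 0 \<Longrightarrow> v s = Some (r + l * s / (1 + g * s))"
  shows "WL v"
  using assms unfolding WL_def by blast

text \<open>
  In \<open>PX\<close> the branch \<open>(e0 + e1 s) / f\<close> is open if \<open>f = 0\<close>. The substitution \<open>s \<mapsto> 1 / s\<close> in \<open>PC\<close>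
  turns a branch with a capacitor into one with an inductor.
\<close>

definition biqs :: "biquad set \<Rightarrow> (real \<Rightarrow> real option) \<Rightarrow> bool" where
  "biqs X v \<longleftrightarrow> (\<exists>x\<in>X. x \<noteq> 0 \<and> (\<forall>s>0. v s = biq x s))"

definition PX :: "biquad set \<Rightarrow> (real \<Rightarrow> real option) \<Rightarrow> bool" where
  "PX X v \<longleftrightarrow> (\<exists>r e0 e1 f w. 0 \<le> r \<and> 0 \<le> e0 \<and> 0 \<le> e1 \<and> 0 \<le> f \<and> 0 < e0 + e1 + f \<and> biqs X w \<and>
     (\<forall>s>0. v s = radd (Some r) (rpar (ratio (e0 + e1 * s) f) (w s))))"

definition PL :: "(real \<Rightarrow> real option) \<Rightarrow> bool" where
  "PL = PX {x. regular x}"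

definition PC :: "(real \<Rightarrow> real option) \<Rightarrow> bool" where
  "PC v = PX {x. rl (bflip x)} (\<lambda>s. v (1 / s))"

text \<open>The connection that first separates the three storage elements splits them as one
  against two: an inductor against the other two, or the capacitor against two inductors. In
  parallel this gives \<open>PL\<close> or \<open>PC\<close>, in series their images under
  \<open>pd\<close>.\<close>

definition TLLC :: "(real \<Rightarrow> real option) \<Rightarrow> bool" where
  "TLLC v \<longleftrightarrow> PL v \<or> PC v \<or> PL (pd v) \<or> PC (pd v)"

lemma TLLC_pd: "TLLC v \<Longrightarrow> TLLC (pd v)"
  unfolding TLLC_def pd_pd by auto

lemma PX_I:
  assumes "0 \<le> r" "0 \<le> e0" "0 \<le> e1" "0 \<le> f" "0 < e0 + e1 + f" "biqs X w"
    and "\<And>s. s > 0 \<Longrightarrow> v s = radd (Some r) (rpar (ratio (e0 + e1 * s) f) (w s))"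
  shows "PX X v"
  using assms unfolding PX_def by blast

lemma PX_cong: "PX X v \<Longrightarrow> (\<And>s. s > 0 \<Longrightarrow> w s = v s) \<Longrightarrow> PX X w" unfolding PX_def by auto

lemma biqs_PX: "biqs X v \<Longrightarrow> PX X v"
  by (rule PX_I[of 0 1 0 0 X v]) auto

lemma TLC_biqs: "TLC v \<longleftrightarrow> biqs {x. regular x} v"
  by (simp add: TLC_def biqs_def)

lemma TLL_biqs: "TLL (\<lambda>s. v (1 / s)) \<longleftrightarrow> biqs {x. rl (bflip x)} v"
proof
  assume "TLL (\<lambda>s. v (1 / s))"
  then obtain x where x: "rl x" "x \<noteq> 0" "\<forall>s>0. v (1 / s) = biq x s" unfolding TLL_def by blast
  have "v s = biq (bflip x) s" if "s > 0" for s
    using x(3)[rule_format, of "1 / s"] that by (simp add: biq_flip)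
  then show "biqs {x. rl (bflip x)} v" using x unfolding biqs_def by (intro bexI[of _ "bflip x"]) auto
next
  assume "biqs {x. rl (bflip x)} v"
  then obtain x where "rl (bflip x)" "x \<noteq> 0" "\<forall>s>0. v s = biq x s" unfolding biqs_def by blast
  then show "TLL (\<lambda>s. v (1 / s))" unfolding TLL_def by (intro exI[of _ "bflip x"]) (auto simp: biq_flip)
qed

section \<open>Impedance scaling and resistors added to a representation\<close>

definition oscale :: "real \<Rightarrow> real option \<Rightarrow> real option" where
  "oscale k = map_option ((*) k)"

lemma oscale_ratio: "oscale k (ratio x y) = ratio (k * x) y"
  by (auto simp: oscale_def ratio_def)

lemma oscale_rpar: "k > 0 \<Longrightarrow> oscale k (rpar v w) = rpar (oscale k v) (oscale k w)"
proof -
  assume k: "k > 0"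
  have 1: "oscale k (rinv v) = rinv (oscale (inverse k) v)" for v
    using k by (cases v) (auto simp: oscale_def rinv_def field_simps)
  have 2: "oscale (inverse k) (rinv v) = rinv (oscale k v)" for v
    using k by (cases v) (auto simp: oscale_def rinv_def field_simps)
  have 3: "oscale j (radd v w) = radd (oscale j v) (oscale j w)" for j v w
    by (cases v; cases w) (auto simp: oscale_def algebra_simps)
  show ?thesis unfolding rpar_def by (simp add: 1 2 3)
qed

lemma min_at_0_scale:
  assumes k: "k > 0"
  shows "min_at_0 (a0, a1, a2, b0, b1, b2) \<Longrightarrow> min_at_0 (k * a0, k * a1, k * a2, b0, b1, b2)"
    and "min_at_0 (b0, b1, b2, a0, a1, a2) \<Longrightarrow> min_at_0 (b0, b1, b2, k * a0, k * a1, k * a2)"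
proof -
  have e: "k * x * y - k * u * w = k * (x * y - u * w)" "x * (k * y) - u * (k * w) = k * (x * y - u * w)"
    for x y u w :: real
    by (simp_all add: algebra_simps)
  assume m: "min_at_0 (a0, a1, a2, b0, b1, b2)"
  have "b0 * (k * (a2 * b0 - a0 * b2)) \<le> b1 * (k * (a1 * b0 - a0 * b1))"
    using m k unfolding min_at_0.simps mult.left_commute[of _ k] by (intro mult_left_mono) auto
  then show "min_at_0 (k * a0, k * a1, k * a2, b0, b1, b2)"
    using k m unfolding min_at_0.simps e by (meson less_imp_le mult_nonneg_nonneg)
next
  have e: "k * x * y - k * u * w = k * (x * y - u * w)" "x * (k * y) - u * (k * w) = k * (x * y - u * w)"
    for x y u w :: real
    by (simp_all add: algebra_simps)
  assume m: "min_at_0 (b0, b1, b2, a0, a1, a2)"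
  have kk: "k * x * (k * y) = k * k * (x * y)" for x y :: real by simp
  from m have "k * k * (a0 * (b2 * a0 - b0 * a2)) \<le> k * k * (a1 * (b1 * a0 - b0 * a1))"
    using k by (intro mult_left_mono) auto
  then have "k * a0 * (k * (b2 * a0 - b0 * a2)) \<le> k * a1 * (k * (b1 * a0 - b0 * a1))"
    unfolding kk .
  then show "min_at_0 (b0, b1, b2, k * a0, k * a1, k * a2)"
    using k m unfolding min_at_0.simps e by (meson less_imp_le mult_nonneg_nonneg)
qed

lemma regular_scale:
  assumes "0 < k" "regular (a0, a1, a2, b0, b1, b2)"
  shows "regular (k * a0, k * a1, k * a2, b0, b1, b2)"
proof -
  have "bres (k * a0, k * a1, k * a2, b0, b1, b2) = k\<^sup>2 * bres (a0, a1, a2, b0, b1, b2)"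
    by (simp add: algebra_simps power2_eq_square)
  then show ?thesis
    using assms min_at_0_scale[OF assms(1)] unfolding regular_def bflip.simps bswap.simps nonneg.simps
    by (metis mult_nonneg_nonneg less_imp_le zero_le_power2)
qed

lemma TLC_oscale:
  assumes "TLC v" "k > 0" shows "TLC (\<lambda>s. oscale k (v s))"
proof -
  obtain a0 a1 a2 b0 b1 b2 where x: "regular (a0, a1, a2, b0, b1, b2)" "(a0, a1, a2, b0, b1, b2) \<noteq> 0"
    "\<And>s. s > 0 \<Longrightarrow> v s = biq (a0, a1, a2, b0, b1, b2) s"
    using assms(1) unfolding TLC_def by (metis prod_cases6)
  have "oscale k (v s) = biq (k * a0, k * a1, k * a2, b0, b1, b2) s" if "s > 0" for s
    using x(3)[OF that] by (simp add: oscale_ratio algebra_simps)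
  moreover have "(k * a0, k * a1, k * a2, b0, b1, b2) \<noteq> 0" using x(2) assms(2) by (auto simp: zero_prod_def)
  ultimately show ?thesis unfolding TLC_def using regular_scale[OF assms(2) x(1)] by blast
qed

lemma TLL_oscale:
  assumes "TLL v" "k > 0" shows "TLL (\<lambda>s. oscale k (v s))"
proof -
  obtain a0 a1 a2 b0 b1 b2 where x: "rl (a0, a1, a2, b0, b1, b2)" "(a0, a1, a2, b0, b1, b2) \<noteq> 0"
    "\<And>s. s > 0 \<Longrightarrow> v s = biq (a0, a1, a2, b0, b1, b2) s"
    using assms(1) unfolding TLL_def by (metis prod_cases6)
  have "oscale k (v s) = biq (k * a0, k * a1, k * a2, b0, b1, b2) s" if "s > 0" for s
    using x(3)[OF that] by (simp add: oscale_ratio algebra_simps)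
  moreover have "(k * a0, k * a1, k * a2, b0, b1, b2) \<noteq> 0" using x(2) assms(2) by (auto simp: zero_prod_def)
  moreover have "bres (k * a0, k * a1, k * a2, b0, b1, b2) = k\<^sup>2 * bres (a0, a1, a2, b0, b1, b2)"
    by (simp add: algebra_simps power2_eq_square)
  then have "rl (k * a0, k * a1, k * a2, b0, b1, b2)"
    using x(1) assms(2) by (auto simp: mult.assoc mult_nonneg_nonpos simp del: bres.simps)
  ultimately show ?thesis unfolding TLL_def by blast
qed

text \<open>A resistor ladder in front of \<open>m\<close> collapses to two resistors once \<open>m\<close> is rescaled.\<close>

lemma shunt_exchange:
  assumes "0 < R" "0 \<le> r" "\<And>x. m = Some x \<Longrightarrow> 0 \<le> x"
  shows "rpar (Some R) (radd (Some r) m) =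
    radd (Some (r * R / (R + r))) (rpar (Some (R\<^sup>2 / (R + r))) (oscale ((R / (R + r))\<^sup>2) m))"
proof (cases m)
  case None
  have "r * R / (R + r) + R\<^sup>2 / (R + r) = R"
    using assms by (simp add: add_divide_distrib[symmetric] power2_eq_square distrib_left[symmetric] mult.commute[of r] add.commute[of r])
  then show ?thesis using None by (simp add: oscale_def)
next
  case (Some x)
  have par: "rpar (Some y) (Some z) = Some (y * z / (y + z))" if "0 < y" "0 \<le> z" for y z
    using that by (cases "z = 0") (auto simp: rpar_def rinv_def field_simps)
  have "0 < R + r" using assms by simp
  define t where "t = R + r"
  have t: "t > 0" "R = t - r" using assms by (simp_all add: t_def)
  have x: "0 \<le> x" using assms Some by simp
  have "rpar (Some R) (radd (Some r) m) = Some (R * (r + x) / (t + x))"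
    using assms x by (simp add: Some par t_def add.assoc)
  moreover have "radd (Some (r * R / t)) (rpar (Some (R\<^sup>2 / t)) (oscale ((R / t)\<^sup>2) m))
     = Some (r * R / t + (R\<^sup>2 / t) * ((R / t)\<^sup>2 * x) / (R\<^sup>2 / t + (R / t)\<^sup>2 * x))"
    using assms x t(1) by (simp add: Some oscale_def par)
  moreover have "R\<^sup>2 / t + (R / t)\<^sup>2 * x = (R / t)\<^sup>2 * (t + x)"
    using t(1) by (simp add: field_simps power2_eq_square)
  moreover have "(R\<^sup>2 / t) * ((R / t)\<^sup>2 * x) / ((R / t)\<^sup>2 * (t + x)) = R\<^sup>2 / t * x / (t + x)"
    using t(1) x assms(1) by simp
  moreover have "r * R / t + R\<^sup>2 / t * x / (t + x) = R * (r + x) / (t + x)"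
  proof -
    have "r * R / t + R\<^sup>2 / t * x / (t + x) = R * (r * (t + x) + R * x) / (t * (t + x))"
    proof -
      have "t + x \<noteq> 0" using t(1) x by simp
      then show ?thesis using t(1) by (simp add: divide_simps power2_eq_square) (simp add: algebra_simps)
    qed
    also have "r * (t + x) + R * x = t * (r + x)"
      by (simp add: t_def algebra_simps)
    finally show ?thesis using t(1) by simp
  qed
  ultimately show ?thesis unfolding t_def[symmetric] by simp
qed

text \<open>What \<open>PX\<close> requires of its biquadratics to be closed under adding resistors:
  closure under \<open>oscale\<close> absorbs the rescaling in \<open>shunt_exchange\<close>, and
  closure under resistive shunts absorbs the shunt that it leaves behind.\<close>

definition branch_class :: "biquad set \<Rightarrow> bool" where
  "branch_class X \<longleftrightarrow> (\<forall>x\<in>X. nonneg x) \<and> (\<forall>v. Res v \<longrightarrow> biqs X v) \<and>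
     (\<forall>u v. Res u \<longrightarrow> biqs X v \<longrightarrow> biqs X (\<lambda>s. rpar (u s) (v s))) \<and>
     (\<forall>k v. 0 < k \<longrightarrow> biqs X v \<longrightarrow> biqs X (\<lambda>s. oscale k (v s)))"

lemma branch_class_regular: "branch_class {x. regular x}"
  unfolding branch_class_def TLC_biqs[symmetric]
  using Res_TLC TLC_Res_parallel TLC_oscale by (auto simp: regular_def)

lemma branch_class_rl: "branch_class {x. rl (bflip x)}"
  unfolding branch_class_def TLL_biqs[symmetric]
proof (intro conjI allI impI ballI)
  fix x assume "x \<in> {x. rl (bflip x)}"
  then have "nonneg (bflip x)" by (cases "bflip x") auto
  then show "nonneg x" by simp
qed (use Res_TLL[OF Res_flip] TLL_Res_parallel[OF Res_flip] TLL_oscale in auto)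

lemma
  assumes "branch_class X"
  shows biqs_Res: "Res v \<Longrightarrow> biqs X v"
    and biqs_parallel: "Res u \<Longrightarrow> biqs X v \<Longrightarrow> biqs X (\<lambda>s. rpar (u s) (v s))"
    and biqs_oscale: "0 < k \<Longrightarrow> biqs X v \<Longrightarrow> biqs X (\<lambda>s. oscale k (v s))"
  using assms unfolding branch_class_def by blast+

lemma biqs_nonneg:
  assumes "branch_class X" "biqs X w" "s > 0" "w s = Some x" shows "0 \<le> x"
proof -
  obtain a0 a1 a2 b0 b1 b2 where "nonneg (a0, a1, a2, b0, b1, b2)" "w s = biq (a0, a1, a2, b0, b1, b2) s"
    using assms unfolding biqs_def branch_class_def by (metis prod_cases6)
  then show ?thesis using assms(3,4) by (auto simp: ratio_def split: if_splits)
qed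

lemma rpar_nonneg:
  assumes "rpar v w = Some x" "\<And>y. v = Some y \<Longrightarrow> 0 \<le> y" "\<And>y. w = Some y \<Longrightarrow> 0 \<le> y"
  shows "0 \<le> x"
  using assms by (cases v; cases w) (auto simp: rpar_def rinv_def split: if_splits)

lemma PX_Res_series:
  assumes X: "branch_class X" and "Res u" "PX X v" shows "PX X (\<lambda>s. radd (u s) (v s))"
  using assms(2)
proof (cases rule: Res_cases)
  case 1
  then show ?thesis by (intro biqs_PX biqs_Res[OF X] Res_None) auto
next
  case (2 r)
  from assms(3) obtain r' e0 e1 f w where
    "0 \<le> r'" "0 \<le> e0 \<and> 0 \<le> e1 \<and> 0 \<le> f \<and> 0 < e0 + e1 + f \<and> biqs X w"
    "\<forall>s>0. v s = radd (Some r') (rpar (ratio (e0 + e1 * s) f) (w s))"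
    unfolding PX_def by blast
  then show ?thesis using 2
    by (intro PX_I[of "r + r'" e0 e1 f X w]) (auto simp: radd_assoc[symmetric])
qed

text \<open>By \<open>shunt_exchange\<close> the shunt R passes behind the series resistor r. There
  it is in parallel with both branches, rescaled by k, and is absorbed into the biquadratic.\<close>

lemma PX_Res_parallel:
  assumes X: "branch_class X" and "Res u" "PX X v" shows "PX X (\<lambda>s. rpar (u s) (v s))"
  using assms(2)
proof (cases rule: Res_cases)
  case 1
  then show ?thesis using assms(3) by (auto elim: PX_cong)
next
  case (2 R)
  show ?thesis
  proof (cases "R = 0")
    case True
    then show ?thesis using 2 by (intro biqs_PX biqs_Res[OF X] Res_Some[of 0]) auto
  next
    case False
    then have R: "R > 0" using 2 by simp
    obtain r e0 e1 f w where *: "0 \<le> r" "0 \<le> e0" "0 \<le> e1" "0 \<le> f" "0 < e0 + e1 + f" "biqs X w"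
      "\<And>s. s > 0 \<Longrightarrow> v s = radd (Some r) (rpar (ratio (e0 + e1 * s) f) (w s))"
      using assms(3) unfolding PX_def by blast
    define k where "k = (R / (R + r))\<^sup>2"
    have k: "0 < k" using R *(1) by (simp add: k_def)
    let ?w = "\<lambda>s. rpar (Some (R\<^sup>2 / (R + r))) (oscale k (w s))"
    have "biqs X ?w"
      using *(1) R by (intro biqs_parallel[OF X] biqs_oscale[OF X k *(6)] Res_Some[of "R\<^sup>2 / (R + r)"]) auto
    moreover have "rpar (u s) (v s) = radd (Some (r * R / (R + r)))
        (rpar (ratio (k * e0 + k * e1 * s) f) (?w s))" if s: "s > 0" for s
    proof -
      have "0 \<le> x" if "rpar (ratio (e0 + e1 * s) f) (w s) = Some x" for x
        using that by (rule rpar_nonneg)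
          (use * s biqs_nonneg[OF X *(6) s] in \<open>auto simp: ratio_def split: if_splits\<close>)
      then have "rpar (u s) (v s) = radd (Some (r * R / (R + r)))
          (rpar (Some (R\<^sup>2 / (R + r))) (oscale k (rpar (ratio (e0 + e1 * s) f) (w s))))"
        unfolding *(7)[OF s] 2(2)[OF s] k_def by (intro shunt_exchange R *(1)) auto
      then show ?thesis
        unfolding oscale_rpar[OF k] oscale_ratio by (simp add: rpar_left_commute algebra_simps)
    qed
    moreover have "0 < k * e0 + k * e1 + f"
    proof (cases "f > 0")
      case True then show ?thesis using * k by (simp add: add_nonneg_pos)
    next
      case False
      then have "0 < k * (e0 + e1)" using *(4,5) k by auto
      then show ?thesis using *(4) by (simp add: algebra_simps)
    qed
    ultimately show ?thesis using * k R
      by (intro PX_I[of "r * R / (R + r)" "k * e0" "k * e1" f X ?w]) simp_all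
  qed
qed

lemma TLLC_Res_series: "Res u \<Longrightarrow> TLLC v \<Longrightarrow> TLLC (\<lambda>s. radd (u s) (v s))"
proof -
  assume u: "Res u" and v: "TLLC v"
  note regs = branch_class_regular branch_class_rl
  have "PL (\<lambda>s. radd (u s) (v s))" if "PL v"
    using PX_Res_series[OF regs(1) u] that by (simp add: PL_def)
  moreover have "PC (\<lambda>s. radd (u s) (v s))" if "PC v"
    using PX_Res_series[OF regs(2) Res_flip[OF u]] that by (simp add: PC_def)
  moreover have "PL (\<lambda>s. rpar (pd u s) (pd v s))" if "PL (pd v)"
    using PX_Res_parallel[OF regs(1) Res_pd[OF u]] that by (simp add: PL_def)
  moreover have "PC (\<lambda>s. rpar (pd u s) (pd v s))" if "PC (pd v)"
    using PX_Res_parallel[OF regs(2) Res_flip[OF Res_pd[OF u]]] that by (simp add: PC_def)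
  ultimately show ?thesis using v unfolding TLLC_def pd_radd by blast
qed

text \<open>The branches of \<open>PX\<close> carry no shunt of their own. The admittance (1 + g s)
  / (r + (l + r g) s) of a general RL branch is its limit \<gamma> at infinity plus f / (r + (l + r
  g) s), and the conductance \<gamma> is absorbed into the biquadratic.\<close>

lemma WL_parallel:
  assumes X: "branch_class X" and "WL v" "biqs X w" shows "PX X (\<lambda>s. rpar (v s) (w s))"
  using assms(2) unfolding WL_def
proof (elim disjE exE conjE)
  assume "Res v"
  then show ?thesis by (intro biqs_PX biqs_parallel[OF X] assms)
next
  fix r l g :: real assume *: "0 \<le> r" "0 < l" "0 \<le> g" "\<forall>s>0. v s = Some (r + l * s / (1 + g * s))"
  define \<gamma> f where "\<gamma> = g / (l + r * g)" and "f = l / (l + r * g)"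
  have d: "0 < l + r * g" using * by (simp add: add_pos_nonneg)
  have \<gamma>: "0 \<le> \<gamma>" and f: "0 < f" using * d by (auto simp: \<gamma>_def f_def)
  let ?w = "\<lambda>s. rpar (ratio 1 \<gamma>) (w s)"
  have "biqs X ?w" using \<gamma>
    by (intro biqs_parallel[OF X] assms) (unfold Res_def, rule exI[of _ 1], rule exI[of _ \<gamma>], simp)
  moreover have "rpar (v s) (w s) = radd (Some 0) (rpar (ratio (r + (l + r * g) * s) f) (?w s))"
    if s: "s > 0" for s
  proof -
    have p: "0 < 1 + g * s" "0 < r + (l + r * g) * s"
      using s * d by (auto simp: add_pos_nonneg add_nonneg_pos)
    have "rpar (ratio (r + (l + r * g) * s) f) (ratio 1 \<gamma>) =
      ratio ((r + (l + r * g) * s) * 1) ((r + (l + r * g) * s) * \<gamma> + 1 * f)"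
      using p f \<gamma> by (intro rpar_ratio) auto
    also have "(r + (l + r * g) * s) * \<gamma> + 1 * f = 1 + g * s"
    proof -
      have "(l + r * g) * \<gamma> = g" "(l + r * g) * f = l" using d by (simp_all add: \<gamma>_def f_def)
      moreover have "r * \<gamma> + f = 1" using d by (simp add: \<gamma>_def f_def add_divide_distrib[symmetric] add.commute)
      moreover have "(r + (l + r * g) * s) * \<gamma> + 1 * f = r * \<gamma> + f + (l + r * g) * \<gamma> * s"
        by (simp add: algebra_simps)
      ultimately show ?thesis by simp
    qed
    also have "ratio ((r + (l + r * g) * s) * 1) (1 + g * s) = v s"
      using p * s by (simp add: ratio_def field_simps)
    finally show ?thesis by (simp add: rpar_assoc[symmetric])
  qed
  ultimately show ?thesis using * d f
    by (intro PX_I[of 0 r "l + r * g" f X ?w]) simp_all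
qed

lemma WL_TLC_series: "WL v \<Longrightarrow> TLC w \<Longrightarrow> TLLC (\<lambda>s. radd (v s) (w s))"
  using WL_parallel[OF branch_class_regular WL_pd, of v "pd w"] TLC_pd[of w]
  by (simp add: TLLC_def pd_radd PL_def TLC_biqs)

lemma TLL_WC_series: "TLL v \<Longrightarrow> WC w \<Longrightarrow> TLLC (\<lambda>s. radd (v s) (w s))"
proof -
  assume v: "TLL v" and w: "WC w"
  have "biqs {x. rl (bflip x)} (\<lambda>s. pd v (1 / s))"
    using TLL_pd[OF v] by (simp add: TLL_biqs[symmetric])
  from WL_parallel[OF branch_class_rl WC_flip[OF WC_pd[OF w]] this]
  show ?thesis by (simp add: TLLC_def pd_radd PC_def rpar_commute)
qed

section \<open>Structural induction over networks\<close>

definition cls :: "nat \<Rightarrow> nat \<Rightarrow> (real \<Rightarrow> real option) \<Rightarrow> bool" where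
  "cls c l = (if c = 0 then (if l = 0 then Res else if l = 1 then WL else TLL)
     else (if l = 0 then WC else if l = 1 then TLC else TLLC))"

lemma cls_pd: "cls c l v \<Longrightarrow> cls c l (pd v)"
  by (auto simp: cls_def Res_pd WL_pd WC_pd TLC_pd TLL_pd TLLC_pd)

lemma cls_series:
  assumes "cls c l u" "cls c' l' v" "c + c' \<le> 1" "l + l' \<le> 2"
  shows "cls (c + c') (l + l') (\<lambda>s. radd (u s) (v s))"
proof -
  \<comment> \<open>Since \<open>radd\<close> is commutative, it suffices to treat pairs of element
    counts in lexicographic order.\<close>
  have sym: "cls (c + c') (l + l') (\<lambda>s. radd (u s) (v s))"
    if "cls c l u" "cls c' l' v" "c' + c \<le> 1" "l' + l \<le> 2" "c < c' \<or> c = c' \<and> l \<le> l'" for u v c c' l l'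
  proof -
    from that have "c = 0 \<and> c' = 0 \<or> c = 0 \<and> c' = 1" by linarith
    then consider "c = 0" "c' = 0" | "c = 0" "c' = 1" by blast
    then show ?thesis
    proof cases
      case 1
      then have "l = 0 \<and> l' = 0 \<or> l = 0 \<and> l' = 1 \<or> l = 0 \<and> l' = 2 \<or> l = 1 \<and> l' = 1"
        using that by linarith
      then consider "l = 0" "l' = 0" | "l = 0" "l' = 1" | "l = 0" "l' = 2" | "l = 1" "l' = 1"
        by blast
      then show ?thesis
        using that(1,2) 1 Res_Res_series[of u v] WL_Res_series[of u v] TLL_Res_series[of u v] WL_WL_series[of u v]
        by cases (simp_all add: cls_def)
    next
      case 2
      have "l = 0 \<and> l' = 0 \<or> l = 0 \<and> l' = 1 \<or> l = 0 \<and> l' = 2 \<or> l = 1 \<and> l' = 0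
          \<or> l = 1 \<and> l' = 1 \<or> l = 2 \<and> l' = 0"
        using that by linarith
      then consider "l = 0" "l' = 0" | "l = 0" "l' = 1" | "l = 0" "l' = 2" | "l = 1" "l' = 0"
        | "l = 1" "l' = 1" | "l = 2" "l' = 0"
        by blast
      then show ?thesis using that(1,2) 2 WC_Res_series[of u v] TLC_Res_series[of u v]
          TLLC_Res_series[of u v] WL_WC_series[of u v] WL_TLC_series[of u v] TLL_WC_series[of u v]
        by cases (simp_all add: cls_def)
    qed
  qed
  show ?thesis
  proof (cases "c < c' \<or> c = c' \<and> l \<le> l'")
    case True
    then show ?thesis using sym[OF assms(1,2)] assms(3,4) by (simp add: add.commute)
  next
    case False
    then have "cls (c' + c) (l' + l) (\<lambda>s. radd (v s) (u s))"
      using assms by (intro sym) auto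
    then show ?thesis by (simp add: add.commute radd_commute)
  qed
qed

lemma cls_parallel:
  assumes "cls c l u" "cls c' l' v" "c + c' \<le> 1" "l + l' \<le> 2"
  shows "cls (c + c') (l + l') (\<lambda>s. rpar (u s) (v s))"
  using cls_pd[OF cls_series[OF cls_pd cls_pd, OF assms]] by (simp add: pd_radd pd_pd)

lemma val_cls:
  "sp_network N \<Longrightarrow> num_capacitors N \<le> 1 \<Longrightarrow> num_inductors N \<le> 2 \<Longrightarrow>
    cls (num_capacitors N) (num_inductors N) (val N)"
proof (induction N)
  case (Resistor R)
  then show ?case by (auto simp: cls_def intro: Res_Some)
next
  case (Conductor G)
  then have "Res (val (Resistor G))" by (auto intro: Res_Some)
  from Res_rinv[OF this] show ?case by (simp add: cls_def)
next
  case (Inductor L)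
  then show ?case
    using WL_I[of 0 L 0 "val (Inductor L)"] by (simp add: cls_def val.simps[abs_def])
next
  case (Capacitor C)
  then have "WL (val (Inductor C))"
    using WL_I[of 0 C 0 "val (Inductor C)"] by simp
  from WL_rinv[OF this] show ?case by (simp add: cls_def)
next
  case (Series N M)
  then show ?case using cls_series by auto
next
  case (Parallel N M)
  then show ?case using cls_parallel by auto
qed

section \<open>Realization of biquadratic impedances\<close>

definition "net5 R1 R2 G3 L1 L2 =
  Resistor R1 \<^bold>+ (Inductor L2 \<parallel> (Resistor R2 \<^bold>+ (Conductor G3 \<parallel> Inductor L1)))"
definition "net6 R1 R2 G3 C1 L1 =
  Resistor R1 \<^bold>+ (Inductor L1 \<parallel> (Resistor R2 \<^bold>+ (Conductor G3 \<parallel> Capacitor C1)))"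
definition "net7 R1 R2 G3 C1 L1 =
  Resistor R1 \<^bold>+ (Capacitor C1 \<parallel> (Resistor R2 \<^bold>+ (Conductor G3 \<parallel> Inductor L1)))"
definition "net8 G1 G2 R3 C1 L1 =
  Conductor G1 \<parallel> (Capacitor C1 \<^bold>+ (Conductor G2 \<parallel> (Resistor R3 \<^bold>+ Inductor L1)))"
definition "net9 G1 G2 R3 C1 L1 =
  Conductor G1 \<parallel> (Inductor L1 \<^bold>+ (Conductor G2 \<parallel> (Resistor R3 \<^bold>+ Capacitor C1)))"

fun coeffs_pos :: "biquad \<Rightarrow> bool" where
  "coeffs_pos (a0, a1, a2, b0, b1, b2) \<longleftrightarrow> 0 < a0 \<and> 0 < a1 \<and> 0 < a2 \<and> 0 < b0 \<and> 0 < b1 \<and> 0 < b2"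

text \<open>The absolute value lets this condition cover both \<open>min_at_0 x\<close> and
  \<open>min_at_0 (bflip x)\<close>. These two cones meet where a2 b0 = a0 b2, and such points must
  not count as boundary.\<close>

fun strict_min_at_0 :: "biquad \<Rightarrow> bool" where
  "strict_min_at_0 (a0, a1, a2, b0, b1, b2) \<longleftrightarrow>
     b0 * \<bar>a2 * b0 - a0 * b2\<bar> < b1 * (a1 * b0 - a0 * b1)"

text \<open>An open part of \<open>regular\<close> chosen so that outside it a canonical network
  lacks its first or third resistive element, or the function is bilinear; see
  \<open>regular_cases\<close>.\<close>

definition regular_int :: "biquad \<Rightarrow> bool" where
  "regular_int x \<longleftrightarrow> coeffs_pos x \<and> 0 < bres x \<and>
     (strict_min_at_0 x \<or> strict_min_at_0 (bflip x) \<or> strict_min_at_0 (bswap x)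
        \<or> strict_min_at_0 (bflip (bswap x)))"

fun rl_int :: "biquad \<Rightarrow> bool" where
  "rl_int (a0, a1, a2, b0, b1, b2) \<longleftrightarrow> coeffs_pos (a0, a1, a2, b0, b1, b2) \<and>
     0 < a2 * b0 - a0 * b2 \<and> 0 < a1 * b0 - a0 * b1 \<and> 0 < a2 * b1 - a1 * b2 \<and>
     bres (a0, a1, a2, b0, b1, b2) < 0"

lemma coeffs_pos_flip_swap [simp]: "coeffs_pos (bflip x) = coeffs_pos x" "coeffs_pos (bswap x) = coeffs_pos x"
  by (cases x; auto)+

lemma regular_int_flip_swap [simp]: "regular_int (bflip x) = regular_int x" "regular_int (bswap x) = regular_int x"
  by (auto simp: regular_int_def)

lemma coeffs_pos_nonneg: "coeffs_pos x \<Longrightarrow> nonneg x" by (cases x) auto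

text \<open>The sign of A decides which alternative holds. For A < 0 the identity b0 D = b1 A - b2 B
  forces D < 0 and turns the strict inequality into the one for the reversed coefficients.\<close>

lemma strict_min_at_0_imp:
  assumes "coeffs_pos x" "strict_min_at_0 x"
  shows "min_at_0 x \<or> min_at_0 (bflip x)"
proof (cases x)
  case (fields a0 a1 a2 b0 b1 b2)
  define A B D where "A = a2 * b0 - a0 * b2" and "B = a1 * b0 - a0 * b1" and "D = a2 * b1 - a1 * b2"
  have bD: "b0 * D = b1 * A - b2 * B" by (simp add: A_def B_def D_def algebra_simps)
  have pos: "0 < b0" "0 < b1" "0 < b2" using assms fields by auto
  have s: "b0 * \<bar>A\<bar> < b1 * B" using assms fields by (simp add: A_def B_def)
  have "0 \<le> b0 * \<bar>A\<bar>" using pos by simp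
  then have "0 < b1 * B" using s by linarith
  then have B: "0 < B" using pos by (simp add: zero_less_mult_iff)
  show ?thesis
  proof (cases "0 \<le> A")
    case True
    then have "min_at_0 x" using s B unfolding fields min_at_0.simps A_def[symmetric] B_def[symmetric] by simp
    then show ?thesis ..
  next
    case False
    then have A: "A < 0" by simp
    have "b0 * D < 0"
      using mult_pos_neg[OF pos(2) A] mult_pos_pos[OF pos(3) B] unfolding bD by linarith
    then have D: "D < 0" using pos by (simp add: mult_less_0_iff)
    have "b0 * (b1 * D - b2 * A) = b1 * b1 * A - b2 * (b1 * B + b0 * A)"
      using arg_cong[OF bD, of "(*) b1"] by (simp add: algebra_simps)
    moreover have "0 < b2 * (b1 * B + b0 * A)" using s A pos by simp
    moreover have "b1 * b1 * A < 0" using pos A by (simp add: mult_pos_neg)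
    ultimately have "b0 * (b1 * D - b2 * A) < 0" by linarith
    then have "b1 * D < b2 * A" using pos by (simp add: mult_less_0_iff)
    moreover have e: "a0 * b2 - a2 * b0 = - A" "a1 * b2 - a2 * b1 = - D"
      by (simp_all add: A_def D_def)
    ultimately have "min_at_0 (bflip x)"
      using A D unfolding fields bflip.simps min_at_0.simps e by simp
    then show ?thesis ..
  qed
qed

lemma regular_int_regular: "regular_int x \<Longrightarrow> regular x"
  unfolding regular_def regular_int_def
  using strict_min_at_0_imp[of x] strict_min_at_0_imp[of "bflip x"]
    strict_min_at_0_imp[of "bswap x"] strict_min_at_0_imp[of "bflip (bswap x)"]
  by (auto simp: coeffs_pos_nonneg)

lemma rl_int_rl: "rl_int x \<Longrightarrow> rl x"
  by (cases x) auto

lemma ratio_WC: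
  assumes "0 \<le> a0" "0 \<le> a1" "0 \<le> b0" "0 \<le> b1" "a0 \<noteq> 0 \<or> a1 \<noteq> 0 \<or> b0 \<noteq> 0 \<or> b1 \<noteq> 0"
    and "a1 * b0 \<le> a0 * b1" and v: "\<And>s. s > 0 \<Longrightarrow> v s = ratio (a0 + a1 * s) (b0 + b1 * s)"
  shows "WC v"
proof -
  have "WL (\<lambda>s. v (1 / s))"
  proof (rule ratio_WL[of a1 a0 b1 b0])
    fix s :: real assume s: "s > 0"
    then have "v (1 / s) = ratio (s * (a0 + a1 * (1 / s))) (s * (b0 + b1 * (1 / s)))"
      using v[of "1 / s"] by (simp add: ratio_scale)
    then show "v (1 / s) = ratio (a1 + a0 * s) (b1 + b0 * s)" using s by (simp add: algebra_simps)
  qed (use assms in auto)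
  from WL_flip[OF this] show ?thesis by simp
qed

lemma val_shunt: "x \<ge> 0 \<Longrightarrow> y > 0 \<Longrightarrow> rpar (rinv (Some x)) (rinv (Some y)) = Some (1 / (x + y))"
  by (auto simp: rpar_def rinv_def field_simps)

lemma rpar_Some: "0 < x \<Longrightarrow> 0 \<le> y \<Longrightarrow> rpar (Some x) (Some y) = Some (x * y / (x + y))"
  by (cases "y = 0") (auto simp: rpar_def rinv_def field_simps)

text \<open>
  Removing the resistor \<open>a0 / b0\<close> and then the inductor \<open>B / b0\<^sup>2\<close> from a biquadratic leaves the bilinear
  function \<open>(A s + B) / (b0 (b2 s + g))\<close>.
\<close>

lemma biq_ladder:
  fixes a0 a1 a2 b0 b1 b2 A B g s :: real
  defines "A \<equiv> a2 * b0 - a0 * b2" and "B \<equiv> a1 * b0 - a0 * b1"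
  assumes b: "0 < b0" "0 \<le> b1" "0 \<le> b2" and A: "0 \<le> A" and B: "0 < B" and gB: "g * B = b1 * B - b0 * A"
    and h: "0 < b2 * s + g" and s: "0 < s"
  shows "radd (Some (a0 / b0)) (rpar (Some (B / b0\<^sup>2 * s)) (Some ((A * s + B) / b0 / (b2 * s + g)))) =
    biq (a0, a1, a2, b0, b1, b2) s"
proof -
  define L d h e where "L = B / b0\<^sup>2" and "d = b0 + b1 * s + b2 * s\<^sup>2" and "h = b2 * s + g"
    and "e = (A * s + B) / b0"
  have d: "0 < d" using b s by (simp add: d_def add_pos_nonneg)
  have h: "0 < h" using h by (simp add: h_def)
  have e: "0 < e" using A B s b by (simp add: e_def add_nonneg_pos)
  have L: "0 < L" using B b by (simp add: L_def)
  have "L * s * h + e = L * d"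
  proof -
    have "b0\<^sup>2 * L = B" "b0\<^sup>2 * e = b0 * (A * s + B)"
      using b by (simp_all add: L_def e_def power2_eq_square)
    then have "b0\<^sup>2 * (L * s * h + e) = B * s * h + b0 * (A * s + B)"
      by (simp only: distrib_left mult.assoc[symmetric])
    also have "\<dots> = B * b2 * s\<^sup>2 + (g * B) * s + b0 * A * s + b0 * B"
      by (simp add: h_def algebra_simps power2_eq_square)
    also have "\<dots> = B * d" unfolding gB by (simp add: d_def algebra_simps)
    also have "\<dots> = b0\<^sup>2 * (L * d)" using b by (simp add: L_def)
    finally show ?thesis using b by simp
  qed
  then have "L * s + e / h = L * d / h" using h by (simp add: add_divide_distrib[symmetric] divide_simps)
  moreover have "rpar (Some (L * s)) (Some (e / h)) = Some (L * s * (e / h) / (L * s + e / h))"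
    using e h L s by (intro rpar_Some) auto
  ultimately have "rpar (Some (L * s)) (Some (e / h)) = Some (e * s / d)" using L h d by simp
  moreover have "a0 / b0 + e * s / d = (a0 + a1 * s + a2 * s\<^sup>2) / d"
  proof -
    have "a0 / b0 * d + e * s = a0 + a1 * s + a2 * s\<^sup>2"
      using b by (simp add: e_def d_def A_def B_def divide_simps) (simp add: algebra_simps power2_eq_square)
    then show ?thesis using d by (simp add: divide_simps)
  qed
  ultimately show ?thesis
    using d by (simp add: ratio_def d_def[symmetric] L_def[symmetric] h_def[symmetric] e_def[symmetric])
qed

text \<open>After the two ladder steps of \<open>biq_ladder\<close>, removing the value R2 = A / (b0
  b2) at infinity from the bilinear remainder leaves k / (b2 s + g), a conductance in parallel with
  a capacitor. The last inequality of \<open>min_at_0\<close> is g >= 0, and positivity of the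
  resultant is k > 0, because b0 times the resultant equals B (b2 B - A g). The two implications
  identify the boundary cases in which an element disappears.\<close>

lemma net6_realizes:
  assumes nn: "nonneg (a0, a1, a2, b0, b1, b2)" and m: "min_at_0 (a0, a1, a2, b0, b1, b2)"
    and K: "0 < bres (a0, a1, a2, b0, b1, b2)" and B0: "0 < a1 * b0 - a0 * b1"
  obtains R1 R2 G3 C1 L1 where "0 \<le> R1" "0 \<le> R2" "0 \<le> G3" "0 < C1" "0 < L1"
    "a0 = 0 \<longrightarrow> R1 = 0"
    "b1 * (a1 * b0 - a0 * b1) = b0 * (a2 * b0 - a0 * b2) \<longrightarrow> G3 = 0"
    "\<And>s. s > 0 \<Longrightarrow> val (net6 R1 R2 G3 C1 L1) s = biq (a0, a1, a2, b0, b1, b2) s"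
    "0 < b0" "0 < b2"
proof -
  define A B where "A = a2 * b0 - a0 * b2" and "B = a1 * b0 - a0 * b1"
  have A: "0 \<le> A" and B: "0 < B" and bBA: "b0 * A \<le> b1 * B"
    using m B0 by (auto simp: A_def B_def)
  have b: "0 \<le> a0" "0 \<le> b0" "0 \<le> b1" "0 \<le> b2" "0 \<le> a2" using nn by auto
  have b0: "0 < b0" using B b nn unfolding B_def
    by (cases "b0 = 0") (auto simp: mult_nonneg_nonneg leD)
  define g where "g = (b1 * B - b0 * A) / B"
  have g: "0 \<le> g" using bBA B by (simp add: g_def)
  have gB: "g * B = b1 * B - b0 * A" using B by (simp add: g_def)
  have K': "b0 * bres (a0, a1, a2, b0, b1, b2) = b2 * B\<^sup>2 - A * (b1 * B - b0 * A)"
    by (simp add: A_def B_def algebra_simps power2_eq_square)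
  have "0 < b0 * bres (a0, a1, a2, b0, b1, b2)" using b0 K by simp
  then have *: "A * (b1 * B - b0 * A) < b2 * B\<^sup>2" unfolding K' by simp
  moreover have "0 \<le> A * (b1 * B - b0 * A)" using A bBA by simp
  ultimately have b2: "0 < b2" using b(4) by (cases "b2 = 0") auto
  have "A * g * B < b2 * B * B" using * by (simp add: mult.assoc gB power2_eq_square)
  then have AgB: "A * g < b2 * B" using B by simp
  define R1 R2 L1 k where "R1 = a0 / b0" and "R2 = A / (b0 * b2)" and "L1 = B / b0\<^sup>2"
    and "k = (b2 * B - A * g) / (b0 * b2)"
  have k: "0 < k" using AgB b0 b2 by (simp add: k_def)
  have val: "val (net6 R1 R2 (g / k) (b2 / k) L1) s = biq (a0, a1, a2, b0, b1, b2) s" if s: "s > 0" for s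
  proof -
    define h where "h = b2 * s + g"
    define e where "e = (A * s + B) / b0"
    have h: "0 < h" using g b2 s by (simp add: h_def add_pos_nonneg)
    have 1: "g / k + b2 / k * s = h / k" by (simp add: h_def add_divide_distrib)
    have 2: "R2 + 1 / (h / k) = e / h"
    proof -
      have "R2 + k / h = (R2 * h + k) / h" using h by (simp add: field_simps)
      also have "R2 * h + k = e"
        using b0 b2 by (simp add: R2_def h_def k_def e_def divide_simps) (simp add: algebra_simps)
      finally show ?thesis by simp
    qed
    have "rpar (rinv (Some (g / k))) (rinv (Some (b2 / k * s))) = Some (1 / (h / k))"
      using val_shunt[of "g / k" "b2 / k * s"] g k b2 s unfolding 1 by simp
    then have "val (net6 R1 R2 (g / k) (b2 / k) L1) s = radd (Some (a0 / b0)) (rpar (Some (B / b0\<^sup>2 * s)) (Some (e / h)))"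
      using 2 by (simp add: net6_def R1_def L1_def)
    then show ?thesis
      using biq_ladder[of b0 b1 b2 a2 a0 a1 g s] b b0 A B gB h s by (simp add: A_def B_def h_def e_def)
  qed
  show thesis
  proof (rule that[of R1 R2 "g / k" "b2 / k" L1])
    show "b1 * (a1 * b0 - a0 * b1) = b0 * (a2 * b0 - a0 * b2) \<longrightarrow> g / k = 0"
      unfolding A_def[symmetric] B_def[symmetric] by (simp add: g_def)
  qed (use val b b0 b2 A B g k in \<open>auto simp: R1_def R2_def L1_def\<close>)
qed

text \<open>If (a0, b0) is not zero, A = B = 0 makes numerator and denominator proportional to it,
  so the function is constant or infinite. If a0 = b0 = 0, a factor s cancels and the third minor
  decides whether the bilinear rest is of type RL or RC.\<close>

lemma biq_rank_one:
  assumes b: "0 \<le> a0" "0 \<le> a1" "0 \<le> a2" "0 \<le> b0" "0 \<le> b1" "0 \<le> b2"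
    and x: "(a0, a1, a2, b0, b1, b2) \<noteq> 0"
    and A: "a2 * b0 - a0 * b2 = 0" and B: "a1 * b0 - a0 * b1 = 0"
  shows "WL (biq (a0, a1, a2, b0, b1, b2)) \<or> a2 * b1 < a1 * b2 \<and> WC (biq (a0, a1, a2, b0, b1, b2))"
    (is "WL (biq ?x) \<or> _")
proof -
  consider (const) "b0 \<noteq> 0" | (shift) "b0 = 0" "a0 = 0" | (infinite) "b0 = 0" "a0 \<noteq> 0" by blast
  then show ?thesis
  proof cases
    case const
    then have b0: "b0 > 0" using b by simp
    then have e: "a1 = a0 / b0 * b1" "a2 = a0 / b0 * b2" "a0 = a0 / b0 * b0"
      using A B by (auto simp: field_simps)
    have "biq ?x s = Some (a0 / b0)" if s: "s > 0" for s
    proof -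
      have d: "0 < b0 + b1 * s + b2 * s\<^sup>2" using quadratic_pos[of b0 b1 b2 s] b b0 s by simp
      have "a0 + a1 * s + a2 * s\<^sup>2 = a0 / b0 * b0 + a0 / b0 * b1 * s + a0 / b0 * b2 * s\<^sup>2"
        using e by metis
      then have "a0 + a1 * s + a2 * s\<^sup>2 = a0 / b0 * (b0 + b1 * s + b2 * s\<^sup>2)"
        by (simp only: distrib_left mult.assoc)
      then show ?thesis using d by (simp add: ratio_def)
    qed
    then show ?thesis using b b0 by (intro disjI1 Res_WL Res_Some[of "a0 / b0"]) auto
  next
    case shift
    have e: "biq ?x s = ratio (a1 + a2 * s) (b1 + b2 * s)" if s: "s > 0" for s
    proof -
      have "biq ?x s = ratio (s * (a1 + a2 * s)) (s * (b1 + b2 * s))"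
        using shift by (simp add: algebra_simps power2_eq_square)
      then show ?thesis using s by (simp add: ratio_scale)
    qed
    have nz: "a1 \<noteq> 0 \<or> a2 \<noteq> 0 \<or> b1 \<noteq> 0 \<or> b2 \<noteq> 0"
      using x shift by (auto simp: zero_prod_def)
    show ?thesis
      using ratio_WL[OF b(2,3,5,6) nz _ e] ratio_WC[OF b(2,3,5,6) nz _ e]
      by (meson not_le less_imp_le)
  next
    case infinite
    then have "biq ?x s = None" for s using A B by auto
    then show ?thesis by (intro disjI1 Res_WL Res_None)
  qed
qed

text \<open>A vanishing resultant gives a common factor; the bilinear quotient that remains has
  determinant B > 0 and is therefore of type RL.\<close>

lemma biq_reducible:
  assumes b: "0 \<le> a0" "0 \<le> a1" "0 \<le> a2" "0 \<le> b0" "0 \<le> b1" "0 \<le> b2"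
    and A: "0 \<le> a2 * b0 - a0 * b2" and B: "0 < a1 * b0 - a0 * b1"
    and m: "b0 * (a2 * b0 - a0 * b2) \<le> b1 * (a1 * b0 - a0 * b1)"
    and K: "bres (a0, a1, a2, b0, b1, b2) = 0"
  shows "WL (biq (a0, a1, a2, b0, b1, b2))"
proof -
  define A B where "A = a2 * b0 - a0 * b2" and "B = a1 * b0 - a0 * b1"
  have A: "0 \<le> A" and red: "B > 0" "bres (a0, a1, a2, b0, b1, b2) = 0" and bBA: "b0 * A \<le> b1 * B"
    using assms by (auto simp: A_def B_def)
  have b0: "0 < b0" using red(1) b unfolding B_def
    by (cases "b0 = 0") (auto simp: mult_nonneg_nonneg leD)
  \<comment> \<open>The common factor is 1 + c s, and the quotient is (a0 + a' s) / (b0 + g s). Here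
    g is read off from b1 = g + b0 c, and a' is defined so that a' b0 - a0 g = B.\<close>
  define c g where "c = A / B" and "g = (b1 * B - b0 * A) / B"
  have c: "0 \<le> c" and g: "0 \<le> g" using A red bBA by (auto simp: c_def g_def)
  define a' where "a' = (a0 * g + B) / b0"
  have "b0 * bres (a0, a1, a2, b0, b1, b2) = b2 * B\<^sup>2 - A * (b1 * B - b0 * A)"
    by (simp add: A_def B_def algebra_simps power2_eq_square)
  then have K: "b2 * B\<^sup>2 = A * (b1 * B - b0 * A)" using red by simp
  have e1: "b1 = g + b0 * c" using red by (simp add: c_def g_def field_simps)
  have "A = c * B" "b1 * B - b0 * A = g * B" using red by (simp_all add: c_def g_def)
  with K have e2: "b2 = g * c" using red by (simp add: power2_eq_square)
  have e3: "a1 = a' + a0 * c"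
  proof -
    have "b0 * a1 = B + a0 * b1" by (simp add: B_def)
    also have "\<dots> = b0 * (a' + a0 * c)"
    proof -
      have "b0 * a' = a0 * g + B" using b0 by (simp add: a'_def)
      then show ?thesis by (simp add: e1 algebra_simps)
    qed
    finally show ?thesis using b0 by simp
  qed
  have e4: "a2 = a' * c"
  proof -
    have "b0 * a2 = A + a0 * b2" by (simp add: A_def)
    also have "\<dots> = b0 * (a' * c)"
    proof -
      have "b0 * a' = a0 * g + B" using b0 by (simp add: a'_def)
      then have "b0 * (a' * c) = (a0 * g + B) * c" by (simp add: mult.assoc[symmetric])
      then show ?thesis by (simp add: e2 \<open>A = c * B\<close> algebra_simps)
    qed
    finally show ?thesis using b0 by simp
  qed
  have a': "0 \<le> a'" using b b0 g red by (simp add: a'_def)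
  show "WL (biq (a0, a1, a2, b0, b1, b2))"
  proof (rule ratio_WL[OF b(1) a' b(4) g])
    show "a0 * g \<le> a' * b0" using b0 red by (simp add: a'_def)
    fix s :: real assume s: "s > 0"
    have "0 < 1 + c * s" using c s by (simp add: add_pos_nonneg)
    moreover have "biq (a0, a1, a2, b0, b1, b2) s = ratio ((1 + c * s) * (a0 + a' * s)) ((1 + c * s) * (b0 + g * s))"
      unfolding biq.simps by (simp add: e1 e2 e3 e4 algebra_simps power2_eq_square)
    ultimately show "biq (a0, a1, a2, b0, b1, b2) s = ratio (a0 + a' * s) (b0 + g * s)" by (simp add: ratio_scale)
  qed (use b0 in auto)
qed

text \<open>The parameters are positional: for \<open>net8\<close> and \<open>net9\<close> the first
  three stand for G1, G2, R3. The disjunction records that outside \<open>regular_int\<close> the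
  first or the third of them vanishes.\<close>

definition net_realizes :: "(real \<Rightarrow> real \<Rightarrow> real \<Rightarrow> real \<Rightarrow> real \<Rightarrow> network) \<Rightarrow> biquad \<Rightarrow> bool" where
  "net_realizes N x \<longleftrightarrow> (\<exists>R1 R2 G3 C1 L1. 0 \<le> R1 \<and> 0 \<le> R2 \<and> 0 \<le> G3 \<and> 0 < C1 \<and> 0 < L1 \<and>
     (regular_int x \<or> R1 = 0 \<or> G3 = 0) \<and> (\<forall>s>0. val (N R1 R2 G3 C1 L1) s = biq x s))"

lemma net_realizesI:
  assumes "0 \<le> R1" "0 \<le> R2" "0 \<le> G3" "0 < C1" "0 < L1" "regular_int x \<or> R1 = 0 \<or> G3 = 0"
    and "\<And>s. s > 0 \<Longrightarrow> val (N R1 R2 G3 C1 L1) s = biq x s"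
  shows "net_realizes N x"
  using assms unfolding net_realizes_def by blast

lemma net_realizesE:
  assumes "net_realizes N x"
  obtains R1 R2 G3 C1 L1 where "0 \<le> R1" "0 \<le> R2" "0 \<le> G3" "0 < C1" "0 < L1"
    "regular_int x \<or> R1 = 0 \<or> G3 = 0" "\<And>s. s > 0 \<Longrightarrow> val (N R1 R2 G3 C1 L1) s = biq x s"
  using assms unfolding net_realizes_def by blast

text \<open>B = 0 forces A = 0 and rank one; otherwise the resultant decides between a common factor
  and \<open>net6\<close>. In the last case \<open>net6_realizes\<close> makes R1 vanish for a0 = 0,
  and G3 for equality in the last inequality of \<open>min_at_0\<close>. If neither occurs, all
  coefficients are positive and \<open>x\<close> lies in \<open>regular_int\<close>.\<close>

lemma min_at_0_cases:
  assumes nn: "nonneg x" and x: "x \<noteq> 0" and m: "min_at_0 x" and K: "0 \<le> bres x"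
  shows "WL (biq x) \<or> WC (biq x) \<or> net_realizes net6 x"
proof (cases x)
  case (fields a0 a1 a2 b0 b1 b2)
  define A B where "A = a2 * b0 - a0 * b2" and "B = a1 * b0 - a0 * b1"
  have A: "0 \<le> A" and B: "0 \<le> B" and bBA: "b0 * A \<le> b1 * B"
    using m fields by (auto simp: A_def B_def)
  have b: "0 \<le> a0" "0 \<le> a1" "0 \<le> a2" "0 \<le> b0" "0 \<le> b1" "0 \<le> b2" using nn fields by auto
  consider (low) "B = 0" | (red) "B > 0" "bres x = 0" | (full) "B > 0" "bres x > 0"
    using B K by linarith
  then show ?thesis
  proof cases
    case low
    have "A = 0"
    proof (cases "b0 = 0")
      case True
      then show ?thesis using A mult_nonneg_nonneg[OF b(1,6)] by (simp add: A_def)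
    next
      case False
      then show ?thesis using low bBA A b by (auto simp: mult_le_0_iff)
    qed
    then show ?thesis using biq_rank_one[OF b] x low unfolding fields by (auto simp: A_def B_def)
  next
    case red
    then show ?thesis using biq_reducible[OF b] A bBA unfolding fields by (simp add: A_def B_def)
  next
    case full
    obtain R1 R2 G3 C1 L1 where N: "0 \<le> R1" "0 \<le> R2" "0 \<le> G3" "0 < C1" "0 < L1"
      "a0 = 0 \<longrightarrow> R1 = 0" "b1 * B = b0 * A \<longrightarrow> G3 = 0"
      "\<And>s. s > 0 \<Longrightarrow> val (net6 R1 R2 G3 C1 L1) s = biq x s" "0 < b0" "0 < b2"
      using net6_realizes[of a0 a1 a2 b0 b1 b2] nn m full unfolding fields B_def[symmetric] A_def[symmetric] by blast
    have "regular_int x \<or> R1 = 0 \<or> G3 = 0"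
    proof (cases "a0 = 0 \<or> b1 * B = b0 * A")
      case True
      then show ?thesis using N by auto
    next
      case False
      then have a0: "0 < a0" and lt: "b0 * A < b1 * B" using b bBA by auto
      have "0 \<le> b0 * A" using N A by simp
      then have b1: "0 < b1" using lt b full by (cases "b1 = 0") auto
      have "a0 * b1 < a1 * b0" "a0 * b2 \<le> a2 * b0" using full A by (auto simp: A_def B_def)
      moreover have "0 < a0 * b1" "0 < a0 * b2" using a0 b1 N by auto
      ultimately have "0 < a1 * b0" "0 < a2 * b0" by linarith+
      then have "0 < a1" "0 < a2" using N by (auto simp: zero_less_mult_iff)
      then have "coeffs_pos x" using a0 b1 N fields by simp
      moreover have "strict_min_at_0 x" using lt A fields by (simp add: A_def B_def)
      ultimately show ?thesis using full by (simp add: regular_int_def)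
    qed
    from net_realizesI[of R1 R2 G3 C1 L1 x net6, OF N(1-5) this N(8)] show ?thesis by blast
  qed
qed

lemma sp_net6 [simp]: "0 \<le> R1 \<Longrightarrow> 0 \<le> R2 \<Longrightarrow> 0 \<le> G3 \<Longrightarrow> 0 < C1 \<Longrightarrow> 0 < L1 \<Longrightarrow> sp_network (net6 R1 R2 G3 C1 L1)"
  by (simp add: net6_def)

lemma trans_net6:
  "trans_i (net6 R1 R2 G3 C1 L1) = net7 R1 R2 G3 (1 / L1) (1 / C1)"
  "trans_d (net6 R1 R2 G3 C1 L1) = net8 R1 R2 G3 L1 C1"
  "trans_p (net6 R1 R2 G3 C1 L1) = net9 R1 R2 G3 (1 / C1) (1 / L1)"
  by (simp_all add: net6_def net7_def net8_def net9_def trans_p_def)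

lemma net_realizes_trans:
  assumes "nonneg x" "x \<noteq> 0"
  shows "net_realizes net6 (bflip x) \<Longrightarrow> net_realizes net7 x"
    and "net_realizes net6 (bswap x) \<Longrightarrow> net_realizes net8 x"
    and "net_realizes net6 (bflip (bswap x)) \<Longrightarrow> net_realizes net9 x"
proof -
  have f: "biq (bflip y) (1 / s) = biq y s" if "s > 0" for s y
    using that biq_flip[of "1 / s" y] by simp
  have r: "rinv (biq (bswap x) s) = biq x s" if "s > 0" for s
    using that rinv_biq[of "bswap x" s] assms by simp
  show "net_realizes net7 x" if "net_realizes net6 (bflip x)"
    using that
  proof (rule net_realizesE)
    fix R1 R2 G3 C1 L1 assume N: "0 \<le> R1" "0 \<le> R2" "0 \<le> G3" "0 < C1" "0 < L1" "regular_int (bflip x) \<or> R1 = 0 \<or> G3 = 0"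
      "\<And>s. s > 0 \<Longrightarrow> val (net6 R1 R2 G3 C1 L1) s = biq (bflip x) s"
    have "val (net7 R1 R2 G3 (1 / L1) (1 / C1)) s = biq x s" if s: "s > 0" for s
      using val_trans_i[of "net6 R1 R2 G3 C1 L1" s] s N by (simp add: f trans_net6)
    then show ?thesis using N by (intro net_realizesI[of R1 R2 G3 "1 / L1" "1 / C1"]) simp_all
  qed
  show "net_realizes net8 x" if "net_realizes net6 (bswap x)"
    using that
  proof (rule net_realizesE)
    fix R1 R2 G3 C1 L1 assume N: "0 \<le> R1" "0 \<le> R2" "0 \<le> G3" "0 < C1" "0 < L1" "regular_int (bswap x) \<or> R1 = 0 \<or> G3 = 0"
      "\<And>s. s > 0 \<Longrightarrow> val (net6 R1 R2 G3 C1 L1) s = biq (bswap x) s"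
    have "val (net8 R1 R2 G3 L1 C1) s = biq x s" if s: "s > 0" for s
      using val_trans_d[of "net6 R1 R2 G3 C1 L1" s] s N by (simp add: r trans_net6)
    then show ?thesis using N by (intro net_realizesI[of R1 R2 G3 L1 C1]) simp_all
  qed
  show "net_realizes net9 x" if "net_realizes net6 (bflip (bswap x))"
    using that
  proof (rule net_realizesE)
    fix R1 R2 G3 C1 L1 assume N: "0 \<le> R1" "0 \<le> R2" "0 \<le> G3" "0 < C1" "0 < L1" "regular_int (bflip (bswap x)) \<or> R1 = 0 \<or> G3 = 0"
      "\<And>s. s > 0 \<Longrightarrow> val (net6 R1 R2 G3 C1 L1) s = biq (bflip (bswap x)) s"
    have "val (net9 R1 R2 G3 (1 / C1) (1 / L1)) s = biq x s" if s: "s > 0" for s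
      using val_trans_p[of "net6 R1 R2 G3 C1 L1" s] s N by (simp add: f r trans_net6)
    then show ?thesis using N by (intro net_realizesI[of R1 R2 G3 "1 / C1" "1 / L1"]) simp_all
  qed
qed

text \<open>The four orientations of \<open>min_at_0\<close> correspond to the four networks, which
  are the images of \<open>net6\<close> under the transformations; see
  \<open>trans_net6\<close>.\<close>

lemma regular_cases:
  assumes "regular x" "x \<noteq> 0"
  obtains (WL) "WL (biq x)" | (WC) "WC (biq x)"
    | (net) N R1 R2 G3 C1 L1 where "N \<in> {net6, net7, net8, net9}"
      "0 \<le> R1" "0 \<le> R2" "0 \<le> G3" "0 < C1" "0 < L1" "regular_int x \<or> R1 = 0 \<or> G3 = 0"
      "\<And>s. s > 0 \<Longrightarrow> val (N R1 R2 G3 C1 L1) s = biq x s"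
proof -
  have nn: "nonneg x" and K: "0 \<le> bres x" using assms by (auto simp: regular_def)
  have f: "biq x s = biq (bflip x) (1 / s)" if "s > 0" for s
    using that biq_flip[of "1 / s" x] by simp
  have r: "biq x s = rinv (biq (bswap x) s)" if "s > 0" for s
    using that rinv_biq[of "bswap x" s] nn assms(2) by simp
  have p: "biq x s = pd (biq (bflip (bswap x))) s" if "s > 0" for s
    using that biq_flip[of "1 / s" "bswap x"] r by (simp add: pd_def)
  have "WL (biq x) \<or> WC (biq x) \<or> (\<exists>N\<in>{net6, net7, net8, net9}. net_realizes N x)"
  proof -
    consider "min_at_0 x" | "min_at_0 (bflip x)" | "min_at_0 (bswap x)" | "min_at_0 (bflip (bswap x))"
      using assms by (auto simp: regular_def)
    then show ?thesis
    proof cases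
      case 1
      show ?thesis using min_at_0_cases[OF nn assms(2) 1 K] by blast
    next
      case 2
      have "WL (biq (bflip x)) \<or> WC (biq (bflip x)) \<or> net_realizes net6 (bflip x)"
        using 2 nn K assms(2) by (intro min_at_0_cases) simp_all
      then show ?thesis
        using WL_cong[OF WC_flip, of _ "biq x"] WC_cong[OF WL_flip, of _ "biq x"] f
          net_realizes_trans(1)[OF nn assms(2)] by blast
    next
      case 3
      have "WL (biq (bswap x)) \<or> WC (biq (bswap x)) \<or> net_realizes net6 (bswap x)"
        using 3 nn K assms(2) by (intro min_at_0_cases) simp_all
      then show ?thesis
        using WL_cong[OF WC_rinv, of _ "biq x"] WC_cong[OF WL_rinv, of _ "biq x"] r
          net_realizes_trans(2)[OF nn assms(2)] by blast
    next
      case 4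
      have "WL (biq (bflip (bswap x))) \<or> WC (biq (bflip (bswap x))) \<or> net_realizes net6 (bflip (bswap x))"
        using 4 nn K assms(2) by (intro min_at_0_cases) simp_all
      then show ?thesis
        using WL_cong[OF WL_pd, of _ "biq x"] WC_cong[OF WC_pd, of _ "biq x"] p
          net_realizes_trans(3)[OF nn assms(2)] by blast
    qed
  qed
  then show thesis using WL WC net net_realizesE by metis
qed

text \<open>The ladder steps are those of \<open>net6\<close>, but a negative resultant makes the
  bilinear remainder increasing. So its value R2 = B / (b0 g) at 0, instead of that at infinity, is
  removed, and k s / (b2 s + g) is a conductance in parallel with an inductor.\<close>

lemma net5_realizes:
  assumes nn: "nonneg (a0, a1, a2, b0, b1, b2)"
    and pos: "0 \<le> a2 * b0 - a0 * b2" "0 \<le> a1 * b0 - a0 * b1" "0 \<le> a2 * b1 - a1 * b2"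
    and K: "bres (a0, a1, a2, b0, b1, b2) < 0"
  obtains R1 R2 G3 L1 L2 where "0 \<le> R1" "0 < R2" "0 \<le> G3" "0 < L1" "0 < L2"
    "a0 = 0 \<longrightarrow> R1 = 0" "b2 = 0 \<longrightarrow> G3 = 0"
    "\<And>s. s > 0 \<Longrightarrow> val (net5 R1 R2 G3 L1 L2) s = biq (a0, a1, a2, b0, b1, b2) s"
    "0 < a2 * b0 - a0 * b2" "0 < a1 * b0 - a0 * b1" "0 < a2 * b1 - a1 * b2"
proof -
  define A B D where "A = a2 * b0 - a0 * b2" and "B = a1 * b0 - a0 * b1" and "D = a2 * b1 - a1 * b2"
  have b: "0 \<le> a0" "0 \<le> a1" "0 \<le> a2" "0 \<le> b0" "0 \<le> b1" "0 \<le> b2" using nn by auto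
  have K2: "A\<^sup>2 < B * D" using K by (simp add: A_def B_def D_def)
  then have "0 < B * D" using zero_le_power2[of A] by linarith
  then have B: "0 < B" and D: "0 < D" using pos(2,3) by (auto simp: B_def[symmetric] D_def[symmetric] zero_less_mult_iff)
  have b0: "0 < b0" using B b unfolding B_def
    by (cases "b0 = 0") (auto simp: mult_nonneg_nonneg leD)
  have K': "b0 * bres (a0, a1, a2, b0, b1, b2) = b2 * B\<^sup>2 - A * (b1 * B - b0 * A)"
    by (simp add: A_def B_def algebra_simps power2_eq_square)
  have "b0 * bres (a0, a1, a2, b0, b1, b2) < 0" using b0 K by (simp add: mult_pos_neg)
  then have *: "b2 * B\<^sup>2 < A * (b1 * B - b0 * A)" unfolding K' by simp
  moreover have "0 \<le> b2 * B\<^sup>2" using b by simp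
  ultimately have "0 < A * (b1 * B - b0 * A)" by linarith
  then have A: "0 < A" and bBA: "0 < b1 * B - b0 * A"
    using pos(1) by (auto simp: A_def[symmetric] zero_less_mult_iff)
  define g where "g = (b1 * B - b0 * A) / B"
  have g: "0 < g" using bBA B by (simp add: g_def)
  have gB: "g * B = b1 * B - b0 * A" using B by (simp add: g_def)
  have "b2 * B * B < A * g * B" using * by (simp add: mult.assoc gB power2_eq_square)
  then have AgB: "b2 * B < A * g" using B by simp
  define R1 R2 L2 k where "R1 = a0 / b0" and "R2 = B / (b0 * g)" and "L2 = B / b0\<^sup>2"
    and "k = (A * g - b2 * B) / (b0 * g)"
  have k: "0 < k" using AgB b0 g by (simp add: k_def)
  have val: "val (net5 R1 R2 (b2 / k) (k / g) L2) s = biq (a0, a1, a2, b0, b1, b2) s" if s: "s > 0" for s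
  proof -
    define h where "h = b2 * s + g"
    define e where "e = (A * s + B) / b0"
    have h: "0 < h" using g b s by (simp add: h_def add_nonneg_pos)
    have 1: "b2 / k + g / (k * s) = h / (k * s)" using s k by (simp add: h_def field_simps)
    have 2: "R2 + k * s / h = e / h"
    proof -
      have "R2 + k * s / h = (R2 * h + k * s) / h" using h by (simp add: field_simps)
      also have "R2 * h + k * s = e"
        using b0 g by (simp add: R2_def h_def k_def e_def divide_simps) (simp add: algebra_simps)
      finally show ?thesis by simp
    qed
    have "rpar (rinv (Some (b2 / k))) (Some (k / g * s)) = Some (k * s / h)"
    proof -
      have p: "0 < g / (k * s)" using g k s by simp
      have "rinv (Some (g / (k * s))) = Some (k / g * s)" using p g k s by (simp add: rinv_def)
      then have "rpar (rinv (Some (b2 / k))) (Some (k / g * s)) = Some (1 / (b2 / k + g / (k * s)))"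
        using val_shunt[OF _ p, of "b2 / k"] b k by simp
      then show ?thesis unfolding 1 by simp
    qed
    then have "val (net5 R1 R2 (b2 / k) (k / g) L2) s = radd (Some (a0 / b0)) (rpar (Some (B / b0\<^sup>2 * s)) (Some (e / h)))"
      using 2 by (simp add: net5_def R1_def L2_def)
    then show ?thesis
      using biq_ladder[of b0 b1 b2 a2 a0 a1 g s] b b0 A B gB h s by (simp add: A_def B_def h_def e_def)
  qed
  show thesis
    by (rule that[of R1 R2 "b2 / k" "k / g" L2])
      (use val b b0 A B D g k in \<open>auto simp: R1_def R2_def L2_def A_def B_def D_def\<close>)
qed

text \<open>The boundary with vanishing resultant is bilinear: for B > 0 by a common factor, and for
  B = 0, hence A = 0, by rank one, where D >= 0 excludes type RC.\<close>

lemma rl_cases: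
  assumes "rl x" "x \<noteq> 0"
  obtains (WL) "WL (biq x)" | (net) R1 R2 G3 L1 L2 where
    "0 \<le> R1" "0 < R2" "0 \<le> G3" "0 < L1" "0 < L2" "rl_int x \<or> R1 = 0 \<or> G3 = 0"
    "\<And>s. s > 0 \<Longrightarrow> val (net5 R1 R2 G3 L1 L2) s = biq x s"
proof (cases x)
  case (fields a0 a1 a2 b0 b1 b2)
  define A B D where "A = a2 * b0 - a0 * b2" and "B = a1 * b0 - a0 * b1" and "D = a2 * b1 - a1 * b2"
  have b: "0 \<le> a0" "0 \<le> a1" "0 \<le> a2" "0 \<le> b0" "0 \<le> b1" "0 \<le> b2" and nn: "nonneg x"
    and p: "0 \<le> A" "0 \<le> B" "0 \<le> D"
    using assms fields by (auto simp: A_def B_def D_def)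
  have bD: "b0 * D = b1 * A - b2 * B"
    by (simp add: A_def B_def D_def algebra_simps)
  show thesis
  proof (cases "bres x < 0")
    case True
    obtain R1 R2 G3 L1 L2 where N: "0 \<le> R1" "0 < R2" "0 \<le> G3" "0 < L1" "0 < L2"
      "a0 = 0 \<longrightarrow> R1 = 0" "b2 = 0 \<longrightarrow> G3 = 0"
      "\<And>s. s > 0 \<Longrightarrow> val (net5 R1 R2 G3 L1 L2) s = biq x s" "0 < A" "0 < B" "0 < D"
      using net5_realizes[of a0 a1 a2 b0 b1 b2] nn p True
      unfolding fields B_def[symmetric] A_def[symmetric] D_def[symmetric] by blast
    have "rl_int x \<or> R1 = 0 \<or> G3 = 0"
    proof (cases "a0 = 0 \<or> b2 = 0")
      case True then show ?thesis using N by auto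
    next
      case False
      then have "0 < a0" "0 < b2" using b by auto
      moreover have "0 < a1 * b0" "0 < a2 * b1" "0 < a2 * b0"
        using N(9-11) mult_nonneg_nonneg[OF b(1,5)] mult_nonneg_nonneg[OF b(2,6)] mult_nonneg_nonneg[OF b(1,6)]
        unfolding A_def B_def D_def by linarith+
      ultimately have "coeffs_pos x" using b unfolding fields by (auto simp: zero_less_mult_iff)
      then show ?thesis using N(9-11) True unfolding fields by (auto simp: A_def B_def D_def)
    qed
    then show thesis using N by (intro net)
  next
    case False
    then have K: "A\<^sup>2 = B * D" using assms unfolding fields by (simp add: A_def B_def D_def)
    show thesis
    proof (cases "B > 0")
      case True
      note 1 = this
      have "A * (b1 * B - b0 * A) = b2 * B\<^sup>2"
      proof -
        have "A * (b1 * B - b0 * A) = B * (b1 * A) - b0 * A\<^sup>2" by (simp add: algebra_simps power2_eq_square)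
        also have "\<dots> = B * (b1 * A) - B * (b0 * D)" by (simp add: K)
        also have "\<dots> = b2 * B\<^sup>2" unfolding bD by (simp add: algebra_simps power2_eq_square)
        finally show ?thesis .
      qed
      then have AB: "0 \<le> A * (b1 * B - b0 * A)" using b by simp
      have "b0 * A \<le> b1 * B"
      proof (cases "A = 0")
        case True then show ?thesis using b p by simp
      next
        case False
        then show ?thesis using AB p by (simp add: zero_le_mult_iff)
      qed
      moreover have "bres x = 0" using K unfolding fields by (simp add: A_def B_def D_def)
      ultimately have "WL (biq x)"
        using biq_reducible[OF b] p 1 unfolding fields by (simp add: A_def B_def)
      then show thesis by (rule WL)
    next
      case False
      then have "B = 0" using p by simp
      then have "A = 0" using K by simp
      have "WL (biq x)"
        using biq_rank_one[OF b] assms(2) p(3) \<open>A = 0\<close> \<open>B = 0\<close> unfolding fields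
        by (auto simp: A_def B_def D_def)
      then show thesis by (rule WL)
    qed
  qed
qed

section \<open>Extremal realizations\<close>

definition num :: "biquad \<Rightarrow> real \<Rightarrow> real" where
  "num x s = fst x + fst (snd x) * s + fst (snd (snd x)) * s\<^sup>2"

definition den :: "biquad \<Rightarrow> real \<Rightarrow> real" where
  "den x s = fst (snd (snd (snd x))) + fst (snd (snd (snd (snd x)))) * s + snd (snd (snd (snd (snd x)))) * s\<^sup>2"

lemma num_den_simps [simp]:
  "num (a0, a1, a2, b0, b1, b2) s = a0 + a1 * s + a2 * s\<^sup>2"
  "den (a0, a1, a2, b0, b1, b2) s = b0 + b1 * s + b2 * s\<^sup>2"
  by (simp_all add: num_def den_def)

lemma biq_num_den: "biq x s = ratio (num x s) (den x s)"
  by (cases x) simp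

lemma num_den_scaleR [simp]: "num (k *\<^sub>R x) s = k * num x s" "den (k *\<^sub>R x) s = k * den x s"
  by (simp_all add: num_def den_def algebra_simps)

lemma num_den_nonneg: "nonneg x \<Longrightarrow> 0 < s \<Longrightarrow> 0 \<le> num x s" "nonneg x \<Longrightarrow> 0 < s \<Longrightarrow> 0 \<le> den x s"
  by (cases x; simp)+

lemma num_den_pos: "coeffs_pos x \<Longrightarrow> 0 < s \<Longrightarrow> 0 < num x s" "coeffs_pos x \<Longrightarrow> 0 < s \<Longrightarrow> 0 < den x s"
  by (cases x; simp add: add_pos_pos)+

definition cubic :: "(nat \<Rightarrow> real) \<Rightarrow> real \<Rightarrow> real" where
  "cubic p s = p 0 + p 1 * s + p 2 * s\<^sup>2 + p 3 * s ^ 3"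

text \<open>
  With \<open>r = p(t) / q(t)\<close> the polynomial \<open>p - r q\<close> vanishes at \<open>t\<close>; a partial fraction expansion of
  \<open>q / (p - r q)\<close> at this zero gives \<open>p / q = r + ((s - t) / c \<parallel> a / b)\<close>.
\<close>

definition split_r :: "(nat \<Rightarrow> real) \<Rightarrow> (nat \<Rightarrow> real) \<Rightarrow> real \<Rightarrow> real" where
  "split_r p q t = cubic p t / cubic q t"

text \<open>Horner's scheme for the quotient of p - r q by s - t; \<open>split_den\<close> divides q
  - c n in the same way, with n this quotient. Explicit coefficients make the splitting visibly
  continuous in p, q and t.\<close>

definition split_num :: "(nat \<Rightarrow> real) \<Rightarrow> (nat \<Rightarrow> real) \<Rightarrow> real \<Rightarrow> nat \<Rightarrow> real" where
  "split_num p q t k = (let m = (\<lambda>i. p i - split_r p q t * q i) in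
     if k = 2 then m 3 else if k = 1 then m 2 + t * m 3 else m 1 + t * (m 2 + t * m 3))"

definition split_c :: "(nat \<Rightarrow> real) \<Rightarrow> (nat \<Rightarrow> real) \<Rightarrow> real \<Rightarrow> real" where
  "split_c p q t = cubic q t / (split_num p q t 0 + split_num p q t 1 * t + split_num p q t 2 * t\<^sup>2)"

definition split_den :: "(nat \<Rightarrow> real) \<Rightarrow> (nat \<Rightarrow> real) \<Rightarrow> real \<Rightarrow> nat \<Rightarrow> real" where
  "split_den p q t k = (let m = (\<lambda>i. q i - split_c p q t * split_num p q t i) in
     if k = 2 then q 3 else if k = 1 then m 2 + t * q 3 else m 1 + t * (m 2 + t * q 3))"

definition split_x :: "(nat \<Rightarrow> real) \<Rightarrow> (nat \<Rightarrow> real) \<Rightarrow> real \<Rightarrow> biquad" where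
  "split_x p q t = (split_num p q t 0, split_num p q t 1, split_num p q t 2,
     split_den p q t 0, split_den p q t 1, split_den p q t 2)"

lemma split_cubic:
  assumes "cubic q t \<noteq> 0"
  shows "cubic p s - split_r p q t * cubic q s = (s - t) * num (split_x p q t) s"
    and "num (split_x p q t) t \<noteq> 0 \<Longrightarrow>
      cubic q s = split_c p q t * num (split_x p q t) s + (s - t) * den (split_x p q t) s"
proof -
  define m where "m i = p i - split_r p q t * q i" for i
  have "split_r p q t * cubic q t = cubic p t" using assms by (simp add: split_r_def)
  then have "m 0 + m 1 * t + m 2 * t\<^sup>2 + m 3 * t ^ 3 = 0"
    by (simp add: m_def cubic_def algebra_simps)
  then have m0: "m 0 = - (m 1 * t + m 2 * t\<^sup>2 + m 3 * t ^ 3)" by linarith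
  have "cubic p s - split_r p q t * cubic q s = m 0 + m 1 * s + m 2 * s\<^sup>2 + m 3 * s ^ 3"
    by (simp add: m_def cubic_def algebra_simps)
  also have "\<dots> = (s - t) * num (split_x p q t) s"
  proof -
    have "num (split_x p q t) s = m 1 + t * (m 2 + t * m 3) + (m 2 + t * m 3) * s + m 3 * s\<^sup>2"
      by (simp add: split_x_def split_num_def m_def)
    then show ?thesis unfolding m0 by (simp add: algebra_simps power2_eq_square power3_eq_cube)
  qed
  finally show "cubic p s - split_r p q t * cubic q s = (s - t) * num (split_x p q t) s" .
next
  assume nz: "num (split_x p q t) t \<noteq> 0"
  define n where "n i = q i - split_c p q t * split_num p q t i" for i
  have "split_c p q t * num (split_x p q t) t = cubic q t"
    using nz by (simp add: split_c_def split_x_def)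
  then have n0: "n 0 = - (n 1 * t + n 2 * t\<^sup>2 + q 3 * t ^ 3)"
    by (simp add: n_def split_x_def cubic_def algebra_simps)
  have "cubic q s - split_c p q t * num (split_x p q t) s = n 0 + n 1 * s + n 2 * s\<^sup>2 + q 3 * s ^ 3"
    by (simp add: n_def cubic_def split_x_def algebra_simps)
  also have "\<dots> = (s - t) * den (split_x p q t) s"
  proof -
    have "den (split_x p q t) s = n 1 + t * (n 2 + t * q 3) + (n 2 + t * q 3) * s + q 3 * s\<^sup>2"
      by (simp add: split_x_def split_den_def n_def)
    then show ?thesis unfolding n0 by (simp add: algebra_simps power2_eq_square power3_eq_cube)
  qed
  finally show "cubic q s = split_c p q t * num (split_x p q t) s + (s - t) * den (split_x p q t) s"
    by linarith
qed

text \<open>Continuity jointly in the coefficients and the splitting point: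
  \<open>realizes_perturb\<close> moves the point, \<open>box_inductor\<close> moves the
  coefficients.\<close>

lemma split_tendsto:
  assumes P: "\<And>k. ((\<lambda>n. P n k) \<longlongrightarrow> p k) F" and Q: "\<And>k. ((\<lambda>n. Q n k) \<longlongrightarrow> q k) F" and T: "(T \<longlongrightarrow> t) F"
    and nz: "cubic q t \<noteq> 0"
  shows "((\<lambda>n. split_r (P n) (Q n) (T n)) \<longlongrightarrow> split_r p q t) F"
    and "num (split_x p q t) t \<noteq> 0 \<Longrightarrow> ((\<lambda>n. split_c (P n) (Q n) (T n)) \<longlongrightarrow> split_c p q t) F"
    and "num (split_x p q t) t \<noteq> 0 \<Longrightarrow> ((\<lambda>n. split_x (P n) (Q n) (T n)) \<longlongrightarrow> split_x p q t) F"
proof -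
  have cub: "((\<lambda>n. cubic (P n) (T n)) \<longlongrightarrow> cubic p t) F" "((\<lambda>n. cubic (Q n) (T n)) \<longlongrightarrow> cubic q t) F"
    unfolding cubic_def by (intro tendsto_intros P Q T)+
  show r: "((\<lambda>n. split_r (P n) (Q n) (T n)) \<longlongrightarrow> split_r p q t) F"
    unfolding split_r_def by (intro tendsto_intros cub nz)
  have num: "((\<lambda>n. split_num (P n) (Q n) (T n) k) \<longlongrightarrow> split_num p q t k) F" for k
    unfolding split_num_def Let_def by (auto intro!: tendsto_intros P Q T r)
  assume "num (split_x p q t) t \<noteq> 0"
  then have nz': "split_num p q t 0 + split_num p q t 1 * t + split_num p q t 2 * t\<^sup>2 \<noteq> 0"
    by (simp add: split_x_def)
  show c: "((\<lambda>n. split_c (P n) (Q n) (T n)) \<longlongrightarrow> split_c p q t) F"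
    unfolding split_c_def by (intro tendsto_intros cub num T nz')
  have "((\<lambda>n. split_den (P n) (Q n) (T n) k) \<longlongrightarrow> split_den p q t k) F" for k
    unfolding split_den_def Let_def by (auto intro!: tendsto_intros P Q T c num)
  then show "((\<lambda>n. split_x (P n) (Q n) (T n)) \<longlongrightarrow> split_x p q t) F"
    unfolding split_x_def by (intro tendsto_intros num)
qed

text \<open>The equation \<open>z = r + ((e0 + e1 s) / f \<parallel> x)\<close>, cross-multiplied because closedness is needed.\<close>

definition realizes :: "biquad set \<Rightarrow> (real \<Rightarrow> real) \<Rightarrow> real \<Rightarrow> real \<Rightarrow> real \<Rightarrow> real \<Rightarrow> biquad \<Rightarrow> bool" where
  "realizes T z r e0 e1 f x \<longleftrightarrow> 0 \<le> r \<and> 0 \<le> e0 \<and> 0 \<le> e1 \<and> 0 \<le> f \<and> x \<in> T \<and>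
     (\<forall>s>0. 0 < f * num x s + den x s * (e0 + e1 * s) \<and>
        (z s - r) * (f * num x s + den x s * (e0 + e1 * s)) = num x s * (e0 + e1 * s))"

text \<open>z - r is the impedance of a parallel connection, hence nonnegative and at most that of
  either branch.\<close>

lemma realizes_bounds:
  assumes T: "\<And>x. x \<in> T \<Longrightarrow> nonneg x" and R: "realizes T z r e0 e1 f x" and s: "s > 0"
  shows "r \<le> z s" "f * (z s - r) \<le> e0 + e1 * s" "den x s * (z s - r) \<le> num x s"
proof -
  define n d e D where "n = num x s" and "d = den x s" and "e = e0 + e1 * s" and "D = f * n + d * e"
  have nn: "0 \<le> n" "0 \<le> d" "0 \<le> e" "0 \<le> f" and D: "0 < D" and eq: "(z s - r) * D = n * e"
    using R s num_den_nonneg[OF T, of x s] unfolding realizes_def n_def d_def e_def D_def by auto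
  have "0 \<le> (z s - r) * D" using eq nn by simp
  then show "r \<le> z s" using D by (simp add: zero_le_mult_iff)
  have "f * (z s - r) * D = f * n * e" using eq by (simp add: mult.assoc)
  also have "\<dots> \<le> D * e" using nn by (intro mult_right_mono) (auto simp: D_def)
  finally show "f * (z s - r) \<le> e0 + e1 * s" using D by (simp add: e_def mult.commute)
  have "d * (z s - r) * D = d * e * n" using eq by (simp add: mult_ac)
  also have "\<dots> \<le> D * n" using nn by (intro mult_right_mono) (auto simp: D_def)
  finally show "den x s * (z s - r) \<le> num x s" using D by (simp add: d_def n_def mult.commute)
qed

lemma realizes_scale:
  assumes "realizes T z r e0 e1 f x" "k > 0" "j > 0" "\<And>x. x \<in> T \<Longrightarrow> j *\<^sub>R x \<in> T"
  shows "realizes T z r (k * e0) (k * e1) (k * f) (j *\<^sub>R x)"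
proof -
  have e: "k * f * num (j *\<^sub>R x) s + den (j *\<^sub>R x) s * (k * e0 + k * e1 * s) = k * j * (f * num x s + den x s * (e0 + e1 * s))"
    "num (j *\<^sub>R x) s * (k * e0 + k * e1 * s) = k * j * (num x s * (e0 + e1 * s))" for s
    by (simp_all add: algebra_simps)
  have "(z s - r) * (k * j * w) = k * j * y" if "(z s - r) * w = y" for s w y
    using that by (simp add: mult_ac)
  then show ?thesis
    using assms unfolding realizes_def e by simp
qed

section \<open>Compactness and the existence of a maximal series resistance\<close>

definition coeff_sum :: "biquad \<Rightarrow> real" where
  "coeff_sum x = num x 1 + den x 1"

lemma coeff_sum_pos: "nonneg x \<Longrightarrow> x \<noteq> 0 \<Longrightarrow> 0 < coeff_sum x"
  by (cases x) (auto simp: coeff_sum_def zero_prod_def)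

lemma coeff_sum_scaleR: "coeff_sum (k *\<^sub>R x) = k * coeff_sum x"
  by (simp add: coeff_sum_def algebra_simps)

lemma continuous_num_den [continuous_intros]:
  assumes "continuous_on A g"
  shows "continuous_on A (\<lambda>p. num (g p) s)" "continuous_on A (\<lambda>p. den (g p) s)"
  unfolding num_def den_def by (intro continuous_intros assms)+

text \<open>
  The two inequalities follow from the equation unless both branches are short circuits. Imposed
  separately, they exclude this degeneration in limits, since \<open>z\<close> is not constant.
\<close>

definition normalized_realizations :: "biquad set \<Rightarrow> (real \<Rightarrow> real) \<Rightarrow> (real \<times> real \<times> real \<times> real \<times> biquad) set" where
  "normalized_realizations T z = {(r, e0, e1, f, x). 0 \<le> r \<and> 0 \<le> e0 \<and> 0 \<le> e1 \<and> 0 \<le> f \<and> e0 + e1 + f = 1 \<and>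
     x \<in> T \<and> coeff_sum x = 1 \<and>
     (\<forall>s\<in>{0<..}. r \<le> z s \<and> f * (z s - r) \<le> e0 + e1 * s \<and> den x s * (z s - r) \<le> num x s \<and>
        (z s - r) * (f * num x s + den x s * (e0 + e1 * s)) = num x s * (e0 + e1 * s))}"

text \<open>The defining conditions are closed; r is bounded by z 1, and the remaining parameters
  are nonnegative with prescribed sums.\<close>

lemma compact_normalized_realizations:
  assumes cl: "closed T" and T: "\<And>x. x \<in> T \<Longrightarrow> nonneg x"
  shows "compact (normalized_realizations T z)"
proof -
  let ?r = "\<lambda>p :: real \<times> real \<times> real \<times> real \<times> biquad. fst p"
  let ?e0 = "\<lambda>p :: real \<times> real \<times> real \<times> real \<times> biquad. fst (snd p)"
  let ?e1 = "\<lambda>p :: real \<times> real \<times> real \<times> real \<times> biquad. fst (snd (snd p))"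
  let ?f = "\<lambda>p :: real \<times> real \<times> real \<times> real \<times> biquad. fst (snd (snd (snd p)))"
  let ?x = "\<lambda>p :: real \<times> real \<times> real \<times> real \<times> biquad. snd (snd (snd (snd p)))"
  let ?A = "{p. 0 \<le> ?r p} \<inter> {p. 0 \<le> ?e0 p} \<inter> {p. 0 \<le> ?e1 p} \<inter> {p. 0 \<le> ?f p}
      \<inter> {p. ?e0 p + ?e1 p + ?f p = 1} \<inter> ?x -` T \<inter> {p. coeff_sum (?x p) = 1}"
  let ?B = "\<Inter>s\<in>{0<..}. {p. ?r p \<le> z s} \<inter> {p. ?f p * (z s - ?r p) \<le> ?e0 p + ?e1 p * s}
      \<inter> {p. den (?x p) s * (z s - ?r p) \<le> num (?x p) s}
      \<inter> {p. (z s - ?r p) * (?f p * num (?x p) s + den (?x p) s * (?e0 p + ?e1 p * s))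
             = num (?x p) s * (?e0 p + ?e1 p * s)}"
  have "closed ?A"
    unfolding coeff_sum_def
    by (intro closed_Int closed_Collect_le closed_Collect_eq continuous_intros closed_vimage[OF cl])
  moreover have "closed ?B"
    by (intro closed_INT ballI closed_Int closed_Collect_le closed_Collect_eq continuous_intros)
  ultimately have "closed (?A \<inter> ?B)" by (rule closed_Int)
  also have "?A \<inter> ?B = normalized_realizations T z"
    unfolding normalized_realizations_def by auto
  finally have "closed (normalized_realizations T z)" .
  moreover have "normalized_realizations T z \<subseteq> {0..z 1} \<times> {0..1} \<times> {0..1} \<times> {0..1} \<times>
      ({0..1} \<times> {0..1} \<times> {0..1} \<times> {0..1} \<times> {0..1} \<times> {0..1})"
  proof
    fix p assume "p \<in> normalized_realizations T z"
    moreover obtain r e0 e1 f a0 a1 a2 b0 b1 b2 where p: "p = (r, e0, e1, f, a0, a1, a2, b0, b1, b2)"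
      by (metis prod.collapse)
    ultimately have *: "0 \<le> r" "0 \<le> e0" "0 \<le> e1" "0 \<le> f" "e0 + e1 + f = 1" "(a0, a1, a2, b0, b1, b2) \<in> T"
      "coeff_sum (a0, a1, a2, b0, b1, b2) = 1" "r \<le> z 1"
      by (auto simp: normalized_realizations_def)
    then have "nonneg (a0, a1, a2, b0, b1, b2)" using T by blast
    then show "p \<in> {0..z 1} \<times> {0..1} \<times> {0..1} \<times> {0..1} \<times>
      ({0..1} \<times> {0..1} \<times> {0..1} \<times> {0..1} \<times> {0..1} \<times> {0..1})"
      using * unfolding p by (simp add: coeff_sum_def)
  qed
  then have "normalized_realizations T z = ({0..z 1} \<times> {0..1} \<times> {0..1} \<times> {0..1} \<times>
      ({0..1} \<times> {0..1} \<times> {0..1} \<times> {0..1} \<times> {0..1} \<times> {0..1})) \<inter> normalized_realizations T z" by blast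
  moreover have "compact ({0..z 1} \<times> {0..1::real} \<times> {0..1::real} \<times> {0..1::real} \<times>
      ({0..1::real} \<times> {0..1::real} \<times> {0..1::real} \<times> {0..1::real} \<times> {0..1::real} \<times> {0..1::real}))"
    by (intro compact_Times compact_Icc)
  ultimately show ?thesis by (metis compact_Int_closed)
qed

lemma nonneg_num_den_zero:
  assumes "nonneg x" "0 < s"
  shows "num x s = 0 \<Longrightarrow> num x t = 0" "den x s = 0 \<Longrightarrow> den x t = 0"
proof -
  obtain a0 a1 a2 b0 b1 b2 where x: "x = (a0, a1, a2, b0, b1, b2)" by (metis prod_cases6)
  show "num x s = 0 \<Longrightarrow> num x t = 0" "den x s = 0 \<Longrightarrow> den x t = 0"
    using assms quadratic_pos[of a0 a1 a2 s] quadratic_pos[of b0 b1 b2 s] unfolding x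
    by (auto simp: add_nonneg_eq_0_iff)
qed

lemma normalized_realizes:
  assumes T: "\<And>x. x \<in> T \<Longrightarrow> nonneg x" and nc: "\<not> (\<exists>c. \<forall>s>0. z s = c)"
    and p: "(r, e0, e1, f, x) \<in> normalized_realizations T z"
  shows "realizes T z r e0 e1 f x"
proof -
  have nn: "0 \<le> r" "0 \<le> e0" "0 \<le> e1" "0 \<le> f" "e0 + e1 + f = 1" "x \<in> T" "coeff_sum x = 1"
    and bd: "\<And>s. s > 0 \<Longrightarrow> r \<le> z s" "\<And>s. s > 0 \<Longrightarrow> f * (z s - r) \<le> e0 + e1 * s"
    "\<And>s. s > 0 \<Longrightarrow> den x s * (z s - r) \<le> num x s"
    and eq: "\<And>s. s > 0 \<Longrightarrow> (z s - r) * (f * num x s + den x s * (e0 + e1 * s)) = num x s * (e0 + e1 * s)"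
    using p by (auto simp: normalized_realizations_def)
  have x: "nonneg x" using T nn by blast
  have "0 < f * num x s + den x s * (e0 + e1 * s)" if s: "s > 0" for s
  proof (rule ccontr)
    assume "\<not> ?thesis"
    moreover have *: "0 \<le> num x s" "0 \<le> den x s" "0 \<le> e0 + e1 * s"
      using num_den_nonneg[OF x s] nn s by auto
    ultimately have 0: "f * num x s + den x s * (e0 + e1 * s) = 0"
      using nn by (meson add_nonneg_nonneg mult_nonneg_nonneg not_less order_antisym)
    then have 1: "f * num x s = 0" "den x s * (e0 + e1 * s) = 0"
      using * nn by (simp_all add: add_nonneg_eq_0_iff)
    have 2: "num x s * (e0 + e1 * s) = 0" using eq[OF s] 0 by simp
    have 3: "e0 = 0 \<and> e1 = 0" if "e0 + e1 * s = 0"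
      using that nn s by (auto simp: add_nonneg_eq_0_iff)
    have 4: "\<not> (num x s = 0 \<and> den x s = 0)"
      using nonneg_num_den_zero[OF x s, of 1] nn(7) by (auto simp: coeff_sum_def)
    \<comment> \<open>If the branch did not vanish, numerator and denominator of x would both be 0,
      against the normalization. So the branch is a short circuit with f = 1, and the two bounds
      squeeze z to the constant r.\<close>
    have e: "e0 + e1 * s = 0" using 1 2 4 by auto
    then have "f = 1" using 3 nn by simp
    then have "z t = r" if "t > 0" for t
      using bd(1,2)[OF that] 3[OF e] by simp
    then show False using nc by auto
  qed
  then show ?thesis unfolding realizes_def using nn eq by auto
qed

text \<open>Rescaling the branch and x leaves r unchanged, so it suffices to maximize r over the
  compact set of normalized representations.\<close>

lemma maximal_realization:
  assumes cl: "closed T" and T: "\<And>x. x \<in> T \<Longrightarrow> nonneg x"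
    and cone: "\<And>k x. 0 < k \<Longrightarrow> x \<in> T \<Longrightarrow> k *\<^sub>R x \<in> T" and nc: "\<not> (\<exists>c. \<forall>s>0. z s = c)"
    and ex: "realizes T z r e0 e1 f x"
  obtains r e0 e1 f x where "realizes T z r e0 e1 f x"
    "\<And>r' e0' e1' f' x'. realizes T z r' e0' e1' f' x' \<Longrightarrow> r' \<le> r"
proof -
  let ?S = "normalized_realizations T z"
  have norm: "\<exists>e0' e1' f' x'. (r, e0', e1', f', x') \<in> ?S" if R: "realizes T z r e0 e1 f x" for r e0 e1 f x
  proof -
    have D: "0 < f * num x 1 + den x 1 * (e0 + e1 * 1)" and x: "x \<in> T"
      using R unfolding realizes_def by (blast intro: zero_less_one)+
    then have "x \<noteq> 0" by (auto simp: num_def den_def)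
    then have sx: "0 < coeff_sum x" using T[OF x] by (rule coeff_sum_pos[rotated])
    have "e0 + e1 + f \<noteq> 0"
    proof
      assume "e0 + e1 + f = 0"
      then have "e0 = 0" "e1 = 0" "f = 0" using R by (auto simp: realizes_def)
      then show False using D by simp
    qed
    then have se: "0 < e0 + e1 + f" using R by (auto simp: realizes_def)
    define k j where "k = 1 / (e0 + e1 + f)" and "j = 1 / coeff_sum x"
    have kj: "0 < k" "0 < j" using sx se by (auto simp: k_def j_def)
    have R': "realizes T z r (k * e0) (k * e1) (k * f) (j *\<^sub>R x)"
      using realizes_scale[OF R kj] cone kj by blast
    have "k * e0 + k * e1 + k * f = k * (e0 + e1 + f)" by (simp add: algebra_simps)
    then have "k * e0 + k * e1 + k * f = 1" using se by (simp add: k_def)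
    moreover have "coeff_sum (j *\<^sub>R x) = 1" using sx by (simp add: coeff_sum_scaleR j_def)
    ultimately have "(r, k * e0, k * e1, k * f, j *\<^sub>R x) \<in> ?S"
      using R' realizes_bounds[OF T R'] unfolding normalized_realizations_def realizes_def by auto
    then show ?thesis by blast
  qed
  have "?S \<noteq> {}" using norm[OF ex] by auto
  moreover have "compact ?S" using cl T by (rule compact_normalized_realizations)
  moreover have "continuous_on ?S fst" by (intro continuous_intros)
  ultimately obtain p where p: "p \<in> ?S" "\<And>q. q \<in> ?S \<Longrightarrow> fst q \<le> fst p"
    using continuous_attains_sup[of ?S fst] by blast
  obtain r e0 e1 f x where pe: "p = (r, e0, e1, f, x)" by (metis prod_cases5)
  show thesis
  proof
    show "realizes T z r e0 e1 f x" using normalized_realizes[OF T nc] p(1) pe by blast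
    show "r' \<le> r" if "realizes T z r' e0' e1' f' x'" for r' e0' e1' f' x'
      using norm[OF that] p(2) pe by force
  qed
qed

text \<open>
  If the zero \<open>-e0 / e1\<close> of the branch \<open>e0 + e1 s\<close> is not a zero of \<open>num x\<close>, moving it to the right
  increases \<open>r\<close> and changes \<open>x\<close> only slightly.
\<close>

lemma realizes_perturb:
  assumes I: "open I" "I \<subseteq> T" and Ipos: "\<And>x. x \<in> I \<Longrightarrow> coeffs_pos x"
    and cone: "\<And>k x. 0 < k \<Longrightarrow> x \<in> I \<Longrightarrow> k *\<^sub>R x \<in> I"
    and R: "realizes T z r e0 e1 f x" and pos: "0 < e0" "0 < e1" "0 < f" and x: "x \<in> I"
    and nz: "num x (- (e0 / e1)) \<noteq> 0"
  obtains r' e0' e1' f' x' where "realizes T z r' e0' e1' f' x'" "r < r'"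
proof -
  obtain a0 a1 a2 b0 b1 b2 where xe: "x = (a0, a1, a2, b0, b1, b2)" by (metis prod_cases6)
  \<comment> \<open>z - r = p / q as a quotient of cubics.\<close>
  define p where "p = (\<lambda>i. [a0 * e0, a1 * e0 + a0 * e1, a2 * e0 + a1 * e1, a2 * e1] ! i)"
  define q where "q = (\<lambda>i. [f * a0 + b0 * e0, f * a1 + b1 * e0 + b0 * e1, f * a2 + b2 * e0 + b1 * e1, b2 * e1] ! i)"
  have p: "p 0 = a0 * e0" "p 1 = a1 * e0 + a0 * e1" "p 2 = a2 * e0 + a1 * e1" "p 3 = a2 * e1"
    and q: "q 0 = f * a0 + b0 * e0" "q 1 = f * a1 + b1 * e0 + b0 * e1" "q 2 = f * a2 + b2 * e0 + b1 * e1" "q 3 = b2 * e1"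
    by (simp_all add: p_def q_def eval_nat_numeral)
  have cp: "cubic p s = num x s * (e0 + e1 * s)" and cq: "cubic q s = f * num x s + den x s * (e0 + e1 * s)" for s
    by (simp_all add: cubic_def p[unfolded One_nat_def] q[unfolded One_nat_def] xe algebra_simps power2_eq_square power3_eq_cube)
  define t where "t = - (e0 / e1)"
  have t: "t < 0" and et: "e0 + e1 * t = 0" using pos by (simp_all add: t_def)
  have e0: "e0 = - (e1 * t)" using et by linarith
  have nz: "num x t \<noteq> 0" using nz by (simp add: t_def)
  have cqt: "cubic q t = f * num x t" "cubic p t = 0" by (simp_all add: cq cp et)
  then have cqt0: "cubic q t \<noteq> 0" using nz pos by simp
  have r0: "split_r p q t = 0" by (simp add: split_r_def cqt)
  have n: "split_num p q t 0 = e1 * a0" "split_num p q t 1 = e1 * a1" "split_num p q t 2 = e1 * a2"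
    unfolding split_num_def Let_def r0 p by (simp_all add: e0 algebra_simps)
  have numt: "num (split_x p q t) t = e1 * num x t"
    by (simp add: split_x_def n[unfolded One_nat_def] xe algebra_simps)
  then have nzt: "num (split_x p q t) t \<noteq> 0" using nz pos by simp
  have c: "split_c p q t = f / e1"
  proof -
    have "split_c p q t = cubic q t / num (split_x p q t) t" by (simp add: split_c_def split_x_def)
    then show ?thesis using nz unfolding numt cqt by simp
  qed
  have ce: "f / e1 * (e1 * y) = f * y" for y using pos by simp
  \<comment> \<open>Splitting at t itself returns the given biquadratic up to the factor e1, which
    the cone property ignores.\<close>
  have "split_x p q t = e1 *\<^sub>R x"
    unfolding split_x_def split_den_def Let_def xe
    by (simp only: n c ce q, simp add: e0 algebra_simps)
  then have xI: "split_x p q t \<in> I" using cone[OF pos(2) x] by simp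
  let ?F = "at_right t"
  have lim: "((\<lambda>u. u) \<longlongrightarrow> t) ?F" by (rule tendsto_ident_at)
  note tends = split_tendsto[OF tendsto_const tendsto_const lim cqt0, of p]
  have 1: "\<forall>\<^sub>F u in ?F. split_x p q u \<in> I"
    using tends(3)[OF nzt] I(1) xI by (rule topological_tendstoD)
  have 2: "\<forall>\<^sub>F u in ?F. 0 < split_c p q u"
    using tends(2)[OF nzt] c pos by (intro order_tendstoD(1)[of _ "f / e1"]) auto
  have 3: "\<forall>\<^sub>F u in ?F. u < 0" using order_tendstoD(2)[OF lim t] .
  have 4: "\<forall>\<^sub>F u in ?F. t < u" by (simp add: eventually_at_right_less)
  \<comment> \<open>\<open>split_r p q u\<close> is this quotient times e0 + e1 u. The quotient
    tends to 1 / f > 0, and e0 + e1 u is positive to the right of t.\<close>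
  have "((\<lambda>u. num x u / cubic q u) \<longlongrightarrow> num x t / cubic q t) ?F"
    unfolding xe num_den_simps cubic_def using cqt0 unfolding cubic_def by (intro tendsto_intros lim)
  moreover have "num x t / cubic q t = 1 / f" using nz pos by (simp add: cqt)
  ultimately have 5: "\<forall>\<^sub>F u in ?F. 0 < num x u / cubic q u"
    using pos by (intro order_tendstoD(1)[of _ "1 / f"]) auto
  have "\<forall>\<^sub>F u in ?F. split_x p q u \<in> I \<and> 0 < split_c p q u \<and> u < 0 \<and> t < u \<and> 0 < num x u / cubic q u"
    using 1 2 3 4 5 by eventually_elim auto
  moreover have "?F \<noteq> bot" by (simp add: trivial_limit_at_right_real)
  ultimately obtain u where u: "split_x p q u \<in> I" "0 < split_c p q u" "u < 0" "t < u" "0 < num x u / cubic q u"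
    using eventually_happens by blast
  have qu: "cubic q u \<noteq> 0" using u by auto
  have "0 < e0 + e1 * u" using u(4) et pos by (smt (verit) mult_less_cancel_left_pos)
  then have ru: "0 < split_r p q u"
    using mult_pos_pos[OF u(5), of "e0 + e1 * u"] by (simp add: split_r_def cp)
  define y where "y = split_x p q u"
  have y: "coeffs_pos y" using Ipos u(1) by (simp add: y_def)
  have nu: "num y u \<noteq> 0"
  proof
    assume 0: "num y u = 0"
    have "cubic p s - split_r p q u * cubic q s = (s - u) * num y s" for s
      unfolding y_def by (rule split_cubic(1)[OF qu])
    have "split_c p q u = 0"
      using 0 unfolding split_c_def y_def split_x_def by simp
    then show False using u(2) by simp
  qed
  have s1: "cubic p s - split_r p q u * cubic q s = (s - u) * num y s"
    and s2: "cubic q s = split_c p q u * num y s + (s - u) * den y s" for s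
    using split_cubic[OF qu, of p s] nu unfolding y_def by auto
  \<comment> \<open>The new branch is (s - u) / c with c = \<open>split_c p q u\<close>. As p / q
    represents z - r, the series resistance grows by \<open>split_r p q u\<close>.\<close>
  have "realizes T z (r + split_r p q u) (- u) 1 (split_c p q u) y"
    unfolding realizes_def
  proof (intro conjI allI impI)
    fix s :: real assume s: "s > 0"
    have D: "split_c p q u * num y s + den y s * (- u + 1 * s) = cubic q s"
      using s2[of s] by (simp add: algebra_simps)
    show "0 < split_c p q u * num y s + den y s * (- u + 1 * s)"
      unfolding D cq using R s by (simp add: realizes_def)
    have "(z s - r) * cubic q s = cubic p s"
      unfolding cp cq using R s by (simp add: realizes_def)
    then show "(z s - (r + split_r p q u)) * (split_c p q u * num y s + den y s * (- u + 1 * s)) = num y s * (- u + 1 * s)"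
      unfolding D using s1[of s] by (simp add: algebra_simps)
  next
    show "0 \<le> r + split_r p q u" using R ru by (simp add: realizes_def)
    show "y \<in> T" using u(1) I(2) by (auto simp: y_def)
  qed (use u in auto)
  then show thesis using ru by (intro that) auto
qed

text \<open>
  If it is a zero of \<open>num x\<close>, admittance can be moved from the branch to \<open>x\<close> until \<open>x\<close> leaves \<open>I\<close> or
  the branch disappears.
\<close>

lemma realizes_shift:
  assumes cl: "closed T" and I: "open I" "I \<subseteq> T" and Ipos: "\<And>x. x \<in> I \<Longrightarrow> coeffs_pos x"
    and R: "realizes T z r e0 e1 f x" and pos: "0 < e0" "0 < e1" "0 < f" and x: "x \<in> I"
    and z: "num x (- (e0 / e1)) = 0"
  obtains f' x' where "realizes T z r e0 e1 f' x'" "f' = 0 \<or> x' \<notin> I"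
proof -
  obtain a0 a1 a2 b0 b1 b2 where xe: "x = (a0, a1, a2, b0, b1, b2)" by (metis prod_cases6)
  have xpos: "coeffs_pos x" using Ipos x by blast
  \<comment> \<open>The cofactor in num x s = (c0 + c1 s) (e0 + e1 s), read off from the outer
    coefficients.\<close>
  define c0 c1 where "c0 = a0 / e0" and "c1 = a2 / e1"
  have c: "a0 = c0 * e0" "a2 = c1 * e1" using pos by (simp_all add: c0_def c1_def)
  have "e1\<^sup>2 * num x (- (e0 / e1)) = a0 * e1\<^sup>2 - a1 * e0 * e1 + a2 * e0\<^sup>2"
    using pos unfolding xe by (simp add: field_simps power2_eq_square)
  then have "a1 * (e0 * e1) = (c0 * e1 + c1 * e0) * (e0 * e1)"
    using z c by (simp add: algebra_simps power2_eq_square)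
  then have a1: "a1 = c0 * e1 + c1 * e0" using pos by simp
  have num: "num x s = (c0 + c1 * s) * (e0 + e1 * s)" for s
    unfolding xe a1 c by (simp add: algebra_simps power2_eq_square)
  \<comment> \<open>The admittance of x increased by \<delta> f / (e0 + e1 s), a fraction \<delta>
    of the admittance of the branch.\<close>
  define y where "y \<delta> = (a0, a1, a2, b0 + \<delta> * (f * c0), b1 + \<delta> * (f * c1), b2)" for \<delta>
  have y: "num (y \<delta>) s = num x s" "den (y \<delta>) s = den x s + \<delta> * f * (c0 + c1 * s)" for \<delta> s
    unfolding y_def xe by (simp_all add: algebra_simps)
  have Ry: "realizes T z r e0 e1 (f * (1 - \<delta>)) (y \<delta>)" if "0 \<le> \<delta>" "\<delta> \<le> 1" "y \<delta> \<in> T" for \<delta>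
  proof -
    have "f * (1 - \<delta>) * num (y \<delta>) s + den (y \<delta>) s * (e0 + e1 * s) = f * num x s + den x s * (e0 + e1 * s)" for s
      unfolding y num by (simp add: algebra_simps)
    then show ?thesis using R that pos unfolding realizes_def y(1) by simp
  qed
  have cont: "continuous_on A y" for A
    unfolding y_def by (intro continuous_intros)
  \<comment> \<open>Take the largest \<delta> that keeps y \<delta> in T. If it were below 1 with y
    \<delta> in the open set I, it could still be increased.\<close>
  have "compact ({0..1} \<inter> y -` T)"
    by (intro compact_Int_closed compact_Icc closed_vimage[OF cl] cont)
  moreover have "0 \<in> {0..1} \<inter> y -` T" using x I(2) by (auto simp: y_def xe)
  ultimately obtain \<delta> where \<delta>: "\<delta> \<in> {0..1} \<inter> y -` T" "\<And>\<epsilon>. \<epsilon> \<in> {0..1} \<inter> y -` T \<Longrightarrow> \<epsilon> \<le> \<delta>"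
    using compact_attains_sup[of "{0..1} \<inter> y -` T"] by blast
  show thesis
  proof (cases "y \<delta> \<in> I \<and> \<delta> < 1")
    case False
    then have "f * (1 - \<delta>) = 0 \<or> y \<delta> \<notin> I" using \<delta>(1) by auto
    then show thesis using Ry[of \<delta>] \<delta>(1) by (intro that) auto
  next
    case True
    have "open (y -` I)" using I(1) cont by (rule open_vimage)
    then obtain \<eta> where \<eta>: "\<eta> > 0" "ball \<delta> \<eta> \<subseteq> y -` I" using True by (metis open_contains_ball vimageI)
    define \<epsilon> where "\<epsilon> = min 1 (\<delta> + \<eta> / 2)"
    have e: "\<delta> < \<epsilon>" "\<epsilon> \<le> 1" "\<epsilon> < \<delta> + \<eta>" using True \<eta> by (auto simp: \<epsilon>_def min_def)
    then have "\<epsilon> \<in> ball \<delta> \<eta>" by (simp add: dist_real_def)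
    then have "y \<epsilon> \<in> T" using \<eta>(2) I(2) by blast
    then have "\<epsilon> \<in> {0..1} \<inter> y -` T" using e \<delta>(1) by auto
    then show thesis using \<delta>(2) e by fastforce
  qed
qed

lemma extremal_realization:
  assumes T: "closed T" "\<And>x. x \<in> T \<Longrightarrow> nonneg x" "\<And>k x. 0 < k \<Longrightarrow> x \<in> T \<Longrightarrow> k *\<^sub>R x \<in> T"
    and I: "open I" "I \<subseteq> T" "\<And>x. x \<in> I \<Longrightarrow> coeffs_pos x" "\<And>k x. 0 < k \<Longrightarrow> x \<in> I \<Longrightarrow> k *\<^sub>R x \<in> I"
    and nc: "\<not> (\<exists>c. \<forall>s>0. z s = c)" and ex: "realizes T z r e0 e1 f x"
  obtains r e0 e1 f x where "realizes T z r e0 e1 f x" "e0 = 0 \<or> e1 = 0 \<or> f = 0 \<or> x \<notin> I"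
proof -
  obtain r e0 e1 f x where R: "realizes T z r e0 e1 f x"
    and max: "\<And>r' e0' e1' f' x'. realizes T z r' e0' e1' f' x' \<Longrightarrow> r' \<le> r"
    using maximal_realization[OF T nc ex] by blast
  show thesis
  proof (cases "e0 = 0 \<or> e1 = 0 \<or> f = 0 \<or> x \<notin> I")
    case True then show thesis using R that by blast
  next
    case False
    then have pos: "0 < e0" "0 < e1" "0 < f" and x: "x \<in> I" using R by (auto simp: realizes_def)
    show thesis
    proof (cases "num x (- (e0 / e1)) = 0")
      case True
      then show thesis using realizes_shift[OF T(1) I(1-3) R pos x] that by metis
    next
      case False
      then show thesis using realizes_perturb[OF I R pos x] max by (metis not_le)
    qed
  qed
qed

section \<open>Every impedance is realized\<close>

lemma bflip_sel: "bflip x = (fst (snd (snd x)), fst (snd x), fst x, snd (snd (snd (snd (snd x)))),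
    fst (snd (snd (snd (snd x)))), fst (snd (snd (snd x))))"
  by (cases x) simp

lemma bswap_sel: "bswap x = (fst (snd (snd (snd x))), fst (snd (snd (snd (snd x)))), snd (snd (snd (snd (snd x)))),
    fst x, fst (snd x), fst (snd (snd x)))"
  by (cases x) simp

lemma continuous_bflip_bswap: "continuous_on A bflip" "continuous_on A bswap"
  unfolding bflip_sel[abs_def] bswap_sel[abs_def] by (intro continuous_intros)+

lemma closed_nonneg: "closed {x. nonneg x}"
proof -
  have "nonneg x \<longleftrightarrow> 0 \<le> fst x \<and> 0 \<le> fst (snd x) \<and> 0 \<le> fst (snd (snd x)) \<and> 0 \<le> fst (snd (snd (snd x)))
      \<and> 0 \<le> fst (snd (snd (snd (snd x)))) \<and> 0 \<le> snd (snd (snd (snd (snd x))))" for x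
    by (cases x) simp
  then show ?thesis
    by (simp add: closed_Collect_conj closed_Collect_le continuous_on_fst continuous_on_snd continuous_on_const continuous_on_id)
qed

lemma open_coeffs_pos: "open {x. coeffs_pos x}"
proof -
  have "coeffs_pos x \<longleftrightarrow> 0 < fst x \<and> 0 < fst (snd x) \<and> 0 < fst (snd (snd x)) \<and> 0 < fst (snd (snd (snd x)))
      \<and> 0 < fst (snd (snd (snd (snd x)))) \<and> 0 < snd (snd (snd (snd (snd x))))" for x
    by (cases x) simp
  then show ?thesis
    by (simp add: open_Collect_conj open_Collect_less continuous_on_fst continuous_on_snd continuous_on_const continuous_on_id)
qed

text \<open>The minors A, B, D of the coefficient matrix, written with projections so that the
  continuity rules apply.\<close>

definition mA :: "biquad \<Rightarrow> real" where
  "mA x = fst (snd (snd x)) * fst (snd (snd (snd x))) - fst x * snd (snd (snd (snd (snd x))))"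
definition mB :: "biquad \<Rightarrow> real" where
  "mB x = fst (snd x) * fst (snd (snd (snd x))) - fst x * fst (snd (snd (snd (snd x))))"
definition mD :: "biquad \<Rightarrow> real" where
  "mD x = fst (snd (snd x)) * fst (snd (snd (snd (snd x)))) - fst (snd x) * snd (snd (snd (snd (snd x))))"

lemma continuous_minors [continuous_intros]: "continuous_on A mA" "continuous_on A mB" "continuous_on A mD"
  unfolding mA_def mB_def mD_def by (intro continuous_intros)+

lemma minors_simps [simp]:
  "mA (a0, a1, a2, b0, b1, b2) = a2 * b0 - a0 * b2" "mB (a0, a1, a2, b0, b1, b2) = a1 * b0 - a0 * b1"
  "mD (a0, a1, a2, b0, b1, b2) = a2 * b1 - a1 * b2"
  by (simp_all add: mA_def mB_def mD_def)

lemma minors_scaleR: "mA (k *\<^sub>R x) = k\<^sup>2 * mA x" "mB (k *\<^sub>R x) = k\<^sup>2 * mB x" "mD (k *\<^sub>R x) = k\<^sup>2 * mD x"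
  by (simp_all add: mA_def mB_def mD_def algebra_simps power2_eq_square)

lemma bres_minors: "bres x = (mA x)\<^sup>2 - mB x * mD x"
  by (cases x) simp

lemma min_at_0_minors: "min_at_0 x \<longleftrightarrow> 0 \<le> mA x \<and> 0 \<le> mB x \<and>
    fst (snd (snd (snd x))) * mA x \<le> fst (snd (snd (snd (snd x)))) * mB x"
  by (cases x) simp

lemma strict_min_at_0_minors: "strict_min_at_0 x \<longleftrightarrow>
    fst (snd (snd (snd x))) * \<bar>mA x\<bar> < fst (snd (snd (snd (snd x)))) * mB x"
  by (cases x) simp

lemma rl_minors: "rl x \<longleftrightarrow> nonneg x \<and> 0 \<le> mA x \<and> 0 \<le> mB x \<and> 0 \<le> mD x \<and> bres x \<le> 0"
  by (cases x) simp

lemma rl_int_minors: "rl_int x \<longleftrightarrow> coeffs_pos x \<and> 0 < mA x \<and> 0 < mB x \<and> 0 < mD x \<and> bres x < 0"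
  by (cases x) simp

lemma closed_min_at_0: "closed {x. min_at_0 x}"
  unfolding min_at_0_minors by (intro closed_Collect_conj closed_Collect_le continuous_intros)

lemma open_strict_min_at_0: "open {x. strict_min_at_0 x}"
  unfolding strict_min_at_0_minors by (intro open_Collect_less continuous_intros)

lemma closed_regular: "closed {x. regular x}"
proof -
  have "closed {x. min_at_0 (bflip x)}" "closed {x. min_at_0 (bswap x)}" "closed {x. min_at_0 (bflip (bswap x))}"
    using closed_vimage[OF closed_min_at_0 continuous_bflip_bswap(1)]
      closed_vimage[OF closed_min_at_0 continuous_bflip_bswap(2)]
      closed_vimage[OF closed_vimage[OF closed_min_at_0 continuous_bflip_bswap(1)] continuous_bflip_bswap(2)]
    by (simp_all add: vimage_def)
  then show ?thesis unfolding regular_def bres_minors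
    by (intro closed_Collect_conj closed_Collect_disj closed_nonneg closed_Collect_le closed_min_at_0 continuous_intros)
qed

lemma open_regular_int: "open {x. regular_int x}"
proof -
  have "open {x. strict_min_at_0 (bflip x)}" "open {x. strict_min_at_0 (bswap x)}"
    "open {x. strict_min_at_0 (bflip (bswap x))}"
    using open_vimage[OF open_strict_min_at_0 continuous_bflip_bswap(1)]
      open_vimage[OF open_strict_min_at_0 continuous_bflip_bswap(2)]
      open_vimage[OF open_vimage[OF open_strict_min_at_0 continuous_bflip_bswap(1)] continuous_bflip_bswap(2)]
    by (simp_all add: vimage_def)
  then show ?thesis unfolding regular_int_def bres_minors
    by (intro open_Collect_conj open_Collect_disj open_coeffs_pos open_Collect_less open_strict_min_at_0 continuous_intros)
qed

lemma closed_rl: "closed {x. rl x}"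
  unfolding rl_minors bres_minors
  by (intro closed_Collect_conj closed_nonneg closed_Collect_le continuous_intros)

lemma open_rl_int: "open {x. rl_int x}"
  unfolding rl_int_minors bres_minors
  by (intro open_Collect_conj open_coeffs_pos open_Collect_less continuous_intros)

lemma flip_swap_scaleR: "bflip (k *\<^sub>R x) = k *\<^sub>R bflip x" "bswap (k *\<^sub>R x) = k *\<^sub>R bswap x"
  by (cases x; simp)+

lemma scaleR_invariant:
  assumes k: "k > 0"
  shows "nonneg (k *\<^sub>R x) = nonneg x" "coeffs_pos (k *\<^sub>R x) = coeffs_pos x"
    "min_at_0 (k *\<^sub>R x) = min_at_0 x" "strict_min_at_0 (k *\<^sub>R x) = strict_min_at_0 x"
    "bres (k *\<^sub>R x) = k ^ 4 * bres x"
proof -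
  show "nonneg (k *\<^sub>R x) = nonneg x" "coeffs_pos (k *\<^sub>R x) = coeffs_pos x"
    using k by (cases x; simp add: zero_le_mult_iff zero_less_mult_iff)+
  have e: "k * b * (k\<^sup>2 * m) = k ^ 3 * (b * m)" for b m by (simp add: power2_eq_square power3_eq_cube)
  have "\<bar>k\<^sup>2 * m\<bar> = k\<^sup>2 * \<bar>m\<bar>" for m by (simp add: abs_mult)
  then show "min_at_0 (k *\<^sub>R x) = min_at_0 x" "strict_min_at_0 (k *\<^sub>R x) = strict_min_at_0 x"
    using k unfolding min_at_0_minors strict_min_at_0_minors minors_scaleR
    by (simp_all add: e zero_le_mult_iff)
  show "bres (k *\<^sub>R x) = k ^ 4 * bres x"
    unfolding bres_minors minors_scaleR by (simp add: algebra_simps eval_nat_numeral)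
qed

lemma regular_scaleR: "0 < k \<Longrightarrow> regular (k *\<^sub>R x) = regular x" "0 < k \<Longrightarrow> regular_int (k *\<^sub>R x) = regular_int x"
  unfolding regular_def regular_int_def flip_swap_scaleR
  by (simp_all add: scaleR_invariant zero_le_mult_iff zero_less_mult_iff)

lemma rl_scaleR: "0 < k \<Longrightarrow> rl (k *\<^sub>R x) = rl x" "0 < k \<Longrightarrow> rl_int (k *\<^sub>R x) = rl_int x"
  unfolding rl_minors rl_int_minors minors_scaleR
  by (simp_all add: scaleR_invariant zero_le_mult_iff zero_less_mult_iff mult_le_0_iff mult_less_0_iff)

text \<open>The two forms of the equation can differ only if a branch is a short circuit, that is e0
  = e1 = 0 or x has numerator zero. In either form z would then be constantly r, which is
  excluded.\<close>

lemma realizes_iff_val: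
  assumes x: "nonneg x" "x \<noteq> 0" and e: "0 \<le> e0" "0 \<le> e1" "0 \<le> f" and nc: "\<not> (\<exists>c. \<forall>s>0. z s = c)"
  shows "(\<forall>s>0. Some (z s) = radd (Some r) (rpar (ratio (e0 + e1 * s) f) (biq x s))) \<and> 0 < e0 + e1 + f \<longleftrightarrow>
    (\<forall>s>0. 0 < f * num x s + den x s * (e0 + e1 * s) \<and>
        (z s - r) * (f * num x s + den x s * (e0 + e1 * s)) = num x s * (e0 + e1 * s))" (is "?l \<longleftrightarrow> ?r")
proof -
  have nd: "0 \<le> num x s" "0 \<le> den x s" "num x s = 0 \<longrightarrow> den x s \<noteq> 0" if "s > 0" for s
    using num_den_nonneg[OF x(1) that] nonneg_num_den_zero[OF x(1) that, of 1] coeff_sum_pos[OF x]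
    by (auto simp: coeff_sum_def)
  have es: "0 \<le> e0 + e1 * s" if "s > 0" for s using e that by simp
  have val: "rpar (ratio (e0 + e1 * s) f) (biq x s) =
      ratio (num x s * (e0 + e1 * s)) (f * num x s + den x s * (e0 + e1 * s))"
    if "s > 0" "0 < e0 + e1 * s" "0 < num x s" for s
    unfolding biq_num_den using nd[OF that(1)] es[OF that(1)] e that
    by (subst rpar_ratio) (auto simp: mult_ac add_ac)
  have e_zero: "e0 = 0 \<and> e1 = 0" if "s > 0" "e0 + e1 * s = 0" for s
    using that e by (auto simp: add_nonneg_eq_0_iff)
  show ?thesis
  proof
    assume l: ?l
    have "0 < e0 + e1 * s" if s: "s > 0" for s
    proof (rule ccontr)
      assume "\<not> ?thesis"
      then have "e0 = 0" "e1 = 0" "f > 0" using e_zero[OF s] es[OF s] l e by auto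
      then have "z t = r" if "t > 0" for t using l that by (auto simp: ratio_def)
      then show False using nc by auto
    qed
    moreover have "0 < num x s" if s: "s > 0" for s
    proof (rule ccontr)
      assume "\<not> ?thesis"
      then have "num x s = 0" using nd[OF s] by simp
      then have n0: "num x t = 0" for t by (rule nonneg_num_den_zero(1)[OF x(1) s])
      then have "biq x t = Some 0" if "t > 0" for t using nd(3)[OF that] by (simp add: biq_num_den ratio_def)
      then have "z t = r" if "t > 0" for t using l that by auto
      then show False using nc by auto
    qed
    ultimately show ?r
    proof (intro allI impI)
      fix s :: real assume s: "s > 0" and p: "\<And>s. 0 < s \<Longrightarrow> 0 < e0 + e1 * s" "\<And>s. 0 < s \<Longrightarrow> 0 < num x s"
      define D where "D = f * num x s + den x s * (e0 + e1 * s)"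
      have "Some (z s) = radd (Some r) (ratio (num x s * (e0 + e1 * s)) D)"
        using l s val[OF s p(1)[OF s] p(2)[OF s]] by (simp add: D_def)
      then have D: "D \<noteq> 0" "z s = r + num x s * (e0 + e1 * s) / D" by (auto simp: ratio_def split: if_splits)
      moreover have "0 \<le> D" using nd[OF s] es[OF s] e by (simp add: D_def)
      ultimately show "0 < D \<and> (z s - r) * D = num x s * (e0 + e1 * s)" by simp
    qed
  next
    assume r: ?r
    have "0 < e0 + e1 * s" if s: "s > 0" for s
    proof (rule ccontr)
      assume "\<not> ?thesis"
      then have "e0 = 0" "e1 = 0" using e_zero[OF s] es[OF s] by auto
      then have "z t = r" if "t > 0" for t using r that by fastforce
      then show False using nc by auto
    qed
    moreover have "0 < num x s" if s: "s > 0" for s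
    proof (rule ccontr)
      assume "\<not> ?thesis"
      then have "num x s = 0" using nd[OF s] by simp
      then have n0: "num x t = 0" for t by (rule nonneg_num_den_zero(1)[OF x(1) s])
      then have "z t = r" if "t > 0" for t using r that by fastforce
      then show False using nc by auto
    qed
    ultimately show ?l
    proof (intro conjI allI impI)
      fix s :: real assume s: "s > 0" and p: "\<And>s. 0 < s \<Longrightarrow> 0 < e0 + e1 * s" "\<And>s. 0 < s \<Longrightarrow> 0 < num x s"
      define D where "D = f * num x s + den x s * (e0 + e1 * s)"
      have "0 < D" "(z s - r) * D = num x s * (e0 + e1 * s)" using r s by (auto simp: D_def)
      then have "z s = r + num x s * (e0 + e1 * s) / D" "D \<noteq> 0" by (auto simp: field_simps)
      then show "Some (z s) = radd (Some r) (rpar (ratio (e0 + e1 * s) f) (biq x s))"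
        unfolding val[OF s p(1)[OF s] p(2)[OF s]] D_def[symmetric] by (simp add: ratio_def)
    next
      assume "\<And>s. 0 < s \<Longrightarrow> 0 < e0 + e1 * s"
      from this[of 1] show "0 < e0 + e1 + f" using e by simp
    qed
  qed
qed

lemma extremal_form:
  assumes T: "closed T" "\<And>x. x \<in> T \<Longrightarrow> nonneg x" "\<And>k x. 0 < k \<Longrightarrow> x \<in> T \<Longrightarrow> k *\<^sub>R x \<in> T"
    and I: "open I" "I \<subseteq> T" "\<And>x. x \<in> I \<Longrightarrow> coeffs_pos x" "\<And>k x. 0 < k \<Longrightarrow> x \<in> I \<Longrightarrow> k *\<^sub>R x \<in> I"
    and nc: "\<not> (\<exists>c. \<forall>s>0. z s = c)"
    and ex: "0 \<le> r" "0 \<le> e0" "0 \<le> e1" "0 \<le> f" "0 < e0 + e1 + f" "x \<in> T" "x \<noteq> 0"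
      "\<And>s. s > 0 \<Longrightarrow> Some (z s) = radd (Some r) (rpar (ratio (e0 + e1 * s) f) (biq x s))"
  obtains r e0 e1 f x where "0 \<le> r" "0 \<le> e0" "0 \<le> e1" "0 \<le> f" "0 < e0 + e1 + f" "x \<in> T" "x \<noteq> 0"
    "\<And>s. s > 0 \<Longrightarrow> Some (z s) = radd (Some r) (rpar (ratio (e0 + e1 * s) f) (biq x s))"
    "e0 = 0 \<or> e1 = 0 \<or> f = 0 \<or> x \<notin> I"
proof -
  have "realizes T z r e0 e1 f x"
    using ex realizes_iff_val[OF T(2)[OF ex(6)] ex(7) ex(2-4) nc, of r] unfolding realizes_def by simp
  then obtain r e0 e1 f x where R: "realizes T z r e0 e1 f x" "e0 = 0 \<or> e1 = 0 \<or> f = 0 \<or> x \<notin> I"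
    using extremal_realization[OF T I nc] by metis
  have "x \<noteq> 0"
  proof
    assume "x = 0"
    then have "num x 1 = 0" "den x 1 = 0" by (simp_all add: num_def den_def)
    then show False using R(1) unfolding realizes_def by (metis add_0 less_irrefl mult_zero_left mult_zero_right zero_less_one)
  qed
  moreover have "0 \<le> r" "0 \<le> e0" "0 \<le> e1" "0 \<le> f" "x \<in> T" using R(1) by (auto simp: realizes_def)
  moreover from this R(1) have "(\<forall>s>0. Some (z s) = radd (Some r) (rpar (ratio (e0 + e1 * s) f) (biq x s))) \<and> 0 < e0 + e1 + f"
    using realizes_iff_val[OF T(2) \<open>x \<noteq> 0\<close> _ _ _ nc, of e0 e1 f r] unfolding realizes_def by simp
  ultimately show thesis using R(2) by (intro that) auto
qed

section \<open>Networks for extremal representations\<close>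

definition nets3 :: "network set" where
  "nets3 = \<N>17 \<union> \<N>18 \<union> \<N>20 \<union> \<N>21 \<union> \<N>22 \<union> \<N>23 \<union> \<N>24 \<union> \<N>25 \<union> \<N>26 \<union> \<N>27 \<union> \<N>29 \<union> \<N>30"

text \<open>The biquadratic alternatives are kept as classes of functions because in this form they
  are invariant under \<open>pd\<close>, on which \<open>good_pd_realized\<close> relies.\<close>

definition good :: "(real \<Rightarrow> real option) \<Rightarrow> bool" where
  "good v \<longleftrightarrow> TLC v \<or> TLL v \<or> (\<exists>N\<in>nets3. \<forall>s>0. val N s = v s)"

lemma good_cong: "good v \<Longrightarrow> (\<And>s. s > 0 \<Longrightarrow> w s = v s) \<Longrightarrow> good w"
  unfolding good_def using TLC_cong TLL_cong by (metis (full_types))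

lemma good_network:
  assumes "N \<in> nets3" "\<And>s. s > 0 \<Longrightarrow> v s = val N s" shows "good v"
  using assms unfolding good_def by auto

lemma good_TLC: "TLC v \<Longrightarrow> 0 \<le> r \<Longrightarrow> good (\<lambda>s. radd (Some r) (v s))"
  unfolding good_def by (intro disjI1 TLC_Res_series) (auto intro: Res_Some)

lemma good_TLL: "TLL v \<Longrightarrow> 0 \<le> r \<Longrightarrow> good (\<lambda>s. radd (Some r) (v s))"
  unfolding good_def by (intro disjI2 disjI1 TLL_Res_series) (auto intro: Res_Some)

lemma WC_WL_parallel: "WC u \<Longrightarrow> WL v \<Longrightarrow> TLC (\<lambda>s. rpar (u s) (v s))"
  using WL_WC_parallel[of v u] by (simp add: rpar_commute)

lemma WL_val: "sp_network N \<Longrightarrow> num_capacitors N = 0 \<Longrightarrow> num_inductors N = 1 \<Longrightarrow> WL (val N)"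
  and WC_val: "sp_network N \<Longrightarrow> num_capacitors N = 1 \<Longrightarrow> num_inductors N = 0 \<Longrightarrow> WC (val N)"
  using val_cls[of N] by (simp_all add: cls_def)

text \<open>The case of a vanishing branch resistor: each of the four networks for w gives a class
  with R5 = 0. If w is bilinear, the result is again biquadratic.\<close>

lemma good_inductor:
  assumes r: "0 \<le> r" and l: "0 < l" and w: "TLC w"
  shows "good (\<lambda>s. radd (Some r) (rpar (val (Inductor l) s) (w s)))"
proof -
  obtain x where x: "regular x" "x \<noteq> 0" and wx: "\<And>s. s > 0 \<Longrightarrow> w s = biq x s"
    using w unfolding TLC_def by blast
  have L: "WL (val (Inductor l))" using l by (intro WL_val) auto
  from x have "good (\<lambda>s. radd (Some r) (rpar (val (Inductor l) s) (biq x s)))"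
  proof (cases rule: regular_cases)
    case WL
    then show ?thesis using L r by (intro good_TLL WL_WL_parallel)
  next
    case WC
    then show ?thesis using L r by (intro good_TLC WL_WC_parallel)
  next
    case (net N R1 R2 G3 C1 L1)
    from net(1) consider "N = net6" | "N = net7" | "N = net8" | "N = net9" by blast
    then show ?thesis
    proof cases
      case 1
      have "net10 R1 R2 G3 r 0 C1 L1 l \<in> nets3" using net r l unfolding nets3_def \<N>18_def by blast
      then show ?thesis by (rule good_network) (use net(8) 1 in \<open>simp add: net10_def net6_def\<close>)
    next
      case 2
      have "net11 R1 R2 G3 r 0 C1 L1 l \<in> nets3" using net r l unfolding nets3_def \<N>21_def by blast
      then show ?thesis by (rule good_network) (use net(8) 2 in \<open>simp add: net11_def net7_def\<close>)
    next
      case 3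
      have "net12 R1 R2 G3 r 0 C1 L1 l \<in> nets3" using net r l unfolding nets3_def \<N>24_def by blast
      then show ?thesis by (rule good_network) (use net(8) 3 in \<open>simp add: net12_def net8_def\<close>)
    next
      case 4
      have "net13 R1 R2 G3 r 0 C1 L1 l \<in> nets3" using net r l unfolding nets3_def \<N>27_def by blast
      then show ?thesis by (rule good_network) (use net(8) 4 in \<open>simp add: net13_def net9_def\<close>)
    qed
  qed
  then show ?thesis by (rule good_cong) (simp add: wx)
qed

lemma good_capacitor:
  assumes r: "0 \<le> r" and c: "0 < c" and w: "TLL w"
  shows "good (\<lambda>s. radd (Some r) (rpar (val (Capacitor c) s) (w s)))"
proof -
  obtain x where x: "rl x" "x \<noteq> 0" and wx: "\<And>s. s > 0 \<Longrightarrow> w s = biq x s"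
    using w unfolding TLL_def by blast
  have C: "WC (val (Capacitor c))" using c by (intro WC_val) auto
  from x have "good (\<lambda>s. radd (Some r) (rpar (val (Capacitor c) s) (biq x s)))"
  proof (cases rule: rl_cases)
    case WL
    then show ?thesis using C r by (intro good_TLC WC_WL_parallel)
  next
    case (net R1 R2 G3 L1 L2)
    have "net14 R1 R2 G3 r 0 c L1 L2 \<in> nets3" using net r c unfolding nets3_def \<N>30_def by blast
    then show ?thesis by (rule good_network) (use net(7) in \<open>simp add: net14_def net5_def\<close>)
  qed
  then show ?thesis by (rule good_cong) (simp add: wx)
qed

text \<open>For \<open>net6\<close> and \<open>net7\<close> the first parameter is a series
  resistor: when it vanishes, L1 or C1 moves to the front and the old branch joins the remaining RC
  or RL part. For \<open>net8\<close> and \<open>net9\<close> it is a shunt conductance, and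
  omitting it gives \<open>\<N>22\<close> or \<open>\<N>25\<close> at once.\<close>

lemma good_boundary_LC:
  assumes r: "0 \<le> r" and E: "0 < R5" "0 < L2" and x: "regular x" "x \<noteq> 0" "\<not> regular_int x"
  shows "good (\<lambda>s. radd (Some r) (rpar (val (Resistor R5 \<^bold>+ Inductor L2) s) (biq x s)))"
    (is "good (\<lambda>s. radd _ (rpar (val ?E s) _))")
proof -
  have WLE: "WL (val ?E)" using E by (intro WL_val) auto
  from x(1,2) show ?thesis
  proof (cases rule: regular_cases)
    case WL
    then show ?thesis using WLE r by (intro good_TLL WL_WL_parallel)
  next
    case WC
    then show ?thesis using WLE r by (intro good_TLC WL_WC_parallel)
  next
    case (net N R1 R2 G3 C1 L1)
    note val = net(8)[symmetric]
    from net(1) x(3) net(7) consider "N = net6" "R1 = 0" | "N = net6" "G3 = 0" | "N = net7" "R1 = 0" | "N = net7" "G3 = 0"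
      | "N = net8" "R1 = 0" | "N = net8" "G3 = 0" | "N = net9" "R1 = 0" | "N = net9" "G3 = 0" by blast
    then show ?thesis
    proof cases
      case 1
      let ?w = "val (Resistor R2 \<^bold>+ (Conductor G3 \<parallel> Capacitor C1))"
      have "WC ?w" using net by (intro WC_val) auto
      then have "good (\<lambda>s. radd (Some r) (rpar (val (Inductor L1) s) (rpar (val ?E s) (?w s))))"
        using r net WLE by (intro good_inductor WL_WC_parallel)
      then show ?thesis by (rule good_cong) (simp add: val 1 net6_def rpar_left_commute)
    next
      case 2
      have "net10 R1 R2 0 r R5 C1 L1 L2 \<in> nets3"
        using net r E less_imp_le[OF E(1)] unfolding nets3_def \<N>17_def by blast
      then show ?thesis by (rule good_network) (simp add: val 2 net10_def net6_def)
    next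
      case 3
      let ?w = "val (Resistor R2 \<^bold>+ (Conductor G3 \<parallel> Inductor L1))"
      have "WL ?w" using net by (intro WL_val) auto
      then have "good (\<lambda>s. radd (Some r) (rpar (val (Capacitor C1) s) (rpar (val ?E s) (?w s))))"
        using r net WLE by (intro good_capacitor WL_WL_parallel)
      then show ?thesis by (rule good_cong) (simp add: val 3 net7_def rpar_left_commute)
    next
      case 4
      have "net11 R1 R2 0 r R5 C1 L1 L2 \<in> nets3"
        using net r E less_imp_le[OF E(1)] unfolding nets3_def \<N>20_def by blast
      then show ?thesis by (rule good_network) (simp add: val 4 net11_def net7_def)
    next
      case 5
      have "net12 0 R2 G3 r R5 C1 L1 L2 \<in> nets3"
        using net r E less_imp_le[OF E(1)] unfolding nets3_def \<N>22_def by blast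
      then show ?thesis by (rule good_network) (simp add: val 5 net12_def net8_def)
    next
      case 6
      have "net12 R1 R2 0 r R5 C1 L1 L2 \<in> nets3"
        using net r E less_imp_le[OF E(1)] unfolding nets3_def \<N>23_def by blast
      then show ?thesis by (rule good_network) (simp add: val 6 net12_def net8_def)
    next
      case 7
      have "net13 0 R2 G3 r R5 C1 L1 L2 \<in> nets3"
        using net r E less_imp_le[OF E(1)] unfolding nets3_def \<N>25_def by blast
      then show ?thesis by (rule good_network) (simp add: val 7 net13_def net9_def)
    next
      case 8
      have "net13 R1 R2 0 r R5 C1 L1 L2 \<in> nets3"
        using net r E less_imp_le[OF E(1)] unfolding nets3_def \<N>26_def by blast
      then show ?thesis by (rule good_network) (simp add: val 8 net13_def net9_def)
    qed
  qed
qed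

text \<open>With R1 = 0 the inductor L2 is the new branch, and the old RC branch in parallel with
  the RL rest is a regular biquadratic, so \<open>good_inductor\<close> takes over.\<close>

lemma good_boundary_LL:
  assumes r: "0 \<le> r" and E: "0 < R5" "0 < C1" and x: "rl x" "x \<noteq> 0" "\<not> rl_int x"
  shows "good (\<lambda>s. radd (Some r) (rpar (val (Resistor R5 \<^bold>+ Capacitor C1) s) (biq x s)))"
    (is "good (\<lambda>s. radd _ (rpar (val ?E s) _))")
proof -
  have WCE: "WC (val ?E)" using E by (intro WC_val) auto
  from x(1,2) show ?thesis
  proof (cases rule: rl_cases)
    case WL
    then show ?thesis using WCE r by (intro good_TLC WC_WL_parallel)
  next
    case (net R1 R2 G3 L1 L2)
    note val = net(7)[symmetric]
    show ?thesis
    proof (cases "R1 = 0")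
      case True
      let ?w = "val (Resistor R2 \<^bold>+ (Conductor G3 \<parallel> Inductor L1))"
      have "WL ?w" using net by (intro WL_val) auto
      then have "good (\<lambda>s. radd (Some r) (rpar (val (Inductor L2) s) (rpar (val ?E s) (?w s))))"
        using r net WCE by (intro good_inductor WC_WL_parallel)
      then show ?thesis by (rule good_cong) (simp add: val True net5_def rpar_left_commute)
    next
      case False
      then have "G3 = 0" using net x by auto
      have "net14 R1 R2 0 r R5 C1 L1 L2 \<in> nets3"
        using net r E less_imp_le[OF E(1)] unfolding nets3_def \<N>29_def by blast
      then show ?thesis by (rule good_network) (simp add: val \<open>G3 = 0\<close> net14_def net5_def)
    qed
  qed
qed

text \<open>Constant functions are set apart because the compactness argument needs a nonconstant z;
  being nonnegative, they are resistors.\<close>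

lemma PX_extremal:
  assumes X: "closed X" "branch_class X" "\<And>k x. 0 < k \<Longrightarrow> x \<in> X \<Longrightarrow> k *\<^sub>R x \<in> X"
    and I: "open I" "I \<subseteq> X" "\<And>x. x \<in> I \<Longrightarrow> coeffs_pos x" "\<And>k x. 0 < k \<Longrightarrow> x \<in> I \<Longrightarrow> k *\<^sub>R x \<in> I"
    and "PX X v" and v: "\<And>s. s > 0 \<Longrightarrow> v s = Some (z s)"
  obtains (const) "Res v"
  | (form) r e0 e1 f x where "0 \<le> r" "0 \<le> e0" "0 \<le> e1" "0 \<le> f" "0 < e0 + e1 + f" "x \<in> X" "x \<noteq> 0"
      "\<And>s. s > 0 \<Longrightarrow> v s = radd (Some r) (rpar (ratio (e0 + e1 * s) f) (biq x s))"
      "f = 0 \<or> f > 0 \<and> e1 = 0 \<or> f > 0 \<and> e1 > 0 \<and> e0 = 0 \<or> f > 0 \<and> e1 > 0 \<and> e0 > 0 \<and> x \<notin> I"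
proof -
  have nn: "nonneg x" if "x \<in> X" for x using X(2) that by (simp add: branch_class_def)
  obtain r e0 e1 f w where P: "0 \<le> r" "0 \<le> e0" "0 \<le> e1" "0 \<le> f" "0 < e0 + e1 + f" "biqs X w"
    "\<forall>s>0. v s = radd (Some r) (rpar (ratio (e0 + e1 * s) f) (w s))"
    using assms(8) unfolding PX_def by blast
  show thesis
  proof (cases "\<exists>c. \<forall>s>0. z s = c")
    case True
    then obtain c where c: "\<forall>s>0. z s = c" by blast
    have "0 \<le> c"
    proof -
      have "Some c = radd (Some r) (rpar (ratio (e0 + e1 * 1) f) (w 1))"
        using P(7) v[of 1] c by (metis zero_less_one)
      moreover have "0 \<le> y" if "rpar (ratio (e0 + e1 * 1) f) (w 1) = Some y" for y
        using that by (rule rpar_nonneg)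
          (use P biqs_nonneg[OF X(2) P(6), of 1] in \<open>auto simp: ratio_def split: if_splits\<close>)
      ultimately show ?thesis using P(1) by (cases "rpar (ratio (e0 + e1 * 1) f) (w 1)") auto
    qed
    then show thesis using v c by (intro const Res_Some[of c]) auto
  next
    case False
    obtain x where x: "x \<in> X" "x \<noteq> 0" "\<forall>s>0. w s = biq x s"
      using P(6) unfolding biqs_def by blast
    show thesis
    proof (rule extremal_form[of X I z r e0 e1 f x])
      show "Some (z s) = radd (Some r) (rpar (ratio (e0 + e1 * s) f) (biq x s))" if "s > 0" for s
        using P(7) v[OF that] x(3) that by simp
    next
      fix r e0 e1 f x
      assume Q: "0 \<le> r" "0 \<le> e0" "0 \<le> e1" "0 \<le> f" "0 < e0 + e1 + f" "x \<in> X" "x \<noteq> 0"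
        and zs: "\<And>s. s > 0 \<Longrightarrow> Some (z s) = radd (Some r) (rpar (ratio (e0 + e1 * s) f) (biq x s))"
        and "e0 = 0 \<or> e1 = 0 \<or> f = 0 \<or> x \<notin> I"
      then have "f = 0 \<or> f > 0 \<and> e1 = 0 \<or> f > 0 \<and> e1 > 0 \<and> e0 = 0 \<or> f > 0 \<and> e1 > 0 \<and> e0 > 0 \<and> x \<notin> I"
        by linarith
      moreover have "v s = radd (Some r) (rpar (ratio (e0 + e1 * s) f) (biq x s))" if "s > 0" for s
        using zs[OF that] v[OF that] by simp
      ultimately show thesis by (rule form[OF Q, rotated])
    qed (use X nn I False P(1-5) x(1,2) in auto)
  qed
qed

lemma PL_good:
  assumes "PL v" and v: "\<And>s. s > 0 \<Longrightarrow> v s = Some (z s)"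
  shows "good v"
proof (rule PX_extremal[OF closed_regular branch_class_regular _ open_regular_int _ _ _ _ v])
  show "PX {x. regular x} v" using assms(1) by (simp add: PL_def)
  show "coeffs_pos y" if "y \<in> {x. regular_int x}" for y using that by (simp add: regular_int_def)
  show "{x. regular_int x} \<subseteq> {x. regular x}" using regular_int_regular by blast
next
  assume "Res v"
  then show ?thesis by (simp add: good_def Res_TLC)
next
  fix r e0 e1 f x
  assume Q: "0 \<le> r" "0 \<le> e0" "0 \<le> e1" "0 \<le> f" "0 < e0 + e1 + f" "x \<in> {x. regular x}" "x \<noteq> 0"
    and vs: "\<And>s. s > 0 \<Longrightarrow> v s = radd (Some r) (rpar (ratio (e0 + e1 * s) f) (biq x s))"
    and cs: "f = 0 \<or> f > 0 \<and> e1 = 0 \<or> f > 0 \<and> e1 > 0 \<and> e0 = 0 \<or> f > 0 \<and> e1 > 0 \<and> e0 > 0 \<and> x \<notin> {x. regular_int x}"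
  have x: "regular x" using Q by simp
  then have TLCx: "TLC (biq x)" using Q unfolding TLC_def by blast
  from cs have "good (\<lambda>s. radd (Some r) (rpar (ratio (e0 + e1 * s) f) (biq x s)))"
  proof (elim disjE)
    assume "f = 0"
    then show ?thesis using good_TLC[OF TLCx Q(1)] by simp
  next
    assume "f > 0 \<and> e1 = 0"
    then have "Res (\<lambda>s. ratio (e0 + e1 * s) f)" using Q by (intro Res_Some[of "e0 / f"]) (auto simp: ratio_def)
    then show ?thesis by (intro good_TLC TLC_Res_parallel TLCx Q)
  next
    assume 3: "f > 0 \<and> e1 > 0 \<and> e0 = 0"
    then have "good (\<lambda>s. radd (Some r) (rpar (val (Inductor (e1 / f)) s) (biq x s)))"
      by (intro good_inductor TLCx Q) simp
    then show ?thesis by (rule good_cong) (use 3 in \<open>simp add: ratio_def\<close>)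
  next
    assume 4: "f > 0 \<and> e1 > 0 \<and> e0 > 0 \<and> x \<notin> {x. regular_int x}"
    then have "good (\<lambda>s. radd (Some r) (rpar (val (Resistor (e0 / f) \<^bold>+ Inductor (e1 / f)) s) (biq x s)))"
      by (intro good_boundary_LC Q x) simp_all
    then show ?thesis by (rule good_cong) (use 4 in \<open>simp add: ratio_def add_divide_distrib\<close>)
  qed
  then show ?thesis by (rule good_cong) (rule vs)
qed (simp_all add: regular_scaleR)

lemma PC_good:
  assumes "PC v" and v: "\<And>s. s > 0 \<Longrightarrow> v s = Some (z s)"
  shows "good v"
proof (rule PX_extremal[OF _ branch_class_rl, where v = "\<lambda>s. v (1 / s)" and z = "\<lambda>s. z (1 / s)" and I = "{x. rl_int (bflip x)}"])
  show "PX {x. rl (bflip x)} (\<lambda>s. v (1 / s))" using assms(1) by (simp add: PC_def)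
  show "closed {x. rl (bflip x)}"
    using closed_vimage[OF closed_rl continuous_bflip_bswap(1)] by (simp add: vimage_def)
  show "open {x. rl_int (bflip x)}"
    using open_vimage[OF open_rl_int continuous_bflip_bswap(1)] by (simp add: vimage_def)
  show "coeffs_pos y" if "y \<in> {x. rl_int (bflip x)}" for y
    using that rl_int_minors[of "bflip y"] by simp
  show "{x. rl_int (bflip x)} \<subseteq> {x. rl (bflip x)}" using rl_int_rl by blast
  show "v (1 / s) = Some (z (1 / s))" if "s > 0" for s using v that by simp
next
  assume "Res (\<lambda>s. v (1 / s))"
  from Res_flip[OF this] show ?thesis by (simp add: good_def Res_TLC)
next
  fix r e0 e1 f y
  assume Q: "0 \<le> r" "0 \<le> e0" "0 \<le> e1" "0 \<le> f" "0 < e0 + e1 + f" "y \<in> {x. rl (bflip x)}" "y \<noteq> 0"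
    and vs: "\<And>s. s > 0 \<Longrightarrow> v (1 / s) = radd (Some r) (rpar (ratio (e0 + e1 * s) f) (biq y s))"
    and cs: "f = 0 \<or> f > 0 \<and> e1 = 0 \<or> f > 0 \<and> e1 > 0 \<and> e0 = 0 \<or> f > 0 \<and> e1 > 0 \<and> e0 > 0 \<and> y \<notin> {x. rl_int (bflip x)}"
  define x where "x = bflip y"
  have x: "rl x" "x \<noteq> 0" using Q by (simp_all add: x_def)
  then have TLLx: "TLL (biq x)" unfolding TLL_def by blast
  \<comment> \<open>Back from 1 / s to s, the branch is a resistor e0 / f in series with a capacitor
    f / e1.\<close>
  have vs': "v s = radd (Some r) (rpar (ratio (e0 * s + e1) (f * s)) (biq x s))" if s: "s > 0" for s
    using vs[of "1 / s"] s ratio_scale[of s "e0 + e1 * (1 / s)" f] biq_flip[OF s, of y]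
    by (simp add: x_def algebra_simps)
  from cs have "good (\<lambda>s. radd (Some r) (rpar (ratio (e0 * s + e1) (f * s)) (biq x s)))"
  proof (elim disjE)
    assume "f = 0"
    then show ?thesis using good_TLL[OF TLLx Q(1)] by simp
  next
    assume "f > 0 \<and> e1 = 0"
    then have "Res (\<lambda>s. ratio (e0 * s + e1) (f * s))" using Q by (intro Res_Some[of "e0 / f"]) (auto simp: ratio_def)
    then show ?thesis by (intro good_TLL TLL_Res_parallel TLLx Q)
  next
    assume 3: "f > 0 \<and> e1 > 0 \<and> e0 = 0"
    then have "good (\<lambda>s. radd (Some r) (rpar (val (Capacitor (f / e1)) s) (biq x s)))"
      by (intro good_capacitor TLLx Q) simp
    then show ?thesis by (rule good_cong) (use 3 in \<open>simp add: ratio_def rinv_def\<close>)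
  next
    assume 4: "f > 0 \<and> e1 > 0 \<and> e0 > 0 \<and> y \<notin> {x. rl_int (bflip x)}"
    then have "good (\<lambda>s. radd (Some r) (rpar (val (Resistor (e0 / f) \<^bold>+ Capacitor (f / e1)) s) (biq x s)))"
      by (intro good_boundary_LL Q x) (simp_all add: x_def)
    then show ?thesis by (rule good_cong) (use 4 in \<open>simp add: ratio_def rinv_def add_divide_distrib\<close>)
  qed
  then show ?thesis by (rule good_cong) (rule vs')
qed (simp_all add: flip_swap_scaleR rl_scaleR)

section \<open>Networks with at most two storage elements; realization of every impedance\<close>

definition nets012 :: "network set" where
  "nets012 = \<N>1 \<union> \<N>2 \<union> \<N>3 \<union> \<N>5 \<union> \<N>6 \<union> \<N>7 \<union> \<N>8 \<union> \<N>9"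

lemma WL_realized:
  assumes "WL v" and v: "\<And>s. s > 0 \<Longrightarrow> v s = Some (z s)"
  shows "\<exists>N\<in>nets012. \<forall>s>0. val N s = v s"
  using assms(1) unfolding WL_def
proof (elim disjE exE conjE)
  assume "Res v"
  then show ?thesis
  proof (cases rule: Res_cases)
    case 1 then show ?thesis using v[of 1] by simp
  next
    case (2 r)
    then have "Resistor r \<in> nets012" by (auto simp: nets012_def \<N>1_def)
    then show ?thesis using 2 by (intro bexI[of _ "Resistor r"]) auto
  qed
next
  fix r l g :: real assume *: "0 \<le> r" "0 < l" "0 \<le> g" "\<forall>s>0. v s = Some (r + l * s / (1 + g * s))"
  let ?N = "Resistor r \<^bold>+ (Conductor (g / l) \<parallel> Inductor l)"
  have "?N \<in> \<N>3" using * by (auto simp: \<N>3_def)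
  moreover have "val ?N s = v s" if s: "s > 0" for s
  proof -
    have "rinv (Some (1 / (l * s))) = Some (l * s)" using s * by (simp add: rinv_def)
    then have "rpar (rinv (Some (g / l))) (Some (l * s)) = Some (1 / (g / l + 1 / (l * s)))"
      using val_shunt[of "g / l" "1 / (l * s)"] s * by simp
    also have "1 / (g / l + 1 / (l * s)) = l * s / (1 + g * s)"
    proof -
      have "g / l + 1 / (l * s) = (1 + g * s) / (l * s)" using s * by (simp add: field_simps)
      then show ?thesis by simp
    qed
    finally show ?thesis using * s by simp
  qed
  ultimately show ?thesis unfolding nets012_def by blast
qed

lemma val_N2:
  assumes "0 < c" "0 \<le> g" "0 < s"
  shows "val (Resistor r \<^bold>+ (Conductor (g / c) \<parallel> Capacitor (1 / c))) s = Some (r + c / (g + s))"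
proof -
  have "rpar (rinv (Some (g / c))) (rinv (Some (1 / c * s))) = Some (1 / (g / c + 1 / c * s))"
    using val_shunt[of "g / c" "1 / c * s"] assms by simp
  also have "1 / (g / c + 1 / c * s) = c / (g + s)" by (simp add: add_divide_distrib[symmetric])
  finally show ?thesis by simp
qed

lemma WC_realized:
  assumes "WC v" and v: "\<And>s. s > 0 \<Longrightarrow> v s = Some (z s)"
  shows "\<exists>N\<in>nets012. \<forall>s>0. val N s = v s"
  using assms(1) unfolding WC_def
proof (elim disjE exE conjE)
  assume "Res v"
  then show ?thesis using WL_realized[of v z, OF Res_WL v] by blast
next
  fix r c g :: real assume *: "0 \<le> r" "0 < c" "0 \<le> g" "\<forall>s>0. v s = Some (r + c / (g + s))"
  let ?N = "Resistor r \<^bold>+ (Conductor (g / c) \<parallel> Capacitor (1 / c))"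
  have "?N \<in> \<N>2" using * by (auto simp: \<N>2_def)
  moreover have "\<forall>s>0. val ?N s = v s" using val_N2 * by metis
  ultimately show ?thesis unfolding nets012_def by blast
qed

lemma TLC_realized:
  assumes "TLC v" and v: "\<And>s. s > 0 \<Longrightarrow> v s = Some (z s)"
  shows "\<exists>N\<in>nets012. \<forall>s>0. val N s = v s"
proof -
  obtain x where x: "regular x" "x \<noteq> 0" and vx: "\<And>s. s > 0 \<Longrightarrow> v s = biq x s"
    using assms(1) unfolding TLC_def by blast
  from x show ?thesis
  proof (cases rule: regular_cases)
    case WL
    show ?thesis by (rule WL_realized[OF WL_cong[OF WL] v]) (simp_all add: vx)
  next
    case WC
    show ?thesis by (rule WC_realized[OF WC_cong[OF WC] v]) (simp_all add: vx)
  next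
    case (net N R1 R2 G3 C1 L1)
    have "N R1 R2 G3 C1 L1 \<in> \<N>6 \<union> \<N>7 \<union> \<N>8 \<union> \<N>9"
      using net(1-6) unfolding \<N>6_def \<N>7_def \<N>8_def \<N>9_def net6_def[abs_def] net7_def[abs_def] net8_def[abs_def] net9_def[abs_def]
      by (elim insertE) auto
    then show ?thesis using net(8) vx unfolding nets012_def by (intro bexI[of _ "N R1 R2 G3 C1 L1"]) auto
  qed
qed

lemma TLL_realized:
  assumes "TLL v" and v: "\<And>s. s > 0 \<Longrightarrow> v s = Some (z s)"
  shows "\<exists>N\<in>nets012. \<forall>s>0. val N s = v s"
proof -
  obtain x where x: "rl x" "x \<noteq> 0" and vx: "\<And>s. s > 0 \<Longrightarrow> v s = biq x s"
    using assms(1) unfolding TLL_def by blast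
  from x show ?thesis
  proof (cases rule: rl_cases)
    case WL
    show ?thesis by (rule WL_realized[OF WL_cong[OF WL] v]) (simp_all add: vx)
  next
    case (net R1 R2 G3 L1 L2)
    have "net5 R1 R2 G3 L1 L2 \<in> \<N>5" using net(1-5) unfolding \<N>5_def net5_def by blast
    then show ?thesis using net(7) vx unfolding nets012_def by (intro bexI[of _ "net5 R1 R2 G3 L1 L2"]) auto
  qed
qed

lemma sp_nets012: "N \<in> nets012 \<Longrightarrow> sp_network N"
  unfolding nets012_def \<N>1_def \<N>2_def \<N>3_def \<N>5_def \<N>6_def \<N>7_def \<N>8_def \<N>9_def by auto

lemma sp_nets3: "N \<in> nets3 \<Longrightarrow> sp_network N"
  unfolding nets3_def \<N>17_def \<N>18_def \<N>20_def \<N>21_def \<N>22_def \<N>23_def \<N>24_def \<N>25_def \<N>26_def \<N>27_def \<N>29_def \<N>30_def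
    net10_def net11_def net12_def net13_def net14_def by auto

lemma good_realized:
  assumes "good v" and v: "\<And>s. s > 0 \<Longrightarrow> v s = Some (z s)"
  shows "\<exists>N\<in>nets012 \<union> nets3. \<forall>s>0. val N s = v s"
  using assms(1) TLC_realized[of v z, OF _ v] TLL_realized[of v z, OF _ v] unfolding good_def by blast

text \<open>By invariance of \<open>TLC\<close> and \<open>TLL\<close> under \<open>pd\<close>, only
  the networks with three storage elements have to be transformed by p.\<close>

lemma good_pd_realized:
  assumes "good (pd v)" and v: "\<And>s. s > 0 \<Longrightarrow> v s = Some (z s)"
  shows "\<exists>M\<in>nets012 \<union> trans_p ` nets3. \<forall>s>0. val M s = v s"
proof -
  from assms(1) consider "TLC (pd v)" | "TLL (pd v)" | N where "N \<in> nets3" "\<forall>s>0. val N s = pd v s"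
    unfolding good_def by blast
  then show ?thesis
  proof cases
    case 1
    then have "TLC v" using TLC_pd[of "pd v"] by (simp add: pd_pd)
    then show ?thesis using TLC_realized[of v z, OF _ v] by blast
  next
    case 2
    then have "TLL v" using TLL_pd[of "pd v"] by (simp add: pd_pd)
    then show ?thesis using TLL_realized[of v z, OF _ v] by blast
  next
    case (3 N)
    have "val (trans_p N) s = v s" if s: "s > 0" for s
      using val_trans_p[OF sp_nets3[OF 3(1)] s] 3(2) s by (simp add: pd_def)
    then show ?thesis using 3(1) by blast
  qed
qed

lemma network_realized:
  assumes N: "sp_network N" "num_capacitors N \<le> 1" "num_inductors N \<le> 2" and Z: "impedance N = Some Z"
  shows "\<exists>M\<in>nets012 \<union> nets3 \<union> trans_p ` nets3. sp_network M \<and> (\<forall>s>0. val M s = val N s)"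
proof -
  obtain p q where pq: "p = 0 \<or> (\<forall>s>0. 0 < poly p s)" "\<forall>s>0. 0 < poly q s"
    "\<forall>s>0. val N s = Some (poly p s / poly q s)"
    using represents_val[OF N(1)] Z by (auto simp: represents_def)
  define z where "z s = poly p s / poly q s" for s
  have z: "val N s = Some (z s)" if "s > 0" for s using pq(3) that by (simp add: z_def)
  have sp: "sp_network M" if "M \<in> nets012 \<union> nets3 \<union> trans_p ` nets3" for M
    using that sp_nets012 sp_nets3 sp_trans_p by blast
  have fin: "\<exists>M\<in>nets012 \<union> nets3 \<union> trans_p ` nets3. \<forall>s>0. val M s = val N s" if "good (val N)"
    using good_realized[OF that z] by blast
  have fin_pd: "\<exists>M\<in>nets012 \<union> nets3 \<union> trans_p ` nets3. \<forall>s>0. val M s = val N s" if "good (pd (val N))"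
    using good_pd_realized[OF that z] by blast
  have "cls (num_capacitors N) (num_inductors N) (val N)" using N by (rule val_cls)
  then consider "TLC (val N)" | "TLL (val N)" | "TLLC (val N)"
    unfolding cls_def by (auto split: if_splits dest: Res_TLC WL_TLC WC_TLC)
  then have "\<exists>M\<in>nets012 \<union> nets3 \<union> trans_p ` nets3. \<forall>s>0. val M s = val N s"
  proof cases
    case 3
    show ?thesis
    \<comment> \<open>A short circuit is treated separately: its image under \<open>pd\<close> is an
      open circuit, which has no finite value.\<close>
    proof (cases "p = 0")
      case True
      then have "Res (val N)" using z by (intro Res_Some[of 0]) (auto simp: z_def)
      then show ?thesis using fin by (simp add: good_def Res_TLC)
    next
      case False
      then have "pd (val N) s = Some (1 / z (1 / s))" if "s > 0" for s
      proof -
        have "0 < z (1 / s)" using False pq that by (auto simp: z_def)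
        then show ?thesis using z[of "1 / s"] that by (simp add: pd_def rinv_def inverse_eq_divide)
      qed
      note pd = this
      from 3 consider "PL (val N)" | "PC (val N)" | "PL (pd (val N))" | "PC (pd (val N))" unfolding TLLC_def by blast
      then have "good (val N) \<or> good (pd (val N))"
        by cases (use PL_good[OF _ z] PC_good[OF _ z] PL_good[OF _ pd] PC_good[OF _ pd] in auto)
      then show ?thesis using fin fin_pd by metis
    qed
  qed (use fin in \<open>auto simp: good_def\<close>)
  then show ?thesis using sp by blast
qed

section \<open>Dimension of realizability sets\<close>

lemma Euclidean_space_top_of_set: "Euclidean_space n = top_of_set {f. \<forall>m\<ge>n. f m = 0}"
  by (simp add: Euclidean_space_def euclidean_product_topology)

lemma openin_open_cube: "openin (Euclidean_space d) (open_cube d)"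
proof -
  have "open (\<Inter>i\<in>{..<d}. {x :: nat \<Rightarrow> real. -1 < x i} \<inter> {x. x i < 1})"
    by (intro open_INT ballI open_Int open_Collect_less continuous_intros) simp_all
  moreover have "open_cube d = {f. \<forall>m\<ge>d. f m = 0} \<inter> (\<Inter>i\<in>{..<d}. {x. -1 < x i} \<inter> {x. x i < 1})"
    by (auto simp: open_cube_def topspace_Euclidean_space)
  ultimately show ?thesis unfolding Euclidean_space_top_of_set openin_open by blast
qed

text \<open>For d < e, invariance of domain makes the image of the e-cube open in e-dimensional
  space, although its coordinate d vanishes identically.\<close>

lemma smooth_cube_dim_le:
  assumes "contains_smooth_cube S e" and S: "\<And>x i. x \<in> S \<Longrightarrow> d \<le> i \<Longrightarrow> x i = 0"
  shows "e \<le> d"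
proof (rule ccontr)
  assume "\<not> e \<le> d"
  then have de: "d < e" by simp
  obtain F where F: "smooth_map e F" "inj_on F (open_cube e)" "F ` open_cube e \<subseteq> S"
    using assms(1) unfolding contains_smooth_cube_def by blast
  have "continuous_on (open_cube e) (\<lambda>x. F x j)" for j
  proof -
    have "C_diff e 0 (\<lambda>x. F x j)" using F(1) unfolding smooth_map_def by blast
    then show ?thesis by simp
  qed
  then have cF: "continuous_on (open_cube e) F" by (rule continuous_on_coordinatewise_then_product)
  have sub: "topspace (subtopology (Euclidean_space e) (open_cube e)) = open_cube e"
    by (auto simp: open_cube_def)
  have FS: "F x i = 0" if "x \<in> open_cube e" "d \<le> i" for x i using F(3) S that by blast
  have "continuous_map (subtopology (Euclidean_space e) (open_cube e)) (Euclidean_space e) F"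
    unfolding cm_Euclidean_space_iff_continuous_on sub
    using cF FS de by (auto simp: topspace_Euclidean_space)
  then have "openin (Euclidean_space e) (F ` open_cube e)"
    using openin_open_cube F(2) by (intro invariance_of_domain_Euclidean_space)
  then obtain V where V: "open V" "F ` open_cube e = {f. \<forall>m\<ge>e. f m = 0} \<inter> V"
    unfolding Euclidean_space_top_of_set openin_open by blast
  have 0: "(\<lambda>_. 0) \<in> open_cube e" by (auto simp: open_cube_def topspace_Euclidean_space)
  define y where "y = F (\<lambda>_. 0)"
  have y: "y \<in> V" "\<And>m. e \<le> m \<Longrightarrow> y m = 0" "y d = 0"
    using V(2) 0 FS[OF 0] by (auto simp: y_def)
  \<comment> \<open>Index d < e is a coordinate of the ambient space in which an open image would
    permit small changes.\<close>
  let ?g = "\<lambda>t. y(d := t)"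
  have "continuous_on UNIV ?g"
  proof (rule continuous_on_coordinatewise_then_product)
    show "continuous_on UNIV (\<lambda>t. (y(d := t)) i)" for i
      by (cases "i = d") (auto intro: continuous_intros)
  qed
  then have "open (?g -` V)" using V(1) by (rule open_vimage[rotated])
  moreover have "0 \<in> ?g -` V" using y(1,3) fun_upd_triv[of y d] by simp
  ultimately obtain \<eta> where \<eta>: "\<eta> > 0" "ball 0 \<eta> \<subseteq> ?g -` V" by (meson open_contains_ball)
  then have "\<eta> / 2 \<in> ball 0 \<eta>" by simp
  then have "?g (\<eta> / 2) \<in> V" using \<eta>(2) by blast
  then have "?g (\<eta> / 2) \<in> F ` open_cube e" using V(2) y(2) de by auto
  then have "?g (\<eta> / 2) d = 0" using FS by force
  then show False using \<eta>(1) by simp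
qed

lemma C_diff_affine: "C_diff d k (\<lambda>x. a + b * x j)"
proof (induction k arbitrary: a b)
  case 0
  have "continuous_on (open_cube d) (\<lambda>x :: nat \<Rightarrow> real. x j)"
    using continuous_on_product_coordinates by (rule continuous_on_subset) simp
  then show ?case by (auto intro!: continuous_intros)
next
  case (Suc k)
  have "continuous_on (open_cube d) (\<lambda>x :: nat \<Rightarrow> real. x j)"
    using continuous_on_product_coordinates by (rule continuous_on_subset) simp
  then have 1: "continuous_on (open_cube d) (\<lambda>x :: nat \<Rightarrow> real. a + b * x j)"
    by (auto intro!: continuous_intros)
  have "\<exists>g. (\<forall>x\<in>open_cube d. ((\<lambda>t. a + b * (x(i := t)) j) has_real_derivative g x) (at (x i))) \<and> C_diff d k g" for i
  proof (intro exI conjI ballI)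
    \<comment> \<open>The constant derivative is written as an affine function of slope 0 to fit the
      induction hypothesis.\<close>
    show "C_diff d k (\<lambda>x. (if i = j then b else 0) + 0 * x j)" by (rule Suc.IH)
    show "((\<lambda>t. a + b * (x(i := t)) j) has_real_derivative (if i = j then b else 0) + 0 * x j) (at (x i))" for x
      by (cases "i = j") (auto intro!: derivative_eq_intros)
  qed
  with 1 show ?case by simp
qed

lemma box_contains_smooth_cube:
  assumes "0 < \<epsilon>" and S: "\<And>c. (\<And>i. i < d \<Longrightarrow> \<bar>c i - c0 i\<bar> < \<epsilon>) \<Longrightarrow> (\<And>i. d \<le> i \<Longrightarrow> c i = 0) \<Longrightarrow> c \<in> S"
  shows "contains_smooth_cube S d"
proof -
  define F where "F = (\<lambda>x i. (if i < d then c0 i else 0) + (if i < d then \<epsilon> else 0) * x i)"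
  have "smooth_map d F" unfolding smooth_map_def F_def by (intro allI C_diff_affine)
  moreover have "inj_on F (open_cube d)"
  proof (rule inj_onI, rule ext)
    fix x y i assume xy: "x \<in> open_cube d" "y \<in> open_cube d" "F x = F y"
    then have "F x i = F y i" by simp
    then show "x i = y i"
      using xy(1,2) assms(1) by (cases "i < d") (auto simp: F_def open_cube_def topspace_Euclidean_space)
  qed
  moreover have "F ` open_cube d \<subseteq> S"
  proof (rule image_subsetI, rule S)
    fix x i assume x: "x \<in> open_cube d" and i: "i < d"
    then have "\<bar>x i\<bar> < 1" by (auto simp: open_cube_def)
    then show "\<bar>F x i - c0 i\<bar> < \<epsilon>" using assms(1) i by (simp add: F_def abs_mult)
  qed (auto simp: F_def)
  ultimately show ?thesis unfolding contains_smooth_cube_def by blast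
qed

section \<open>Neighbourhoods of coefficient vectors\<close>

definition psum :: "nat \<Rightarrow> (nat \<Rightarrow> real) \<Rightarrow> real \<Rightarrow> real" where
  "psum n c s = (\<Sum>i\<le>n. c i * s ^ i)"

definition coeff_quot :: "nat \<Rightarrow> (nat \<Rightarrow> real) \<Rightarrow> real \<Rightarrow> real" where
  "coeff_quot n c s = psum n c s / psum n (\<lambda>i. c (n + 1 + i)) s"

lemma psum_pos: "(\<And>i. i \<le> n \<Longrightarrow> 0 < c i) \<Longrightarrow> 0 < s \<Longrightarrow> 0 < psum n c s"
  unfolding psum_def by (intro sum_pos) auto

lemma psum_flip:
  assumes "s > 0" shows "s ^ n * psum n c (1 / s) = psum n (\<lambda>i. c (n - i)) s"
proof -
  have "s ^ n * psum n c (1 / s) = (\<Sum>i\<le>n. c i * s ^ (n - i))"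
    unfolding psum_def sum_distrib_left
    by (rule sum.cong) (use assms in \<open>auto simp: power_diff power_divide field_simps\<close>)
  also have "\<dots> = (\<Sum>i\<le>n. c (n - i) * s ^ i)"
    by (rule sum.reindex_bij_witness[of _ "\<lambda>i. n - i" "\<lambda>i. n - i"]) auto
  finally show ?thesis by (simp add: psum_def)
qed

text \<open>
  The coefficient vectors of the impedances in \<open>F\<close>, indexed as in \<^const>\<open>coeff_vector\<close>, fill a
  neighbourhood of a positive vector.
\<close>

definition coeff_box :: "nat \<Rightarrow> (real \<Rightarrow> real option) set \<Rightarrow> bool" where
  "coeff_box n F \<longleftrightarrow> (\<exists>c0 \<epsilon>. 0 < \<epsilon> \<and> (\<forall>i\<le>2 * n + 1. \<epsilon> < c0 i) \<and>
     (\<forall>c. (\<forall>i\<le>2 * n + 1. \<bar>c i - c0 i\<bar> < \<epsilon>) \<longrightarrow> (\<exists>v\<in>F. \<forall>s>0. v s = Some (coeff_quot n c s))))"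

lemma box_mono: "coeff_box n F \<Longrightarrow> F \<subseteq> G \<Longrightarrow> coeff_box n G"
proof -
  assume FG: "F \<subseteq> G" and "coeff_box n F"
  then obtain c0 \<epsilon> where c0: "0 < \<epsilon>" "\<forall>i\<le>2 * n + 1. \<epsilon> < c0 i"
    "\<And>c. (\<forall>i\<le>2 * n + 1. \<bar>c i - c0 i\<bar> < \<epsilon>) \<Longrightarrow> \<exists>v\<in>F. \<forall>s>0. v s = Some (coeff_quot n c s)"
    unfolding coeff_box_def by blast
  have "\<forall>c. (\<forall>i\<le>2 * n + 1. \<bar>c i - c0 i\<bar> < \<epsilon>) \<longrightarrow> (\<exists>v\<in>G. \<forall>s>0. v s = Some (coeff_quot n c s))"
    using c0(3) FG by blast
  with c0(1,2) show ?thesis unfolding coeff_box_def by blast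
qed

text \<open>If no box around c0 worked, shrinking boxes would yield a sequence of unrealized
  positive vectors converging to c0. In this sequential form the limits of
  \<open>split_tendsto\<close> apply directly.\<close>

lemma boxI:
  assumes pos: "\<And>i. i \<le> 2 * n + 1 \<Longrightarrow> 0 < c0 i"
    and lim: "\<And>C. (\<And>i. i \<le> 2 * n + 1 \<Longrightarrow> (\<lambda>k. C k i) \<longlonglongrightarrow> c0 i) \<Longrightarrow> (\<And>k i. i \<le> 2 * n + 1 \<Longrightarrow> 0 < C k i) \<Longrightarrow>
      \<exists>k. \<exists>v\<in>F. \<forall>s>0. v s = Some (coeff_quot n (C k) s)"
  shows "coeff_box n F"
proof (rule ccontr)
  assume no: "\<not> coeff_box n F"
  define m where "m = Min (c0 ` {..2 * n + 1})"
  have m: "0 < m" "\<And>i. i \<le> 2 * n + 1 \<Longrightarrow> m \<le> c0 i"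
    using pos by (auto simp: m_def)
  \<comment> \<open>The summand 2 keeps the radius strictly below m already for k = 0, so that all
    vectors in the box are positive.\<close>
  define \<epsilon> where "\<epsilon> k = m / (real k + 2)" for k
  have e: "0 < \<epsilon> k" "\<epsilon> k < m" for k
  proof -
    show "0 < \<epsilon> k" using m(1) by (simp add: \<epsilon>_def)
    have "m * 1 < m * (real k + 2)" using m(1) by (intro mult_strict_left_mono) auto
    then show "\<epsilon> k < m" by (simp add: \<epsilon>_def divide_less_eq)
  qed
  have e': "\<forall>i\<le>2 * n + 1. \<epsilon> k < c0 i" for k using e(2)[of k] m(2) by fastforce
  have "\<exists>c. (\<forall>i\<le>2 * n + 1. \<bar>c i - c0 i\<bar> < \<epsilon> k) \<and> \<not> (\<exists>v\<in>F. \<forall>s>0. v s = Some (coeff_quot n c s))" for k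
  proof (rule ccontr)
    assume "\<not> ?thesis"
    then have "\<forall>c. (\<forall>i\<le>2 * n + 1. \<bar>c i - c0 i\<bar> < \<epsilon> k) \<longrightarrow> (\<exists>v\<in>F. \<forall>s>0. v s = Some (coeff_quot n c s))"
      by blast
    then have "coeff_box n F" unfolding coeff_box_def using e(1)[of k] e'[of k]
      by (intro exI[of _ c0] exI[of _ "\<epsilon> k"] conjI)
    then show False using no by contradiction
  qed
  then obtain C where C: "\<And>k i. i \<le> 2 * n + 1 \<Longrightarrow> \<bar>C k i - c0 i\<bar> < \<epsilon> k"
    and bad: "\<And>k. \<not> (\<exists>v\<in>F. \<forall>s>0. v s = Some (coeff_quot n (C k) s))"
    by metis
  have "\<epsilon> \<longlonglongrightarrow> 0"
    unfolding \<epsilon>_def[abs_def]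
    by real_asymp
  then have "(\<lambda>k. C k i) \<longlonglongrightarrow> c0 i" if "i \<le> 2 * n + 1" for i
  proof -
    have "(\<lambda>k. C k i - c0 i) \<longlonglongrightarrow> 0"
      by (rule Lim_null_comparison[OF _ \<open>\<epsilon> \<longlonglongrightarrow> 0\<close>]) (use C[OF that] in \<open>simp add: less_imp_le\<close>)
    then show ?thesis by (rule LIM_zero_cancel)
  qed
  moreover have "0 < C k i" if "i \<le> 2 * n + 1" for k i
    using C[OF that, of k] e(2)[of k] m(2)[OF that] by linarith
  ultimately show False using lim bad by blast
qed

text \<open>An involution of the indices maps boxes to boxes; the substitution of 1 / s and
  \<open>pd\<close> both act on coefficient vectors in this way.\<close>

lemma box_permute:
  assumes "coeff_box n F" and \<sigma>: "\<And>i. i \<le> 2 * n + 1 \<Longrightarrow> \<sigma> i \<le> 2 * n + 1 \<and> \<sigma> (\<sigma> i) = i"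
    and step: "\<And>c v. (\<And>i. i \<le> 2 * n + 1 \<Longrightarrow> 0 < c i) \<Longrightarrow> v \<in> F \<Longrightarrow> (\<And>s. s > 0 \<Longrightarrow> v s = Some (coeff_quot n c s)) \<Longrightarrow>
      \<exists>w\<in>G. \<forall>s>0. w s = Some (coeff_quot n (\<lambda>i. c (\<sigma> i)) s)"
  shows "coeff_box n G"
proof -
  obtain c0 \<epsilon> where c0: "0 < \<epsilon>" "\<And>i. i \<le> 2 * n + 1 \<Longrightarrow> \<epsilon> < c0 i"
    "\<And>c. (\<forall>i\<le>2 * n + 1. \<bar>c i - c0 i\<bar> < \<epsilon>) \<Longrightarrow> \<exists>v\<in>F. \<forall>s>0. v s = Some (coeff_quot n c s)"
    using assms(1) unfolding coeff_box_def by blast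
  have "\<exists>w\<in>G. \<forall>s>0. w s = Some (coeff_quot n c s)" if c: "\<forall>i\<le>2 * n + 1. \<bar>c i - c0 (\<sigma> i)\<bar> < \<epsilon>" for c
  proof -
    define c' where "c' = (\<lambda>i. c (\<sigma> i))"
    have c': "\<forall>i\<le>2 * n + 1. \<bar>c' i - c0 i\<bar> < \<epsilon>"
      using c \<sigma> unfolding c'_def by metis
    then obtain v where v: "v \<in> F" "\<forall>s>0. v s = Some (coeff_quot n c' s)" using c0(3) by blast
    have "0 < c' i" if "i \<le> 2 * n + 1" for i
      using c'[rule_format, OF that] c0(2)[OF that] by linarith
    then obtain w where w: "w \<in> G" "\<forall>s>0. w s = Some (coeff_quot n (\<lambda>i. c' (\<sigma> i)) s)"
      using step[of c' v] v by blast
    have "coeff_quot n (\<lambda>i. c' (\<sigma> i)) s = coeff_quot n c s" for s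
      using \<sigma> unfolding coeff_quot_def psum_def c'_def by simp
    then show ?thesis using w by auto
  qed
  then show ?thesis unfolding coeff_box_def using c0(1,2) \<sigma>
    by (intro exI[of _ "\<lambda>i. c0 (\<sigma> i)"] exI[of _ \<epsilon>]) auto
qed

text \<open>Each half of the vector is reversed: n + 1 + j goes to 2 n + 1 - j, which is 3 n + 2
  minus the index.\<close>

lemma coeff_quot_flip:
  assumes "s > 0"
  shows "coeff_quot n c (1 / s) = coeff_quot n (\<lambda>i. c (if i \<le> n then n - i else 3 * n + 2 - i)) s"
proof -
  have "coeff_quot n c (1 / s) = (s ^ n * psum n c (1 / s)) / (s ^ n * psum n (\<lambda>i. c (n + 1 + i)) (1 / s))"
    using assms by (simp add: coeff_quot_def)
  also have "\<dots> = psum n (\<lambda>i. c (n - i)) s / psum n (\<lambda>i. c (n + 1 + (n - i))) s"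
    unfolding psum_flip[OF assms] by simp
  also have "\<dots> = coeff_quot n (\<lambda>i. c (if i \<le> n then n - i else 3 * n + 2 - i)) s"
  proof -
    have "psum n (\<lambda>i. c (n - i)) s = psum n (\<lambda>i. c (if i \<le> n then n - i else 3 * n + 2 - i)) s"
      unfolding psum_def by (rule sum.cong) auto
    moreover have "psum n (\<lambda>i. c (n + 1 + (n - i))) s =
        psum n (\<lambda>i. c (if n + 1 + i \<le> n then n - (n + 1 + i) else 3 * n + 2 - (n + 1 + i))) s"
      unfolding psum_def by (rule sum.cong) (auto intro!: arg_cong[of _ _ c])
    ultimately show ?thesis unfolding coeff_quot_def by simp
  qed
  finally show ?thesis .
qed

lemma box_flip:
  assumes "coeff_box n F" and G: "\<And>v. v \<in> F \<Longrightarrow> \<exists>w\<in>G. \<forall>s>0. w s = v (1 / s)"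
  shows "coeff_box n G"
proof (rule box_permute[OF assms(1), where \<sigma> = "\<lambda>i. if i \<le> n then n - i else 3 * n + 2 - i"])
  fix c v assume "v \<in> F" and v: "\<And>s. s > 0 \<Longrightarrow> v s = Some (coeff_quot n c s)"
  then obtain w where w: "w \<in> G" "\<forall>s>0. w s = v (1 / s)" using G by blast
  then show "\<exists>w\<in>G. \<forall>s>0. w s = Some (coeff_quot n (\<lambda>i. c (if i \<le> n then n - i else 3 * n + 2 - i)) s)"
    using v by (intro bexI[of _ w]) (auto simp: coeff_quot_flip)
qed auto

text \<open>Substituting 1 / s reverses each half of the vector and the reciprocal exchanges the
  halves; together this reverses the whole vector.\<close>

lemma box_pd:
  assumes "coeff_box n F" and G: "\<And>v. v \<in> F \<Longrightarrow> \<exists>w\<in>G. \<forall>s>0. w s = pd v s"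
  shows "coeff_box n G"
proof (rule box_permute[OF assms(1), where \<sigma> = "\<lambda>i. 2 * n + 1 - i"])
  fix c v assume c: "\<And>i. i \<le> 2 * n + 1 \<Longrightarrow> 0 < c i" and "v \<in> F" and v: "\<And>s. s > 0 \<Longrightarrow> v s = Some (coeff_quot n c s)"
  then obtain w where w: "w \<in> G" "\<forall>s>0. w s = pd v s" using G by blast
  have "w s = Some (coeff_quot n (\<lambda>i. c (2 * n + 1 - i)) s)" if s: "s > 0" for s
  proof -
    have p: "0 < psum n c (1 / s)" "0 < psum n (\<lambda>i. c (n + 1 + i)) (1 / s)"
      using s c by (auto intro!: psum_pos)
    have "w s = rinv (Some (coeff_quot n c (1 / s)))" using w(2) v s by (simp add: pd_def)
    also have "\<dots> = Some (psum n (\<lambda>i. c (n + 1 + i)) (1 / s) / psum n c (1 / s))"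
      using p by (auto simp: coeff_quot_def rinv_def)
    also have "psum n (\<lambda>i. c (n + 1 + i)) (1 / s) / psum n c (1 / s) =
        (s ^ n * psum n (\<lambda>i. c (n + 1 + i)) (1 / s)) / (s ^ n * psum n c (1 / s))"
      using s by simp
    also have "\<dots> = psum n (\<lambda>i. c (n + 1 + (n - i))) s / psum n (\<lambda>i. c (n - i)) s"
      unfolding psum_flip[OF s] by simp
    also have "\<dots> = coeff_quot n (\<lambda>i. c (2 * n + 1 - i)) s"
    proof -
      have "psum n (\<lambda>i. c (n + 1 + (n - i))) s = psum n (\<lambda>i. c (2 * n + 1 - i)) s"
        "psum n (\<lambda>i. c (n - i)) s = psum n (\<lambda>i. c (2 * n + 1 - (n + 1 + i))) s"
        unfolding psum_def by (rule sum.cong; auto intro!: arg_cong[of _ _ c])+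
      then show ?thesis unfolding coeff_quot_def by simp
    qed
    finally show ?thesis .
  qed
  then show "\<exists>w\<in>G. \<forall>s>0. w s = Some (coeff_quot n (\<lambda>i. c (2 * n + 1 - i)) s)" using w(1) by blast
qed auto

text \<open>Coefficient vectors are not normalized, so multiples of one pair (p, q) are different
  points and the box has dimension 2 n + 2. It cannot be exceeded because all further coordinates
  vanish.\<close>

lemma generic_box:
  assumes "coeff_box n (val ` \<N>)"
    and N: "\<And>N. N \<in> \<N> \<Longrightarrow> sp_network N \<and> num_storage N = n \<and> num_elements N < 2 * n + 2"
  shows "generic \<N>"
  unfolding generic_def
proof (intro exI conjI)
  show "\<forall>N\<in>\<N>. num_storage N = n" "\<forall>N\<in>\<N>. num_elements N < 2 * n + 2" using N by auto
  let ?S = "realizability_set n \<N>"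
  have "contains_smooth_cube ?S (2 * n + 2)"
  proof -
    obtain c0 \<epsilon> where c0: "0 < \<epsilon>" "\<And>i. i \<le> 2 * n + 1 \<Longrightarrow> \<epsilon> < c0 i"
      "\<And>c. (\<forall>i\<le>2 * n + 1. \<bar>c i - c0 i\<bar> < \<epsilon>) \<Longrightarrow> \<exists>v\<in>val ` \<N>. \<forall>s>0. v s = Some (coeff_quot n c s)"
      using assms(1) unfolding coeff_box_def by blast
    show ?thesis
    proof (rule box_contains_smooth_cube[OF c0(1), of _ c0])
      fix c assume c: "\<And>i. i < 2 * n + 2 \<Longrightarrow> \<bar>c i - c0 i\<bar> < \<epsilon>" and c_zero: "\<And>i. 2 * n + 2 \<le> i \<Longrightarrow> c i = 0"
      obtain N where NN: "N \<in> \<N>" "\<And>s. s > 0 \<Longrightarrow> val N s = Some (coeff_quot n c s)"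
        using c0(3)[of c] c by auto
      have pos: "0 < c i" if "i \<le> 2 * n + 1" for i
        using c[of i] c0(2)[OF that] that by (smt (verit) add.commute add_2_eq_Suc' le_imp_less_Suc Suc_eq_plus1)
      define P where "P a = (\<Sum>i\<le>n. Polynomial.monom (a i) i)" for a :: "nat \<Rightarrow> real"
      have poly_P: "poly (P a) s = psum n a s" for a s
        by (simp add: P_def psum_def poly_sum poly_monom)
      have coeff_P: "Polynomial.coeff (P a) i = (if i \<le> n then a i else 0)" for a i
        by (simp add: P_def coeff_sum sum.delta)
      have deg_P: "Polynomial.degree (P a) \<le> n" for a
        by (rule degree_le) (simp add: coeff_P)
      define p q where "p = P c" and "q = P (\<lambda>i. c (n + 1 + i))"
      have cv: "c = coeff_vector n p q"
      proof
        fix i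
        show "c i = coeff_vector n p q i"
          using c_zero[of i] by (auto simp: coeff_vector_def p_def q_def coeff_P)
      qed
      have qpos: "poly q s > 0" if "s > 0" for s
        using that pos by (auto simp: q_def poly_P intro!: psum_pos)
      then have "impedance N = Some (Fract p q)"
        using NN N[OF NN(1)] by (intro impedance_eq_Fract) (auto simp: p_def q_def poly_P coeff_quot_def less_imp_neq[symmetric])
      moreover have "Polynomial.coeff p n \<noteq> 0" using pos[of n] by (simp add: p_def coeff_P)
      moreover have "q \<noteq> 0" using qpos[of 1] by auto
      moreover have "Polynomial.degree p \<le> n" "Polynomial.degree q \<le> n" by (simp_all add: p_def q_def deg_P)
      ultimately show "c \<in> ?S"
        unfolding realizability_set_def mem_Collect_eq using cv NN(1) by metis
    qed
  qed
  moreover have "x i = 0" if "x \<in> ?S" "2 * n + 2 \<le> i" for x i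
    using that by (auto simp: realizability_set_def coeff_vector_def)
  then have "e \<le> 2 * n + 2" if "contains_smooth_cube ?S e" for e
    using smooth_cube_dim_le[OF that] by blast
  ultimately show "has_dimension ?S (2 * n + 2)" unfolding has_dimension_def by blast
qed

section \<open>Genericity of the network classes\<close>

lemma box_biq:
  assumes U: "open U" "x0 \<in> U" "\<And>x. x \<in> U \<Longrightarrow> coeffs_pos x"
    and F: "\<And>x. x \<in> U \<Longrightarrow> \<exists>v\<in>F. \<forall>s>0. v s = biq x s"
  shows "coeff_box 2 F"
proof -
  obtain a0 a1 a2 b0 b1 b2 where x0: "x0 = (a0, a1, a2, b0, b1, b2)" by (metis prod_cases6)
  have pos: "coeffs_pos x0" using U by blast
  define c0 where "c0 = (\<lambda>i. [a0, a1, a2, b0, b1, b2] ! i)"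
  have c0: "c0 0 = a0" "c0 1 = a1" "c0 2 = a2" "c0 3 = b0" "c0 4 = b1" "c0 5 = b2"
    by (simp_all add: c0_def eval_nat_numeral)
  have i6: "i = 0 \<or> i = 1 \<or> i = 2 \<or> i = 3 \<or> i = 4 \<or> i = 5" if "i \<le> 2 * 2 + 1" for i :: nat
    using that by linarith
  show ?thesis
  proof (rule boxI[of _ c0])
    show "0 < c0 i" if "i \<le> 2 * 2 + 1" for i
      using i6[OF that] pos c0 x0 by auto
    fix C :: "nat \<Rightarrow> nat \<Rightarrow> real"
    assume lim: "\<And>i. i \<le> 2 * 2 + 1 \<Longrightarrow> (\<lambda>k. C k i) \<longlonglongrightarrow> c0 i"
    define X where "X k = (C k 0, C k 1, C k 2, C k 3, C k 4, C k 5)" for k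
    have "(\<lambda>k. C k i) \<longlonglongrightarrow> c0 i" if "i \<in> {0, 1, 2, 3, 4, 5}" for i using that lim by auto
    then have "X \<longlonglongrightarrow> x0"
      unfolding X_def[abs_def] x0 c0[symmetric] by (intro tendsto_Pair) simp_all
    then have "\<forall>\<^sub>F k in sequentially. X k \<in> U" using U(1,2) by (rule topological_tendstoD)
    then obtain k where k: "X k \<in> U" using eventually_happens trivial_limit_sequentially by blast
    then obtain v where v: "v \<in> F" "\<forall>s>0. v s = biq (X k) s" using F by blast
    have "v s = Some (coeff_quot 2 (C k) s)" if s: "s > 0" for s
    proof -
      have "0 < den (X k) s" using num_den_pos(2)[OF U(3)[OF k] s] .
      then have "v s = Some (num (X k) s / den (X k) s)" using v s by (simp add: biq_num_den ratio_def)
      also have "num (X k) s / den (X k) s = coeff_quot 2 (C k) s"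
        by (simp add: X_def coeff_quot_def psum_def numeral_2_eq_2 eval_nat_numeral)
      finally show ?thesis .
    qed
    then show "\<exists>k. \<exists>v\<in>F. \<forall>s>0. v s = Some (coeff_quot 2 (C k) s)" using v by blast
  qed
qed

lemma coeff_quot_cubic: "coeff_quot 3 c s = cubic c s / cubic (\<lambda>i. c (4 + i)) s"
  by (simp add: coeff_quot_def psum_def cubic_def numeral_3_eq_3 eval_nat_numeral)

text \<open>Splitting at t = 0 inverts the map from (r, l, x) to the coefficients of r + (l s
  \<parallel> x). By continuity, coefficients near those for r = l = 1 and x = x0 yield r > 0, c = 1
  / l > 0 and a biquadratic in U.\<close>

lemma box_inductor:
  assumes U: "open U" "x0 \<in> U" "\<And>x. x \<in> U \<Longrightarrow> coeffs_pos x"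
    and F: "\<And>x r l. x \<in> U \<Longrightarrow> 0 < r \<Longrightarrow> 0 < l \<Longrightarrow>
      \<exists>v\<in>F. \<forall>s>0. v s = radd (Some r) (rpar (Some (l * s)) (biq x s))"
  shows "coeff_box 3 F"
proof -
  obtain a0 a1 a2 b0 b1 b2 where x0: "x0 = (a0, a1, a2, b0, b1, b2)" by (metis prod_cases6)
  have pos: "0 < a0" "0 < a1" "0 < a2" "0 < b0" "0 < b1" "0 < b2" using U(3)[OF U(2)] x0 by auto
  \<comment> \<open>The coefficients of 1 + (s \<parallel> x0): with n, d the numerator and
    denominator of x0, the numerator is n + s d + s n and the denominator n + s d.\<close>
  define c0 where "c0 = (\<lambda>i. [a0, a1 + b0 + a0, a2 + b1 + a1, b2 + a2, a0, a1 + b0, a2 + b1, b2] ! i)"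
  \<comment> \<open>Cut off beyond index 3, because \<open>split_tendsto\<close> asks for
    convergence at every index.\<close>
  define p q where "p = (\<lambda>i. if i \<le> 3 then c0 i else 0)" and "q = (\<lambda>i. if i \<le> 3 then c0 (4 + i) else 0)"
  have pq: "p 0 = a0" "p 1 = a1 + b0 + a0" "p 2 = a2 + b1 + a1" "p 3 = b2 + a2"
    "q 0 = a0" "q 1 = a1 + b0" "q 2 = a2 + b1" "q 3 = b2"
    by (simp_all add: p_def q_def c0_def eval_nat_numeral)
  have "cubic q 0 = a0" "cubic p 0 = a0" by (simp_all add: cubic_def pq)
  then have q0: "cubic q 0 \<noteq> 0" and r1: "split_r p q 0 = 1" using pos by (simp_all add: split_r_def)
  have n: "split_num p q 0 0 = a0" "split_num p q 0 1 = a1" "split_num p q 0 2 = a2"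
    unfolding split_num_def Let_def r1 pq by simp_all
  have c1: "split_c p q 0 = 1" using pos by (simp add: split_c_def n \<open>cubic q 0 = a0\<close>)
  have x: "split_x p q 0 = x0"
    unfolding split_x_def split_den_def Let_def n c1 pq x0 by simp
  then have nz: "num (split_x p q 0) 0 \<noteq> 0" using pos x0 by simp
  have i8: "i = 0 \<or> i = 1 \<or> i = 2 \<or> i = 3 \<or> i = 4 \<or> i = 5 \<or> i = 6 \<or> i = 7" if "i \<le> 2 * 3 + 1" for i :: nat
    using that by linarith
  show ?thesis
  proof (rule boxI[of _ c0])
    show "0 < c0 i" if "i \<le> 2 * 3 + 1" for i
      using i8[OF that] pos by (auto simp: c0_def eval_nat_numeral add_pos_pos)
    fix C :: "nat \<Rightarrow> nat \<Rightarrow> real"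
    assume lim: "\<And>i. i \<le> 2 * 3 + 1 \<Longrightarrow> (\<lambda>k. C k i) \<longlonglongrightarrow> c0 i" and Cpos: "\<And>k i. i \<le> 2 * 3 + 1 \<Longrightarrow> 0 < C k i"
    define P Q where "P k = (\<lambda>i. if i \<le> 3 then C k i else 0)" and "Q k = (\<lambda>i. if i \<le> 3 then C k (4 + i) else 0)" for k
    have PQ: "(\<lambda>k. P k i) \<longlonglongrightarrow> p i" "(\<lambda>k. Q k i) \<longlonglongrightarrow> q i" for i
      using lim[of i] lim[of "4 + i"] by (cases "i \<le> 3"; simp add: P_def Q_def p_def q_def)+
    note tends = split_tendsto[of P p sequentially Q q "\<lambda>_. 0" 0, OF PQ tendsto_const q0]
    have "\<forall>\<^sub>F k in sequentially. split_x (P k) (Q k) 0 \<in> U"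
      using tends(3)[OF nz] U(1,2) x by (intro topological_tendstoD) auto
    moreover have "\<forall>\<^sub>F k in sequentially. 0 < split_r (P k) (Q k) 0"
      using tends(1) r1 by (intro order_tendstoD(1)[of _ 1]) auto
    moreover have "\<forall>\<^sub>F k in sequentially. 0 < split_c (P k) (Q k) 0"
      using tends(2)[OF nz] c1 by (intro order_tendstoD(1)[of _ 1]) auto
    ultimately have "\<forall>\<^sub>F k in sequentially. split_x (P k) (Q k) 0 \<in> U \<and> 0 < split_r (P k) (Q k) 0 \<and> 0 < split_c (P k) (Q k) 0"
      by eventually_elim auto
    then obtain k where k: "split_x (P k) (Q k) 0 \<in> U" "0 < split_r (P k) (Q k) 0" "0 < split_c (P k) (Q k) 0"
      using eventually_happens trivial_limit_sequentially by blast
    define y r c where "y = split_x (P k) (Q k) 0" and "r = split_r (P k) (Q k) 0" and "c = split_c (P k) (Q k) 0"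
    have y: "y \<in> U" "0 < r" "0 < 1 / c" "0 < c" using k by (auto simp: y_def r_def c_def)
    then obtain v where v: "v \<in> F" "\<forall>s>0. v s = radd (Some r) (rpar (Some (1 / c * s)) (biq y s))"
      using F by blast
    have Q0: "cubic (Q k) 0 \<noteq> 0" using Cpos[of 4 k] by (simp add: cubic_def Q_def)
    have y0: "num y 0 \<noteq> 0" using U(3)[OF y(1)] by (cases y) auto
    have s1: "cubic (P k) s - r * cubic (Q k) s = s * num y s"
      and s2: "cubic (Q k) s = c * num y s + s * den y s" for s
      using split_cubic[OF Q0, of "P k" s] y0 by (simp_all add: y_def r_def c_def)
    have cub: "cubic (C k) s = cubic (P k) s" "cubic (\<lambda>i. C k (4 + i)) s = cubic (Q k) s" for s
      by (simp_all add: cubic_def P_def Q_def)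
    have "v s = Some (coeff_quot 3 (C k) s)" if s: "s > 0" for s
    proof -
      define n d where "n = num y s" and "d = den y s"
      have nd: "0 < n" "0 < d" using num_den_pos[OF U(3)[OF y(1)] s] by (simp_all add: n_def d_def)
      define D where "D = c * n + s * d"
      have D: "0 < D" using nd y(4) s by (simp add: D_def add_pos_pos)
      have "biq y s = Some (n / d)" using nd by (simp add: biq_num_den ratio_def n_def d_def)
      then have "v s = Some (r + 1 / c * s * (n / d) / (1 / c * s + n / d))"
        using v s nd y(4) rpar_Some[of "1 / c * s" "n / d"] by simp
      also have "1 / c * s * (n / d) / (1 / c * s + n / d) = s * n / D"
      proof -
        have "1 / c * s + n / d = D / (c * d)" using nd y(4) by (simp add: D_def field_simps)
        then show ?thesis using nd y(4) by simp
      qed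
      also have "r + s * n / D = cubic (P k) s / cubic (Q k) s"
      proof -
        have "cubic (Q k) s = D" "cubic (P k) s = r * D + s * n"
          using s1[of s] s2[of s] by (simp_all add: D_def n_def d_def)
        then show ?thesis using D by (simp add: field_simps)
      qed
      finally show ?thesis by (simp add: coeff_quot_cubic cub)
    qed
    then show "\<exists>k. \<exists>v\<in>F. \<forall>s>0. v s = Some (coeff_quot 3 (C k) s)" using v by blast
  qed
qed

definition fills_open :: "(real \<Rightarrow> real \<Rightarrow> real \<Rightarrow> real \<Rightarrow> real \<Rightarrow> network) \<Rightarrow> bool" where
  "fills_open N \<longleftrightarrow> (\<exists>U x0. open U \<and> x0 \<in> U \<and> (\<forall>x\<in>U. coeffs_pos x \<and>
     net_realizes N x))"

lemma coeffs_pos_nz: "coeffs_pos x \<Longrightarrow> x \<noteq> 0"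
  by (cases x) (auto simp: zero_prod_def)

lemma biq_flip_inv: "s > 0 \<Longrightarrow> biq (bflip x) (1 / s) = biq x s"
  using biq_flip[of "1 / s" x] by simp

lemma fills_open_net6: "fills_open net6"
  unfolding fills_open_def
proof (intro exI conjI ballI)
  let ?U = "{x. coeffs_pos x \<and> 0 < bres x \<and> 0 < mA x \<and> 0 < mB x \<and>
    fst (snd (snd (snd x))) * mA x < fst (snd (snd (snd (snd x)))) * mB x}"
  show "open ?U" unfolding bres_minors
    by (intro open_Collect_conj open_coeffs_pos open_Collect_less continuous_intros)
  \<comment> \<open>Here A = 2, B = 4, D = 0, the resultant is 4, and b0 A = 4 < 8 = b1 B.\<close>
  show "(2, 4, 2, 2, 2, 1) \<in> ?U" by simp
  fix x assume x: "x \<in> ?U"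
  then show "coeffs_pos x" by simp
  obtain a0 a1 a2 b0 b1 b2 where xe: "x = (a0, a1, a2, b0, b1, b2)" by (metis prod_cases6)
  have k: "nonneg (a0, a1, a2, b0, b1, b2)" "min_at_0 (a0, a1, a2, b0, b1, b2)"
    "0 < bres (a0, a1, a2, b0, b1, b2)" "0 < a1 * b0 - a0 * b1" "regular_int x"
    using x unfolding xe by (auto simp: regular_int_def)
  show "net_realizes net6 x"
    unfolding xe
  proof (rule net6_realizes[OF k(1-4)])
    fix R1 R2 G3 C1 L1 assume N: "0 \<le> R1" "0 \<le> R2" "0 \<le> G3" "0 < C1" "0 < L1"
      "\<And>s. s > 0 \<Longrightarrow> val (net6 R1 R2 G3 C1 L1) s = biq (a0, a1, a2, b0, b1, b2) s"
    show "net_realizes net6 (a0, a1, a2, b0, b1, b2)"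
      using k(5)[unfolded xe] by (intro net_realizesI[of R1 R2 G3 C1 L1 _ net6, OF N(1-5) _ N(6)]) simp_all
  qed
qed

lemma fills_open_trans:
  assumes "fills_open net6" and g: "continuous_on UNIV g" "\<And>x. g (g x) = x" "\<And>x. coeffs_pos (g x) = coeffs_pos x"
    and t: "\<And>x. nonneg x \<Longrightarrow> x \<noteq> 0 \<Longrightarrow> net_realizes net6 (g x) \<Longrightarrow> net_realizes M x"
  shows "fills_open M"
proof -
  obtain U x0 where U: "open U" "x0 \<in> U" "\<And>x. x \<in> U \<Longrightarrow> coeffs_pos x" "\<And>x. x \<in> U \<Longrightarrow> net_realizes net6 x"
    using assms(1) unfolding fills_open_def by blast
  show ?thesis unfolding fills_open_def
  proof (intro exI conjI ballI)
    show "open (g -` U)" using U(1) g(1) by (rule open_vimage)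
    show "g x0 \<in> g -` U" using U(2) g(2) by simp
    fix x assume x: "x \<in> g -` U"
    then show c: "coeffs_pos x" using U(3)[of "g x"] g(3) by simp
    show "net_realizes M x"
      using t[OF coeffs_pos_nonneg[OF c] coeffs_pos_nz[OF c]] U(4)[of "g x"] x by simp
  qed
qed

lemma fills_open_net7: "fills_open net7"
  by (rule fills_open_trans[OF fills_open_net6 continuous_bflip_bswap(1)]) (simp_all add: net_realizes_trans)

lemma fills_open_net8: "fills_open net8"
  by (rule fills_open_trans[OF fills_open_net6 continuous_bflip_bswap(2)]) (simp_all add: net_realizes_trans)

lemma fills_open_net9: "fills_open net9"
  by (rule fills_open_trans[OF fills_open_net6, of "\<lambda>x. bflip (bswap x)"])
    (auto simp: net_realizes_trans intro: continuous_on_compose2[OF continuous_bflip_bswap])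

lemma fills_open_box2:
  assumes "fills_open N" "\<And>R1 R2 G3 C1 L1. 0 \<le> R1 \<Longrightarrow> 0 \<le> R2 \<Longrightarrow> 0 \<le> G3 \<Longrightarrow> 0 < C1 \<Longrightarrow> 0 < L1 \<Longrightarrow> N R1 R2 G3 C1 L1 \<in> \<N>"
  shows "coeff_box 2 (val ` \<N>)"
proof -
  obtain U x0 where U: "open U" "x0 \<in> U" "\<And>x. x \<in> U \<Longrightarrow> coeffs_pos x"
    "\<And>x. x \<in> U \<Longrightarrow> net_realizes N x"
    using assms(1) unfolding fills_open_def by blast
  show ?thesis
  proof (rule box_biq[OF U(1-3)])
    fix x assume "x \<in> U"
    from net_realizesE[OF U(4)[OF this]] obtain R1 R2 G3 C1 L1 where "0 \<le> R1" "0 \<le> R2" "0 \<le> G3" "0 < C1" "0 < L1"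
      "\<And>s. s > 0 \<Longrightarrow> val (N R1 R2 G3 C1 L1) s = biq x s" by metis
    then show "\<exists>v\<in>val ` \<N>. \<forall>s>0. v s = biq x s"
      using assms(2) by (intro bexI[of _ "val (N R1 R2 G3 C1 L1)"]) auto
  qed
qed

lemma fills_open_box3:
  assumes "fills_open N" "\<And>R1 R2 G3 R4 C1 L1 L2. 0 \<le> R1 \<Longrightarrow> 0 \<le> R2 \<Longrightarrow> 0 \<le> G3 \<Longrightarrow> 0 \<le> R4 \<Longrightarrow> 0 < C1 \<Longrightarrow> 0 < L1 \<Longrightarrow> 0 < L2 \<Longrightarrow>
      M R1 R2 G3 R4 C1 L1 L2 \<in> \<N> \<and> (\<forall>s. val (M R1 R2 G3 R4 C1 L1 L2) s =
        radd (Some R4) (rpar (Some (L2 * s)) (val (N R1 R2 G3 C1 L1) s)))"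
  shows "coeff_box 3 (val ` \<N>)"
proof -
  obtain U x0 where U: "open U" "x0 \<in> U" "\<And>x. x \<in> U \<Longrightarrow> coeffs_pos x"
    "\<And>x. x \<in> U \<Longrightarrow> net_realizes N x"
    using assms(1) unfolding fills_open_def by blast
  show ?thesis
  proof (rule box_inductor[OF U(1-3)])
    fix x and r l :: real assume x: "x \<in> U" and r: "0 < r" and l: "0 < l"
    from net_realizesE[OF U(4)[OF x]] obtain R1 R2 G3 C1 L1 where *: "0 \<le> R1" "0 \<le> R2" "0 \<le> G3" "0 < C1" "0 < L1"
      "\<And>s. s > 0 \<Longrightarrow> val (N R1 R2 G3 C1 L1) s = biq x s" by metis
    have "M R1 R2 G3 r C1 L1 l \<in> \<N>" "\<forall>s. val (M R1 R2 G3 r C1 L1 l) s =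
        radd (Some r) (rpar (Some (l * s)) (val (N R1 R2 G3 C1 L1) s))"
      using assms(2)[OF *(1-3) less_imp_le[OF r] *(4,5) l] by auto
    then show "\<exists>v\<in>val ` \<N>. \<forall>s>0. v s = radd (Some r) (rpar (Some (l * s)) (biq x s))"
      using * by (intro bexI[of _ "val (M R1 R2 G3 r C1 L1 l)"]) auto
  qed
qed

lemma box_N6: "coeff_box 2 (val ` \<N>6)" and box_N7: "coeff_box 2 (val ` \<N>7)" and box_N8: "coeff_box 2 (val ` \<N>8)" and box_N9: "coeff_box 2 (val ` \<N>9)"
  by (rule fills_open_box2[OF fills_open_net6], unfold \<N>6_def net6_def, blast)
    (rule fills_open_box2[OF fills_open_net7], unfold \<N>7_def net7_def, blast,
     rule fills_open_box2[OF fills_open_net8], unfold \<N>8_def net8_def, blast,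
     rule fills_open_box2[OF fills_open_net9], unfold \<N>9_def net9_def, blast)

lemma box_N18: "coeff_box 3 (val ` \<N>18)"
  by (rule fills_open_box3[OF fills_open_net6, of "\<lambda>R1 R2 G3 R4 C1 L1 L2. net10 R1 R2 G3 R4 0 C1 L1 L2"])
    (unfold \<N>18_def, rule conjI, blast, simp add: net10_def net6_def)

lemma box_N21: "coeff_box 3 (val ` \<N>21)"
  by (rule fills_open_box3[OF fills_open_net7, of "\<lambda>R1 R2 G3 R4 C1 L1 L2. net11 R1 R2 G3 R4 0 C1 L1 L2"])
    (unfold \<N>21_def, rule conjI, blast, simp add: net11_def net7_def)

lemma box_N24: "coeff_box 3 (val ` \<N>24)"
  by (rule fills_open_box3[OF fills_open_net8, of "\<lambda>R1 R2 G3 R4 C1 L1 L2. net12 R1 R2 G3 R4 0 C1 L1 L2"])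
    (unfold \<N>24_def, rule conjI, blast, simp add: net12_def net8_def)

lemma box_N27: "coeff_box 3 (val ` \<N>27)"
  by (rule fills_open_box3[OF fills_open_net9, of "\<lambda>R1 R2 G3 R4 C1 L1 L2. net13 R1 R2 G3 R4 0 C1 L1 L2"])
    (unfold \<N>27_def, rule conjI, blast, simp add: net13_def net9_def)

lemma rl_int_net5:
  assumes "rl_int x"
  obtains R1 R2 G3 L1 L2 where "0 \<le> R1" "0 < R2" "0 \<le> G3" "0 < L1" "0 < L2"
    "\<And>s. s > 0 \<Longrightarrow> val (net5 R1 R2 G3 L1 L2) s = biq x s"
proof -
  obtain a0 a1 a2 b0 b1 b2 where xe: "x = (a0, a1, a2, b0, b1, b2)" by (metis prod_cases6)
  have "nonneg (a0, a1, a2, b0, b1, b2)" "0 \<le> a2 * b0 - a0 * b2" "0 \<le> a1 * b0 - a0 * b1" "0 \<le> a2 * b1 - a1 * b2"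
    "bres (a0, a1, a2, b0, b1, b2) < 0"
    using assms unfolding xe by auto
  then show thesis using that unfolding xe by (rule net5_realizes) blast
qed

lemma box_N5: "coeff_box 2 (val ` \<N>5)"
proof (rule box_biq[OF open_rl_int])
  \<comment> \<open>Here A = 2, B = 1, D = 5, and the resultant is -1.\<close>
  show "(1, 4, 3, 1, 3, 1) \<in> {x. rl_int x}" by simp
  show "coeffs_pos x" if "x \<in> {x. rl_int x}" for x using that by (simp add: rl_int_minors)
  fix x assume "x \<in> {x. rl_int x}"
  then obtain R1 R2 G3 L1 L2 where *: "0 \<le> R1" "0 < R2" "0 \<le> G3" "0 < L1" "0 < L2"
    "\<And>s. s > 0 \<Longrightarrow> val (net5 R1 R2 G3 L1 L2) s = biq x s" by (auto elim: rl_int_net5)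
  have "net5 R1 R2 G3 L1 L2 \<in> \<N>5" using * unfolding \<N>5_def net5_def by blast
  then show "\<exists>v\<in>val ` \<N>5. \<forall>s>0. v s = biq x s" using *(6) by blast
qed

text \<open>In the variable 1 / s the capacitor in front becomes an inductor, so that
  \<open>box_inductor\<close> applies.\<close>

lemma box_N30: "coeff_box 3 (val ` \<N>30)"
proof (rule box_flip)
  show "coeff_box 3 ((\<lambda>N s. val N (1 / s)) ` \<N>30)"
  proof (rule box_inductor)
    show "open {x. rl_int (bflip x)}"
      using open_vimage[OF open_rl_int continuous_bflip_bswap(1)] by (simp add: vimage_def)
    \<comment> \<open>The reversal of the vector used for \<open>\<N>5\<close>.\<close>
    show "(3, 4, 1, 1, 3, 1) \<in> {x. rl_int (bflip x)}" by simp
    show "coeffs_pos x" if "x \<in> {x. rl_int (bflip x)}" for x using that rl_int_minors[of "bflip x"] by simp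
    fix x and r l :: real assume "x \<in> {x. rl_int (bflip x)}" and rl: "0 < r" "0 < l"
    then obtain R1 R2 G3 L1 L2 where *: "0 \<le> R1" "0 < R2" "0 \<le> G3" "0 < L1" "0 < L2"
      "\<And>s. s > 0 \<Longrightarrow> val (net5 R1 R2 G3 L1 L2) s = biq (bflip x) s" by (auto elim: rl_int_net5)
    let ?N = "net14 R1 R2 G3 r 0 (1 / l) L1 L2"
    have "0 \<le> r" "0 < 1 / l" using rl by simp_all
    then have "?N \<in> \<N>30" using * unfolding \<N>30_def by blast
    moreover have "val ?N (1 / s) = radd (Some r) (rpar (Some (l * s)) (biq x s))" if s: "s > 0" for s
    proof -
      have "val ?N (1 / s) = radd (Some r) (rpar (rinv (Some (1 / l * (1 / s)))) (val (net5 R1 R2 G3 L1 L2) (1 / s)))"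
        by (simp add: net14_def net5_def)
      also have "rinv (Some (1 / l * (1 / s))) = Some (l * s)" using rl s by (simp add: rinv_def)
      also have "val (net5 R1 R2 G3 L1 L2) (1 / s) = biq x s" using *(6)[of "1 / s"] s by (simp add: biq_flip_inv)
      finally show ?thesis .
    qed
    ultimately show "\<exists>v\<in>(\<lambda>N s. val N (1 / s)) ` \<N>30. \<forall>s>0. v s = radd (Some r) (rpar (Some (l * s)) (biq x s))"
      by (intro bexI[of _ "\<lambda>s. val ?N (1 / s)"]) auto
  qed
  show "\<exists>w\<in>val ` \<N>30. \<forall>s>0. w s = v (1 / s)" if "v \<in> (\<lambda>N s. val N (1 / s)) ` \<N>30" for v
    using that by auto
qed

lemma box_N1: "coeff_box 0 (val ` \<N>1)"
proof (rule boxI[of _ "\<lambda>_. 1"])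
  fix C :: "nat \<Rightarrow> nat \<Rightarrow> real" assume "\<And>k i. i \<le> 2 * 0 + 1 \<Longrightarrow> 0 < C k i"
  from this[of 0 0] this[of 1 0] have "Resistor (C 0 0 / C 0 1) \<in> \<N>1" by (simp add: \<N>1_def)
  then show "\<exists>k. \<exists>v\<in>val ` \<N>1. \<forall>s>0. v s = Some (coeff_quot 0 (C k) s)"
    by (intro exI[of _ 0] bexI[of _ "val (Resistor (C 0 0 / C 0 1))"]) (auto simp: coeff_quot_def psum_def)
qed simp

lemma box_N2: "coeff_box 1 (val ` \<N>2)"
\<comment> \<open>The base vector belongs to (2 + s) / (1 + s), for which a0 b1 - a1 b0 = 1 is
  positive.\<close>
proof (rule boxI[of _ "\<lambda>i. if i = 0 then 2 else 1"])
  fix C :: "nat \<Rightarrow> nat \<Rightarrow> real"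
  assume lim: "\<And>i. i \<le> 2 * 1 + 1 \<Longrightarrow> (\<lambda>k. C k i) \<longlonglongrightarrow> (if i = 0 then 2 else 1)"
    and pos: "\<And>k i. i \<le> 2 * 1 + 1 \<Longrightarrow> 0 < C k i"
  have "(\<lambda>k. C k 0 * C k 3 - C k 1 * C k 2) \<longlonglongrightarrow> 2 * 1 - 1 * 1"
    using lim[of 0] lim[of 1] lim[of 2] lim[of 3] by (intro tendsto_intros) auto
  then have "\<forall>\<^sub>F k in sequentially. 0 < C k 0 * C k 3 - C k 1 * C k 2"
    by (rule order_tendstoD) simp
  then obtain k where k: "0 < C k 0 * C k 3 - C k 1 * C k 2"
    using eventually_happens trivial_limit_sequentially by blast
  define a0 a1 b0 b1 where "a0 = C k 0" and "a1 = C k 1" and "b0 = C k 2" and "b1 = C k 3"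
  have p: "0 < a0" "0 < a1" "0 < b0" "0 < b1" "0 < a0 * b1 - a1 * b0"
    using pos[of 0 k] pos[of 1 k] pos[of 2 k] pos[of 3 k] k by (simp_all add: a0_def a1_def b0_def b1_def)
  define c where "c = (a0 * b1 - a1 * b0) / b1\<^sup>2"
  have c: "0 < c" using p by (simp add: c_def)
  let ?N = "Resistor (a1 / b1) \<^bold>+ (Conductor (b0 / b1 / c) \<parallel> Capacitor (1 / c))"
  have "0 \<le> a1 / b1" "0 \<le> b0 / b1 / c" "0 < 1 / c" using p c by simp_all
  then have "?N \<in> \<N>2" unfolding \<N>2_def by blast
  moreover have "val ?N s = Some (coeff_quot 1 (C k) s)" if s: "s > 0" for s
  proof -
    have "val ?N s = Some (a1 / b1 + c / (b0 / b1 + s))"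
      using val_N2[of c "b0 / b1" s "a1 / b1"] p c s by simp
    also have "a1 / b1 + c / (b0 / b1 + s) = (a0 + a1 * s) / (b0 + b1 * s)"
    proof -
      define d where "d = b0 + b1 * s"
      have d: "0 < d" using p s by (simp add: d_def add_pos_pos)
      have "b0 / b1 + s = d / b1" using p by (simp add: d_def field_simps)
      then have "c / (b0 / b1 + s) = (a0 * b1 - a1 * b0) / (b1 * d)"
        using p by (simp add: c_def power2_eq_square)
      then have "a1 / b1 + c / (b0 / b1 + s) = (a1 * d + (a0 * b1 - a1 * b0)) / (b1 * d)"
        using p d by (simp add: add_divide_distrib)
      also have "a1 * d + (a0 * b1 - a1 * b0) = b1 * (a0 + a1 * s)"
        by (simp add: d_def algebra_simps)
      finally show ?thesis using p by (simp add: d_def)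
    qed
    also have "\<dots> = coeff_quot 1 (C k) s"
      by (simp add: coeff_quot_def psum_def a0_def a1_def b0_def b1_def eval_nat_numeral)
    finally show ?thesis .
  qed
  ultimately show "\<exists>k. \<exists>v\<in>val ` \<N>2. \<forall>s>0. v s = Some (coeff_quot 1 (C k) s)" by blast
qed auto

lemma box_N3: "coeff_box 1 (val ` \<N>3)"
proof (rule box_flip[OF box_N2])
  fix v assume "v \<in> val ` \<N>2"
  then obtain R1 G2 C1 where *: "R1 \<ge> 0" "G2 \<ge> 0" "C1 > 0"
    "v = val (Resistor R1 \<^bold>+ (Conductor G2 \<parallel> Capacitor C1))" (is "v = val ?N")
    unfolding \<N>2_def by blast
  have "0 < 1 / C1" using * by simp
  then have "trans_i ?N \<in> \<N>3" using * unfolding \<N>3_def by auto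
  moreover have "val (trans_i ?N) s = v (1 / s)" if "s > 0" for s
    using val_trans_i[of ?N s] that * by simp
  ultimately show "\<exists>w\<in>val ` \<N>3. \<forall>s>0. w s = v (1 / s)" by blast
qed

lemma box_trans_p:
  assumes "coeff_box n (val ` \<N>)" "\<And>N. N \<in> \<N> \<Longrightarrow> sp_network N"
  shows "coeff_box n (val ` trans_p ` \<N>)"
proof (rule box_pd[OF assms(1)])
  fix v assume "v \<in> val ` \<N>"
  then obtain N where N: "N \<in> \<N>" "v = val N" by blast
  then show "\<exists>w\<in>val ` trans_p ` \<N>. \<forall>s>0. w s = pd v s"
    using val_trans_p[OF assms(2)] by (intro bexI[of _ "val (trans_p N)"]) (auto simp: pd_def)
qed

section \<open>Genericity of the classes and the final assembly\<close>

lemmas class_defs = \<N>1_def \<N>2_def \<N>3_def \<N>5_def \<N>6_def \<N>7_def \<N>8_def \<N>9_def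
  \<N>17_def \<N>18_def \<N>20_def \<N>21_def \<N>22_def \<N>23_def \<N>24_def \<N>25_def \<N>26_def \<N>27_def \<N>29_def \<N>30_def
  net10_def net11_def net12_def net13_def net14_def

text \<open>Each class lacks one of the five resistors of its parent, which leaves at most four
  besides the three storage elements; the bound is 8 = 2 * 3 + 2.\<close>

lemma num_nets3: "N \<in> nets3 \<Longrightarrow> num_storage N = 3 \<and> num_elements N < 8"
  unfolding nets3_def class_defs by (auto simp: num_storage_def num_elements_def)

lemma num_nets012:
  "N \<in> \<N>1 \<Longrightarrow> num_storage N = 0 \<and> num_elements N < 2"
  "N \<in> \<N>2 \<union> \<N>3 \<Longrightarrow> num_storage N = 1 \<and> num_elements N < 4"
  "N \<in> \<N>5 \<union> \<N>6 \<union> \<N>7 \<union> \<N>8 \<union> \<N>9 \<Longrightarrow> num_storage N = 2 \<and> num_elements N < 6"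
  unfolding class_defs by (auto simp: num_storage_def num_elements_def)

lemma generic_nets3:
  assumes "coeff_box 3 (val ` \<N>)" "\<N> \<subseteq> nets3"
  shows "generic \<N>" "generic (trans_p ` \<N>)"
proof -
  show "generic \<N>" using assms num_nets3 sp_nets3 by (intro generic_box[of 3]) auto
  have "num_storage (trans_p N) = num_storage N" "num_elements (trans_p N) = num_elements N" for N
    by (simp_all add: num_storage_def num_elements_def)
  then show "generic (trans_p ` \<N>)"
    using assms num_nets3 sp_nets3 sp_trans_p by (intro generic_box[of 3] box_trans_p) auto
qed

lemma network_class_trans_p: "network_class \<N> \<Longrightarrow> network_class (trans_p ` \<N>)"
  unfolding network_class_def using form_trans_p by blast

text \<open>
  A single one of the classes with three storage elements need not be generic: \<open>G1 = 0\<close> in \<open>\<N>25\<close> forces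
  \<open>q3 = 0\<close>, so its realizability set has dimension at most \<open>7\<close>. Networks of the same form are therefore
  collected in one class, whose dimension is \<open>8\<close> because of the networks with \<open>R5 = 0\<close>.
\<close>

definition merged :: "network set set" where
  "merged = {\<N>17 \<union> \<N>18, \<N>20 \<union> \<N>21, \<N>22 \<union> \<N>23 \<union> \<N>24, \<N>25 \<union> \<N>26 \<union> \<N>27, \<N>29 \<union> \<N>30}"

lemma Union_merged: "\<Union>merged = nets3"
  by (auto simp: merged_def nets3_def)

lemma form_nets:
  "form (net10 R1 R2 G3 R4 R5 C1 L1 L2) = net10 1 1 1 1 1 1 1 1"
  "form (net11 R1 R2 G3 R4 R5 C1 L1 L2) = net11 1 1 1 1 1 1 1 1"
  "form (net12 G1 G2 R3 R4 R5 C1 L1 L2) = net12 1 1 1 1 1 1 1 1"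
  "form (net13 G1 G2 R3 R4 R5 C1 L1 L2) = net13 1 1 1 1 1 1 1 1"
  "form (net14 R1 R2 G3 R4 R5 C1 L1 L2) = net14 1 1 1 1 1 1 1 1"
  by (simp_all add: net10_def net11_def net12_def net13_def net14_def)

lemma network_classI: "(\<And>N. N \<in> \<N> \<Longrightarrow> form N = M) \<Longrightarrow> network_class \<N>"
  by (simp add: network_class_def)

lemma merged_class:
  assumes "\<N> \<in> merged" shows "network_class \<N>" "coeff_box 3 (val ` \<N>)"
proof -
  show "network_class \<N>"
    using assms unfolding merged_def
  proof (elim insertE emptyE)
    assume "\<N> = \<N>17 \<union> \<N>18"
    then show ?thesis
      by (intro network_classI[of _ "net10 1 1 1 1 1 1 1 1"]) (auto simp: \<N>17_def \<N>18_def form_nets)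
  next
    assume "\<N> = \<N>20 \<union> \<N>21"
    then show ?thesis
      by (intro network_classI[of _ "net11 1 1 1 1 1 1 1 1"]) (auto simp: \<N>20_def \<N>21_def form_nets)
  next
    assume "\<N> = \<N>22 \<union> \<N>23 \<union> \<N>24"
    then show ?thesis
      by (intro network_classI[of _ "net12 1 1 1 1 1 1 1 1"]) (auto simp: \<N>22_def \<N>23_def \<N>24_def form_nets)
  next
    assume "\<N> = \<N>25 \<union> \<N>26 \<union> \<N>27"
    then show ?thesis
      by (intro network_classI[of _ "net13 1 1 1 1 1 1 1 1"]) (auto simp: \<N>25_def \<N>26_def \<N>27_def form_nets)
  next
    assume "\<N> = \<N>29 \<union> \<N>30"
    then show ?thesis
      by (intro network_classI[of _ "net14 1 1 1 1 1 1 1 1"]) (auto simp: \<N>29_def \<N>30_def form_nets)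
  qed
  have "coeff_box 3 (val ` (\<N>17 \<union> \<N>18))" by (rule box_mono[OF box_N18]) (simp add: image_Un)
  moreover have "coeff_box 3 (val ` (\<N>20 \<union> \<N>21))" by (rule box_mono[OF box_N21]) (simp add: image_Un)
  moreover have "coeff_box 3 (val ` (\<N>22 \<union> \<N>23 \<union> \<N>24))" by (rule box_mono[OF box_N24]) (simp add: image_Un)
  moreover have "coeff_box 3 (val ` (\<N>25 \<union> \<N>26 \<union> \<N>27))" by (rule box_mono[OF box_N27]) (simp add: image_Un)
  moreover have "coeff_box 3 (val ` (\<N>29 \<union> \<N>30))" by (rule box_mono[OF box_N30]) (simp add: image_Un)
  ultimately show "coeff_box 3 (val ` \<N>)" using assms unfolding merged_def by auto
qed

lemma low_classes:
  assumes "\<N> \<in> {\<N>1, \<N>2, \<N>3, \<N>5, \<N>6, \<N>7, \<N>8, \<N>9}"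
  shows "network_class \<N>" "generic \<N>"
proof -
  show "network_class \<N>"
    using assms by (elim insertE emptyE; simp only: network_class_def class_defs; force)
  have sp: "sp_network N" if "N \<in> \<N>" for N using that assms sp_nets012 unfolding nets012_def by blast
  show "generic \<N>"
    using assms
  proof (elim insertE emptyE)
    assume "\<N> = \<N>1" then show ?thesis using sp num_nets012(1) box_N1 by (intro generic_box[of 0]) (auto simp: numeral_2_eq_2)
  next
    assume "\<N> = \<N>2" then show ?thesis using sp num_nets012(2) box_N2 by (intro generic_box[of 1]) auto
  next
    assume "\<N> = \<N>3" then show ?thesis using sp num_nets012(2) box_N3 by (intro generic_box[of 1]) auto
  next
    assume "\<N> = \<N>5" then show ?thesis using sp num_nets012(3) box_N5 by (intro generic_box[of 2]) auto
  next
    assume "\<N> = \<N>6" then show ?thesis using sp num_nets012(3) box_N6 by (intro generic_box[of 2]) auto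
  next
    assume "\<N> = \<N>7" then show ?thesis using sp num_nets012(3) box_N7 by (intro generic_box[of 2]) auto
  next
    assume "\<N> = \<N>8" then show ?thesis using sp num_nets012(3) box_N8 by (intro generic_box[of 2]) auto
  next
    assume "\<N> = \<N>9" then show ?thesis using sp num_nets012(3) box_N9 by (intro generic_box[of 2]) auto
  qed
qed

lemma generating: "generating_set 1 2 (nets012 \<union> nets3 \<union> trans_p ` nets3)"
  unfolding generating_set_def
proof (intro conjI ballI)
  fix N assume N: "N \<in> nets012 \<union> nets3 \<union> trans_p ` nets3"
  then show "sp_network N" using sp_nets012 sp_nets3 sp_trans_p by blast
  have "num_storage M \<le> 3" if "M \<in> nets012" for M
    using that num_nets012[of M] unfolding nets012_def by auto
  moreover have "num_storage (trans_p M) = num_storage M" for M by (simp add: num_storage_def)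
  ultimately show "num_storage N \<le> 1 + 2" using N num_nets3 by (auto simp: numeral_3_eq_3)
next
  fix Z assume "Z \<in> \<Z> 1 2"
  then obtain N where N: "sp_network N" "num_capacitors N \<le> 1" "num_inductors N \<le> 2" "impedance N = Some Z"
    unfolding \<Z>_def by blast
  then obtain M where "M \<in> nets012 \<union> nets3 \<union> trans_p ` nets3" "sp_network M" "\<forall>s>0. val M s = val N s"
    using network_realized by blast
  then show "\<exists>M\<in>nets012 \<union> nets3 \<union> trans_p ` nets3. impedance M = Some Z"
    using impedance_eqI[of M N] N by auto
qed

theorem theorem20:
  shows "let \<T> = {\<N>17, \<N>18, \<N>20, \<N>21, \<N>22, \<N>23, \<N>24, \<N>25, \<N>26, \<N>27, \<N>29, \<N>30};
             \<C> = {\<N>1, \<N>2, \<N>3, \<N>5, \<N>6, \<N>7, \<N>8, \<N>9} \<union> \<T> \<union> {trans_p ` \<N> | \<N>. \<N> \<in> \<T>}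
         in minimal_generating_set 1 2 (\<Union>\<C>)"
proof -
  let ?T = "{\<N>17, \<N>18, \<N>20, \<N>21, \<N>22, \<N>23, \<N>24, \<N>25, \<N>26, \<N>27, \<N>29, \<N>30}"
  let ?L = "{\<N>1, \<N>2, \<N>3, \<N>5, \<N>6, \<N>7, \<N>8, \<N>9}"
  have T: "\<Union>?T = nets3" by (simp add: nets3_def Un_assoc)
  have L: "\<Union>?L = nets012" by (simp add: nets012_def Un_assoc)
  have TP: "\<Union>{trans_p ` \<N> | \<N>. \<N> \<in> S} = trans_p ` \<Union>S" for S by blast
  have eq: "\<Union>(?L \<union> ?T \<union> {trans_p ` \<N> | \<N>. \<N> \<in> ?T}) = nets012 \<union> nets3 \<union> trans_p ` nets3"
    unfolding Union_Un_distrib TP T L ..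
  \<comment> \<open>The same networks regrouped: the classes of three storage elements enter only
    through the merged ones, which are generic.\<close>
  have eq': "nets012 \<union> nets3 \<union> trans_p ` nets3 = \<Union>(?L \<union> merged \<union> {trans_p ` \<N> | \<N>. \<N> \<in> merged})"
    unfolding Union_Un_distrib TP Union_merged L ..
  have "network_class \<N> \<and> generic \<N>" if "\<N> \<in> ?L \<union> merged \<union> {trans_p ` \<N> | \<N>. \<N> \<in> merged}" for \<N>
  proof -
    have m: "network_class \<M> \<and> generic \<M>" "network_class (trans_p ` \<M>) \<and> generic (trans_p ` \<M>)" if "\<M> \<in> merged" for \<M>
    proof -
      have "\<M> \<subseteq> nets3" using that Union_merged by blast
      then show "network_class \<M> \<and> generic \<M>" "network_class (trans_p ` \<M>) \<and> generic (trans_p ` \<M>)"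
        using merged_class[OF that] generic_nets3 network_class_trans_p by blast+
    qed
    from that consider "\<N> \<in> ?L" | "\<N> \<in> merged" | \<M> where "\<M> \<in> merged" "\<N> = trans_p ` \<M>" by blast
    then show ?thesis
    proof cases
      case 1 then show ?thesis using low_classes by auto
    next
      case 2 then show ?thesis by (rule m(1))
    next
      case 3 then show ?thesis using m(2) by simp
    qed
  qed
  then have "minimal_generating_set 1 2 (nets012 \<union> nets3 \<union> trans_p ` nets3)"
    unfolding minimal_generating_set_def using generating eq' by blast
  then show ?thesis unfolding Let_def eq .
qed

end
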